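(* Let $p\ge 3$ be a prime. Any $S_\infty$ orbit equivalence relation can be Borel reduced to isomorphism between profinite nil-2 groups of exponent $p$. That is, let $\mathcal M$ be the space of all $N\in\mathcal N(\widehat F_\omega)$ such that $\widehat F_\omega/N$ is nilpotent of class $2$ and of exponent $p$. For every Polish space $X$ with a continuous action of $S_\infty$, with orbit equivalence relation $E$, there is a Borel function $g:X\to\mathcal M$ such that for all $u,v\in X$: $u\,E\,v$ if and only if $\widehat F_\omega/g(u)$ and $\widehat F_\omega/g(v)$ are isomorphic as topological groups.
   Context: $S_\infty$ is the Polish group of permutations of $\omega$. An $S_\infty$ orbit equivalence relation is the orbit equivalence relation of a continuous action of $S_\infty$ on a Polish space. A profinite group is a compact, totally disconnected topological group; all profinite groups here are countably based. $\widehat F_\omega$ denotes the free profinite group on a sequence of generators $x_0,x_1,x_2,\ldots$ converging to $1$: it is the completion (inverse limit of the quotients $F_\omega/U$) of the free group $F_\omega$ on $x_0,x_1,\ldots$ with respect to the system of all normal subgroups $U$ of finite index in $F_\omega$ that contain $x_i$ for almost every $i$. Every countably based profinite group is isomorphic to $\widehat F_\omega/R$ for some closed normal subgroup $R$ of $\widehat F_\omega$. $\mathcal N(\widehat F_\omega)$ is the set of closed normal subgroups of $\widehat F_\omega$. Fixing a bi-invariant metric $\delta$ on $\widehat F_\omega$ compatible with its topology, $\mathcal N(\widehat F_\omega)$ is equipped with the Hausdorff metric $\delta_H(A,B)=\max(\sup_{x\in A}\inf_{y\in B}\delta(x,y),\ \sup_{y\in B}\inf_{x\in A}\delta(x,y))$,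 which makes it a compact Polish space. $\mathcal M$ carries the subspace topology. A group is nilpotent of class $2$ (nil-2) if it satisfies the law $[[x,y],z]=1$ (equivalently, the commutator subgroup is contained in the centre); it has exponent $p$ if it satisfies the law $x^p=1$. *)

theory Defs
  imports "HOL-Analysis.Analysis" "HOL-Algebra.Group_Action" "HOL-Algebra.Product_Groups"
begin

section \<open>Topology\<close>

definition polish_topology :: "'a topology \<Rightarrow> bool"
  where "polish_topology X \<longleftrightarrow> completely_metrizable_space X \<and> separable_space X"

definition borel_of :: "'a topology \<Rightarrow> 'a measure"
  where "borel_of X = sigma (topspace X) {U. openin X U}"

definition quotient_topology :: "'a topology \<Rightarrow> ('a \<Rightarrow> 'b) \<Rightarrow> 'b topology"
  where "quotient_topology X q =
    topology (\<lambda>W. W \<subseteq> q ` topspace X \<and> openin X {x \<in> topspace X. q x \<in> W})"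

lemma openin_quotient_topology:
  "openin (quotient_topology X q) W \<longleftrightarrow>
     W \<subseteq> q ` topspace X \<and> openin X {x \<in> topspace X. q x \<in> W}"
proof -
  have "istopology (\<lambda>W. W \<subseteq> q ` topspace X \<and> openin X {x \<in> topspace X. q x \<in> W})"
    unfolding istopology_def
  proof (intro conjI allI impI)
    fix S T
    assume *: "S \<subseteq> q ` topspace X \<and> openin X {x \<in> topspace X. q x \<in> S}"
      "T \<subseteq> q ` topspace X \<and> openin X {x \<in> topspace X. q x \<in> T}"
    show "S \<inter> T \<subseteq> q ` topspace X" using * by blast
    have "{x \<in> topspace X. q x \<in> S \<inter> T} =
      {x \<in> topspace X. q x \<in> S} \<inter> {x \<in> topspace X. q x \<in> T}" by blast
    then show "openin X {x \<in> topspace X. q x \<in> S \<inter> T}"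
      using * by (simp only: openin_Int)
  next
    fix \<K>
    assume *: "\<forall>K\<in>\<K>. K \<subseteq> q ` topspace X \<and> openin X {x \<in> topspace X. q x \<in> K}"
    show "\<Union>\<K> \<subseteq> q ` topspace X" using * by blast
    have "{x \<in> topspace X. q x \<in> \<Union>\<K>} = (\<Union>K\<in>\<K>. {x \<in> topspace X. q x \<in> K})" by blast
    then show "openin X {x \<in> topspace X. q x \<in> \<Union>\<K>}" using * by auto
  qed
  then show ?thesis by (simp add: quotient_topology_def topology_inverse')
qed

lemma topspace_quotient_topology [simp]: "topspace (quotient_topology X q) = q ` topspace X"
proof
  have "{x \<in> topspace X. q x \<in> q ` topspace X} = topspace X" by blast
  then have "openin (quotient_topology X q) (q ` topspace X)"
    by (simp add: openin_quotient_topology)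
  then show "q ` topspace X \<subseteq> topspace (quotient_topology X q)" by (rule openin_subset)
  show "topspace (quotient_topology X q) \<subseteq> q ` topspace X"
    using openin_topspace[of "quotient_topology X q"]
    by (simp only: openin_quotient_topology[of X q])
qed

lemma quotient_map_quotient_topology: "quotient_map X (quotient_topology X q) q"
  by (auto simp: quotient_map_def openin_quotient_topology)

section \<open>The Polish group of permutations of the natural numbers\<close>

definition Sinf :: "(nat \<Rightarrow> nat) monoid"
  where "Sinf = BijGroup UNIV"

definition Sinf_top :: "(nat \<Rightarrow> nat) topology"
  where "Sinf_top = subtopology (product_topology (\<lambda>_. discrete_topology UNIV) UNIV) (carrier Sinf)"

definition continuous_Sinf_action :: "'a topology \<Rightarrow> ((nat \<Rightarrow> nat) \<Rightarrow> 'a \<Rightarrow> 'a) \<Rightarrow> bool"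
  where "continuous_Sinf_action X \<phi> \<longleftrightarrow>
    group_action Sinf (topspace X) \<phi> \<and>
    continuous_map (prod_topology Sinf_top X) X (\<lambda>(\<sigma>, x). \<phi> \<sigma> x)"

definition orbit_equiv :: "((nat \<Rightarrow> nat) \<Rightarrow> 'a \<Rightarrow> 'a) \<Rightarrow> 'a \<Rightarrow> 'a \<Rightarrow> bool"
  where "orbit_equiv \<phi> u v \<longleftrightarrow> v \<in> orbit Sinf \<phi> u"

section \<open>The free group on countably many generators\<close>

text \<open>Elements are the reduced words in the letters \<^term>\<open>(i, True)\<close>, standing for the generator
  \<open>x\<^sub>i\<close>, and \<^term>\<open>(i, False)\<close>, standing for its inverse.\<close>

type_synonym word = "(nat \<times> bool) list"

definition inv_letter :: "nat \<times> bool \<Rightarrow> nat \<times> bool"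
  where "inv_letter a = (fst a, \<not> snd a)"

fun reduced :: "word \<Rightarrow> bool" where
  "reduced [] = True"
| "reduced [a] = True"
| "reduced (a # b # w) \<longleftrightarrow> b \<noteq> inv_letter a \<and> reduced (b # w)"

fun cons_reduce :: "nat \<times> bool \<Rightarrow> word \<Rightarrow> word" where
  "cons_reduce a [] = [a]"
| "cons_reduce a (b # w) = (if b = inv_letter a then w else a # b # w)"

definition free_group :: "word monoid"
  where "free_group = \<lparr>carrier = {w. reduced w}, mult = foldr cons_reduce, one = []\<rparr>"

definition free_gen :: "nat \<Rightarrow> word"
  where "free_gen i = [(i, True)]"

lemma inv_letter_inv_letter [simp]: "inv_letter (inv_letter a) = a"
  by (simp add: inv_letter_def)

lemma reduced_Cons: "reduced (a # w) \<Longrightarrow> reduced w"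
  by (cases w) auto

lemma reduced_cons_reduce: "reduced w \<Longrightarrow> reduced (cons_reduce a w)"
  by (cases w) (auto dest: reduced_Cons)

lemma reduced_foldr_cons_reduce: "reduced w \<Longrightarrow> reduced (foldr cons_reduce u w)"
  by (induction u) (auto intro: reduced_cons_reduce)

lemma cons_reduce_cancel: "reduced w \<Longrightarrow> cons_reduce a (cons_reduce (inv_letter a) w) = w"
  by (cases w rule: reduced.cases) auto

lemma foldr_cons_reduce_cons_reduce:
  assumes "reduced w"
  shows "foldr cons_reduce (cons_reduce a u) w = cons_reduce a (foldr cons_reduce u w)"
  using assms cons_reduce_cancel[OF reduced_foldr_cons_reduce]
  by (cases u) auto

lemma foldr_cons_reduce_assoc:
  "reduced w \<Longrightarrow> foldr cons_reduce (foldr cons_reduce u v) w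
     = foldr cons_reduce u (foldr cons_reduce v w)"
  by (induction u) (auto simp: foldr_cons_reduce_cons_reduce)

lemma foldr_cons_reduce_Nil: "reduced w \<Longrightarrow> foldr cons_reduce w [] = w"
proof (induction w)
  case (Cons a w)
  then show ?case by (cases w) auto
qed simp

lemma foldr_cons_reduce_inverse: "foldr cons_reduce (rev (map inv_letter w)) w = []"
proof -
  have "foldr cons_reduce (rev (map inv_letter w)) (w @ v) = v" for v
    by (induction w) auto
  from this[of "[]"] show ?thesis by simp
qed

lemma group_free_group: "group free_group"
proof (rule groupI)
  fix x assume "x \<in> carrier free_group"
  then show "\<exists>y\<in>carrier free_group. y \<otimes>\<^bsub>free_group\<^esub> x = \<one>\<^bsub>free_group\<^esub>"
    apply (intro bexI[of _ "foldr cons_reduce (rev (map inv_letter x)) []"])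
     apply (auto simp: free_group_def foldr_cons_reduce_assoc foldr_cons_reduce_inverse
        intro: reduced_foldr_cons_reduce)
    done
qed (auto simp: free_group_def foldr_cons_reduce_assoc intro: reduced_foldr_cons_reduce)

section \<open>The free profinite group on a sequence of generators converging to 1\<close>

definition fin_index_nsubgroups :: "word set set"
  where "fin_index_nsubgroups = {U. U \<lhd> free_group \<and> finite (carrier (free_group Mod U)) \<and>
    finite {i. free_gen i \<notin> U}}"

text \<open>The inverse limit of the finite groups \<open>F/U\<close>. For \<open>U \<subseteq> V\<close> the connecting map
  \<open>F/U \<rightarrow> F/V\<close> sends a coset of \<open>U\<close> to the unique coset of \<open>V\<close> that includes it.\<close>

definition Fhat :: "(word set \<Rightarrow> word set) monoid"
  where "Fhat = (product_group fin_index_nsubgroups (\<lambda>U. free_group Mod U))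
    \<lparr>carrier := {f \<in> carrier (product_group fin_index_nsubgroups (\<lambda>U. free_group Mod U)).
      \<forall>U\<in>fin_index_nsubgroups. \<forall>V\<in>fin_index_nsubgroups. U \<subseteq> V \<longrightarrow> f U \<subseteq> f V}\<rparr>"

definition Fhat_top :: "(word set \<Rightarrow> word set) topology"
  where "Fhat_top = subtopology
    (product_topology (\<lambda>U. discrete_topology (carrier (free_group Mod U))) fin_index_nsubgroups)
    (carrier Fhat)"

lemma topspace_Fhat_top [simp]: "topspace Fhat_top = carrier Fhat"
  by (auto simp: Fhat_top_def Fhat_def)

lemma group_Fhat: "group Fhat"
proof -
  let ?I = "fin_index_nsubgroups" and ?Q = "\<lambda>U. free_group Mod U"
  let ?P = "product_group ?I ?Q"
  have nrm: "U \<lhd> free_group" if "U \<in> ?I" for U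
    using that by (simp add: fin_index_nsubgroups_def)
  have grp: "group (?Q U)" if "U \<in> ?I" for U
    using nrm[OF that] by (rule normal.factorgroup_is_group)
  interpret P: group ?P using grp by (simp add: product_group)
  have "subgroup (carrier Fhat) ?P"
  proof (rule P.subgroupI)
    show "carrier Fhat \<subseteq> carrier ?P" by (auto simp: Fhat_def)
    have "\<one>\<^bsub>?P\<^esub> \<in> carrier Fhat" using P.one_closed by (auto simp: Fhat_def)
    then show "carrier Fhat \<noteq> {}" by blast
  next
    fix f assume f: "f \<in> carrier Fhat"
    then have fP: "f \<in> carrier ?P" by (simp add: Fhat_def)
    have eq: "(inv\<^bsub>?P\<^esub> f) U = set_inv\<^bsub>free_group\<^esub> (f U)" if "U \<in> ?I" for U
    proof -
      have "(inv\<^bsub>?P\<^esub> f) U = inv\<^bsub>?Q U\<^esub> (f U)"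
        using fP that grp by (subst inv_product_group) auto
      also have "\<dots> = set_inv\<^bsub>free_group\<^esub> (f U)"
        using fP that nrm by (intro normal.inv_FactGroup) (auto simp: PiE_iff)
      finally show ?thesis .
    qed
    have "set_inv\<^bsub>free_group\<^esub> A \<subseteq> set_inv\<^bsub>free_group\<^esub> B" if "A \<subseteq> B" for A B
      using that by (auto simp: SET_INV_def)
    moreover have "inv\<^bsub>?P\<^esub> f \<in> carrier ?P" using fP by (rule P.inv_closed)
    ultimately show "inv\<^bsub>?P\<^esub> f \<in> carrier Fhat"
      using f eq by (simp add: Fhat_def)
  next
    fix f g assume fg: "f \<in> carrier Fhat" "g \<in> carrier Fhat"
    have "f \<otimes>\<^bsub>?P\<^esub> g \<in> carrier ?P" using fg by (intro P.m_closed) (auto simp: Fhat_def)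
    moreover have "A <#>\<^bsub>free_group\<^esub> B \<subseteq> A' <#>\<^bsub>free_group\<^esub> B'" if "A \<subseteq> A'" "B \<subseteq> B'" for A A' B B'
      using that by (auto simp: set_mult_def)
    ultimately show "f \<otimes>\<^bsub>?P\<^esub> g \<in> carrier Fhat"
      using fg by (simp add: Fhat_def FactGroup_def)
  qed
  then have "group (?P\<lparr>carrier := carrier Fhat\<rparr>)" by (rule subgroup.subgroup_is_group[OF _ P.is_group])
  moreover have "?P\<lparr>carrier := carrier Fhat\<rparr> = Fhat" by (simp add: Fhat_def)
  ultimately show ?thesis by simp
qed

lemma compact_space_Fhat_top: "compact_space Fhat_top"
proof -
  let ?I = "fin_index_nsubgroups" and ?C = "\<lambda>U. carrier (free_group Mod U)"
  let ?T = "product_topology (\<lambda>U. discrete_topology (?C U)) ?I"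
  have fin: "finite (?C U)" if "U \<in> ?I" for U
    using that by (simp add: fin_index_nsubgroups_def)
  have cmp: "compact_space ?T"
    using fin by (auto simp: compact_space_product_topology compact_space_discrete_topology)
  have cl: "closedin ?T {f \<in> topspace ?T. f U = A}" if "U \<in> ?I" for U A
  proof -
    have "closedin ?T {f \<in> topspace ?T. f U \<in> {A} \<inter> ?C U}"
      using that by (intro closedin_continuous_map_preimage[OF continuous_map_product_projection]) auto
    moreover have "{f \<in> topspace ?T. f U \<in> {A} \<inter> ?C U} = {f \<in> topspace ?T. f U = A}"
      using that by (auto simp: PiE_iff)
    ultimately show ?thesis by simp
  qed
  have cl2: "closedin ?T {f \<in> topspace ?T. f U \<subseteq> f V}" if UV: "U \<in> ?I" "V \<in> ?I" for U V
  proof -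
    have "closedin ?T (\<Union>(A, B)\<in>{(A, B) \<in> ?C U \<times> ?C V. A \<subseteq> B}.
      {f \<in> topspace ?T. f U = A} \<inter> {f \<in> topspace ?T. f V = B})"
    proof (rule closedin_Union)
      show "finite ((\<lambda>(A, B). {f \<in> topspace ?T. f U = A} \<inter> {f \<in> topspace ?T. f V = B}) `
        {(A, B) \<in> ?C U \<times> ?C V. A \<subseteq> B})"
        by (rule finite_imageI, rule finite_subset[of _ "?C U \<times> ?C V"]) (use fin UV in auto)
      show "closedin ?T S" if S: "S \<in> (\<lambda>(A, B). {f \<in> topspace ?T. f U = A} \<inter>
        {f \<in> topspace ?T. f V = B}) ` {(A, B) \<in> ?C U \<times> ?C V. A \<subseteq> B}" for S
      proof -
        obtain A B where "S = {f \<in> topspace ?T. f U = A} \<inter> {f \<in> topspace ?T. f V = B}"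
          using S by auto
        then show ?thesis using cl UV by (metis (no_types, lifting) closedin_Int)
      qed
    qed
    moreover have "(\<Union>(A, B)\<in>{(A, B) \<in> ?C U \<times> ?C V. A \<subseteq> B}.
      {f \<in> topspace ?T. f U = A} \<inter> {f \<in> topspace ?T. f V = B}) =
      {f \<in> topspace ?T. f U \<subseteq> f V}"
      using UV by (auto simp: PiE_iff)
    ultimately show ?thesis by simp
  qed
  have eq: "carrier Fhat = topspace ?T \<inter>
     \<Inter>{{f \<in> topspace ?T. f U \<subseteq> f V} |U V. U \<in> ?I \<and> V \<in> ?I \<and> U \<subseteq> V}"
    unfolding Fhat_def by auto
  have "closedin ?T (topspace ?T \<inter>
     \<Inter>{{f \<in> topspace ?T. f U \<subseteq> f V} |U V. U \<in> ?I \<and> V \<in> ?I \<and> U \<subseteq> V})"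
  proof (cases "{{f \<in> topspace ?T. f U \<subseteq> f V} |U V. U \<in> ?I \<and> V \<in> ?I \<and> U \<subseteq> V} = {}")
    case False
    then have "closedin ?T (\<Inter>{{f \<in> topspace ?T. f U \<subseteq> f V} |U V. U \<in> ?I \<and> V \<in> ?I \<and> U \<subseteq> V})"
      using cl2 by (intro closedin_Inter) auto
    then show ?thesis by (rule closedin_Int[OF closedin_topspace])
  qed (simp only: Inter_empty Int_UNIV_right closedin_topspace)
  then have "closedin ?T (carrier Fhat)" using eq by metis
  then show ?thesis
    unfolding Fhat_top_def by (intro compact_space_subtopology closedin_compact_space[OF cmp])
qed

section \<open>Closed normal subgroups and the Hausdorff metric\<close>

definition bi_invariant :: "('a, 'b) monoid_scheme \<Rightarrow> ('a \<Rightarrow> 'a \<Rightarrow> real) \<Rightarrow> bool"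
  where "bi_invariant G \<delta> \<longleftrightarrow> (\<forall>a\<in>carrier G. \<forall>x\<in>carrier G. \<forall>y\<in>carrier G.
    \<delta> (a \<otimes>\<^bsub>G\<^esub> x) (a \<otimes>\<^bsub>G\<^esub> y) = \<delta> x y \<and> \<delta> (x \<otimes>\<^bsub>G\<^esub> a) (y \<otimes>\<^bsub>G\<^esub> a) = \<delta> x y)"

definition compatible_metric :: "'a topology \<Rightarrow> ('a \<Rightarrow> 'a \<Rightarrow> real) \<Rightarrow> bool"
  where "compatible_metric X \<delta> \<longleftrightarrow>
    Metric_space (topspace X) \<delta> \<and> Metric_space.mtopology (topspace X) \<delta> = X"

definition closed_normal_subgroups :: "('a, 'b) monoid_scheme \<Rightarrow> 'a topology \<Rightarrow> 'a set set"
  where "closed_normal_subgroups G T = {N. N \<lhd> G \<and> closedin T N}"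

text \<open>\<^locale>\<open>Metric_space\<close> requires non-negativity also outside the carrier, where suprema and
  infima of empty or unbounded sets of reals are unspecified; hence the value 0 off the family
  \<open>\<C>\<close>.\<close>

definition hausdorff_metric :: "'a set set \<Rightarrow> ('a \<Rightarrow> 'a \<Rightarrow> real) \<Rightarrow> 'a set \<Rightarrow> 'a set \<Rightarrow> real"
  where "hausdorff_metric \<C> \<delta> A B =
    (if A \<in> \<C> \<and> B \<in> \<C>
     then max (SUP x\<in>A. INF y\<in>B. \<delta> x y) (SUP y\<in>B. INF x\<in>A. \<delta> x y) else 0)"

definition hausdorff_topology :: "'a set set \<Rightarrow> ('a \<Rightarrow> 'a \<Rightarrow> real) \<Rightarrow> 'a set topology"
  where "hausdorff_topology \<C> \<delta> = Metric_space.mtopology \<C> (hausdorff_metric \<C> \<delta>)"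

lemma Metric_space_hausdorff_metric:
  assumes "Metric_space M \<delta>" "compact_space (Metric_space.mtopology M \<delta>)"
    and C: "\<And>A. A \<in> \<C> \<Longrightarrow> A \<noteq> {} \<and> closedin (Metric_space.mtopology M \<delta>) A"
  shows "Metric_space \<C> (hausdorff_metric \<C> \<delta>)"
proof -
  interpret Metric_space M \<delta> by fact
  have "compactin mtopology M" using assms(2) by (simp add: compact_space_def)
  then have "mbounded M" by (rule compactin_imp_mbounded)
  then obtain b where b: "\<delta> x y \<le> b" if "x \<in> M" "y \<in> M" for x y
    by (auto simp: mbounded_alt)
  define e where "e x B = (INF y\<in>B. \<delta> x y)" for x B
  define s where "s A B = (SUP x\<in>A. e x B)" for A B
  have ne: "A \<noteq> {}" if "A \<in> \<C>" for A using C that by blast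
  have sub: "A \<subseteq> M" if "A \<in> \<C>" for A using C[OF that] closedin_subset by fastforce
  have bb: "bdd_below (\<delta> x ` B)" for x B by (intro bdd_belowI[of _ 0]) auto
  have e0: "0 \<le> e x B" if "B \<in> \<C>" for x B
    unfolding e_def using ne[OF that] by (intro cINF_greatest) auto
  have ele: "e x B \<le> \<delta> x y" if "y \<in> B" for x y B
    unfolding e_def by (intro cINF_lower bb that)
  have ba: "bdd_above ((\<lambda>x. e x B) ` A)" if AB: "A \<in> \<C>" "B \<in> \<C>" for A B
  proof -
    obtain y where "y \<in> B" using ne[OF AB(2)] by blast
    then have "e x B \<le> b" if "x \<in> A" for x
      using ele[of y B x] b[of x y] subsetD[OF sub[OF AB(1)] that] subsetD[OF sub[OF AB(2)]]
      by (meson order_trans)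
    then show ?thesis by (intro bdd_aboveI[of _ b]) auto
  qed
  have es: "e x B \<le> s A B" if "A \<in> \<C>" "B \<in> \<C>" "x \<in> A" for x A B
    unfolding s_def by (intro cSUP_upper that ba)
  have s0: "0 \<le> s A B" if "A \<in> \<C>" "B \<in> \<C>" for A B
    using es e0 ne that by (meson ex_in_conv order_trans)
  have hd: "hausdorff_metric \<C> \<delta> A B = (if A \<in> \<C> \<and> B \<in> \<C> then max (s A B) (s B A) else 0)" for A B
    by (simp add: hausdorff_metric_def s_def e_def commute)
  have cl: "A \<subseteq> B" if AB: "A \<in> \<C>" "B \<in> \<C>" and "s A B \<le> 0" for A B
  proof
    fix x assume x: "x \<in> A"
    then have "e x B \<le> 0" using es[OF AB x] that by simp
    then have "\<exists>y\<in>B. \<delta> x y < r" if "r > 0" for r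
      using that ne[OF AB(2)] bb unfolding e_def
      by (metis cINF_less_iff order_le_less_trans)
    then have "x \<in> mtopology closure_of B"
      unfolding metric_closure_of using sub AB x by (auto simp: in_mball) blast
    then show "x \<in> B" using C[OF AB(2)] by (simp add: closure_of_eq[THEN iffD2])
  qed
  have tri: "s A D \<le> s A B + s B D" if "A \<in> \<C>" "B \<in> \<C>" "D \<in> \<C>" for A B D
    unfolding s_def[of A D]
  proof (rule cSUP_least)
    show "A \<noteq> {}" using ne that by blast
    fix x assume x: "x \<in> A"
    have "e x D - s B D \<le> \<delta> x y" if y: "y \<in> B" for y
    proof -
      have "e x D - \<delta> x y \<le> \<delta> y z" if z: "z \<in> D" for z
        using ele[OF z, of x] triangle[OF subsetD[OF sub x] subsetD[OF sub y] subsetD[OF sub z]]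
          \<open>A \<in> \<C>\<close> \<open>B \<in> \<C>\<close> \<open>D \<in> \<C>\<close> by simp
      then have "e x D - \<delta> x y \<le> e y D"
        unfolding e_def[of y] using ne \<open>D \<in> \<C>\<close> by (intro cINF_greatest) auto
      then show ?thesis using es[OF \<open>B \<in> \<C>\<close> \<open>D \<in> \<C>\<close> y] by simp
    qed
    then have "e x D - s B D \<le> e x B"
      unfolding e_def[of x B] using ne \<open>B \<in> \<C>\<close> by (intro cINF_greatest) auto
    then show "e x D \<le> s A B + s B D" using es[OF \<open>A \<in> \<C>\<close> \<open>B \<in> \<C>\<close> x] by simp
  qed
  have self: "s A A = 0" if "A \<in> \<C>" for A
  proof -
    have "e x A \<le> 0" if "x \<in> A" for x
      using ele[OF that, of x] sub[OF \<open>A \<in> \<C>\<close>] that by auto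
    then have "s A A \<le> 0" unfolding s_def using ne that by (intro cSUP_least) auto
    then show ?thesis using s0[OF that that] by simp
  qed
  show ?thesis
  proof
    fix A B show "0 \<le> hausdorff_metric \<C> \<delta> A B" using s0 by (simp add: hd le_max_iff_disj)
    show "hausdorff_metric \<C> \<delta> A B = hausdorff_metric \<C> \<delta> B A" by (simp add: hd max.commute)
  next
    fix A B assume AB: "A \<in> \<C>" "B \<in> \<C>"
    show "hausdorff_metric \<C> \<delta> A B = 0 \<longleftrightarrow> A = B"
    proof
      assume "hausdorff_metric \<C> \<delta> A B = 0"
      then have "max (s A B) (s B A) = 0" using AB by (simp only: hd) simp
      then have "s A B \<le> 0" "s B A \<le> 0" by linarith+
      then show "A = B" using cl AB by (intro equalityI) blast+
    next
      assume "A = B"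
      then show "hausdorff_metric \<C> \<delta> A B = 0" using self[OF AB(1)] by (simp add: hd)
    qed
  next
    fix A B D assume ABD: "A \<in> \<C>" "B \<in> \<C>" "D \<in> \<C>"
    have "max (s A D) (s D A) \<le> max (s A B) (s B A) + max (s B D) (s D B)"
      using tri[OF ABD(1,2,3)] tri[OF ABD(3,2,1)] by linarith
    then show "hausdorff_metric \<C> \<delta> A D \<le> hausdorff_metric \<C> \<delta> A B + hausdorff_metric \<C> \<delta> B D"
      using ABD by (simp only: hd if_True simp_thms)
  qed
qed

corollary Metric_space_closed_normal_subgroups_Fhat:
  assumes "compatible_metric Fhat_top \<delta>"
  shows "Metric_space (closed_normal_subgroups Fhat Fhat_top)
    (hausdorff_metric (closed_normal_subgroups Fhat Fhat_top) \<delta>)"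
proof (rule Metric_space_hausdorff_metric)
  show "Metric_space (carrier Fhat) \<delta>" using assms by (simp add: compatible_metric_def)
  have eq: "Metric_space.mtopology (carrier Fhat) \<delta> = Fhat_top"
    using assms by (simp add: compatible_metric_def)
  show "compact_space (Metric_space.mtopology (carrier Fhat) \<delta>)"
    using compact_space_Fhat_top by (simp add: eq)
  show "A \<noteq> {} \<and> closedin (Metric_space.mtopology (carrier Fhat) \<delta>) A"
    if "A \<in> closed_normal_subgroups Fhat Fhat_top" for A
    using that subgroup.one_closed normal_imp_subgroup
    by (fastforce simp: closed_normal_subgroups_def eq)
qed

section \<open>Quotients of the free profinite group\<close>

definition commutator :: "('a, 'b) monoid_scheme \<Rightarrow> 'a \<Rightarrow> 'a \<Rightarrow> 'a"
  where "commutator G x y = inv\<^bsub>G\<^esub> x \<otimes>\<^bsub>G\<^esub> inv\<^bsub>G\<^esub> y \<otimes>\<^bsub>G\<^esub> x \<otimes>\<^bsub>G\<^esub> y"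

definition nil2 :: "('a, 'b) monoid_scheme \<Rightarrow> bool"
  where "nil2 G \<longleftrightarrow> (\<forall>x\<in>carrier G. \<forall>y\<in>carrier G. \<forall>z\<in>carrier G.
    commutator G (commutator G x y) z = \<one>\<^bsub>G\<^esub>)"

definition has_exponent :: "('a, 'b) monoid_scheme \<Rightarrow> nat \<Rightarrow> bool"
  where "has_exponent G p \<longleftrightarrow> (\<forall>x\<in>carrier G. x [^]\<^bsub>G\<^esub> p = \<one>\<^bsub>G\<^esub>)"

definition nil2_exp_kernels :: "nat \<Rightarrow> (word set \<Rightarrow> word set) set set"
  where "nil2_exp_kernels p =
    {N \<in> closed_normal_subgroups Fhat Fhat_top. nil2 (Fhat Mod N) \<and> has_exponent (Fhat Mod N) p}"

definition nil2_exp_space ::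
  "nat \<Rightarrow> ((word set \<Rightarrow> word set) \<Rightarrow> (word set \<Rightarrow> word set) \<Rightarrow> real) \<Rightarrow>
    (word set \<Rightarrow> word set) set topology"
  where "nil2_exp_space p \<delta> =
    subtopology (hausdorff_topology (closed_normal_subgroups Fhat Fhat_top) \<delta>) (nil2_exp_kernels p)"

definition Mod_top :: "('a, 'b) monoid_scheme \<Rightarrow> 'a topology \<Rightarrow> 'a set \<Rightarrow> 'a set topology"
  where "Mod_top G T N = quotient_topology T (\<lambda>x. N #>\<^bsub>G\<^esub> x)"

definition top_group_iso ::
  "('a, 'c) monoid_scheme \<Rightarrow> 'a topology \<Rightarrow> ('b, 'd) monoid_scheme \<Rightarrow> 'b topology \<Rightarrow> bool"
  where "top_group_iso G S H T \<longleftrightarrow> (\<exists>h \<in> iso G H. homeomorphic_map S T h)"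

end

theory Submission
  imports Defs "HOL-Library.Nat_Bijection" "HOL-Number_Theory.Cong"
begin

text \<open>To a graph \<open>E\<close> on the generators we attach the closed normal subgroup \<open>N\<close> cut out by the
  homomorphisms to \<open>\<int>/p\<close> and, for every edge \<open>ij\<close>, to the Heisenberg group mod \<open>p\<close> sending \<open>x\<^sub>i\<close>, \<open>x\<^sub>j\<close> to
  its generators and the other \<open>x\<^sub>k\<close> to \<open>1\<close>; thus non-adjacent generators commute in the quotient. The
  continuous characters to \<open>\<int>/p\<close> of the quotient are the finitely supported vectors \<open>a\<close>, and
  \<open>a\<close>, \<open>b\<close> satisfy the isomorphism-invariant relation \<open>a(x)b(y) = a(y)b(x)\<close> for all commuting
  \<open>x\<close>, \<open>y\<close> iff \<open>a\<^sub>i b\<^sub>j = a\<^sub>j b\<^sub>i\<close> for all non-edges \<open>ij\<close>. If distinct vertices have only finitely many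
  common neighbours, then a non-zero \<open>a\<close> is related to infinitely many \<open>b\<close> only if it is a multiple of
  a basis vector of a vertex of infinite degree, and the number of common neighbours of two such
  vertices is read off from the size of the intersection of the corresponding sets. So the quotient
  determines the complete graph on the vertices of infinite degree, labelled by numbers of common
  neighbours, and such labels suffice to code a structure with universe \<open>\<omega>\<close>.

  A point \<open>x\<close> of the Polish space is coded by the structure whose \<open>n\<close>-th relation holds of a tuple \<open>s\<close>
  iff some \<open>g\<close> with \<open>g(s\<^sub>i) = i\<close> for all \<open>i\<close> moves \<open>x\<close> into the \<open>n\<close>-th basic open set. This coding is
  equivariant and injective, so orbits correspond to isomorphism classes.\<close>

text \<open>An isomorphism of quotients need not carry generators to generators, so the graph must
  be read off from invariant data. Counting related characters sees only vertices of infinite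
  degree: a vertex of finite degree, like any vector with two non-zero entries, is related to
  finitely many vectors. This is why the structure is coded on the hubs and all other vertices serve
  only to be counted. The construction is a profinite relative of Mekler's coding of graphs in nil-2
  groups of exponent \<open>p\<close>. That \<open>p\<close> is odd enters twice, each time by
  dividing by 2: in the upper right entry of a \<open>p\<close>-th power, and when a double sum is
  antisymmetrised to compare commuting elements with minors of coefficient vectors. What is shown
  about the reduction is a semicontinuity: relations hold in an open way, they only add edges, edges
  shrink the kernel, and so missing a given coset is an open condition. This suffices for a Borel
  map because the image of the kernel in a finite quotient is then determined by finitely many open
  or closed conditions.\<close>

interpretation F: group free_group
  by (rule group_free_group)

interpretation Fhat: group Fhat
  by (rule group_Fhat)

abbreviation FI :: "word set set"
  where "FI \<equiv> fin_index_nsubgroups"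

subsection \<open>Heisenberg coordinates of words\<close>

fun expsum :: "nat \<Rightarrow> word \<Rightarrow> int" where
  "expsum i [] = 0"
| "expsum i (a # w) = (if fst a = i then if snd a then 1 else - 1 else 0) + expsum i w"

text \<open>For \<open>i \<noteq> j\<close> this is the upper right entry of the image of a word under the homomorphism to
  the integral Heisenberg group that sends \<open>x\<^sub>i\<close> and \<open>x\<^sub>j\<close> to the two standard generators and all
  other generators to \<open>1\<close>.\<close>

fun heis :: "nat \<Rightarrow> nat \<Rightarrow> word \<Rightarrow> int" where
  "heis i j [] = 0"
| "heis i j (a # w) = expsum i [a] * expsum j w + heis i j w"

lemma expsum_cons_reduce: "expsum i (cons_reduce a w) = expsum i [a] + expsum i w"
  by (cases w) (auto simp: inv_letter_def)

text \<open>Cancelling a letter against its inverse changes the recursive formula by the product of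
  the \<open>i\<close>-exponent and the \<open>j\<close>-exponent of one letter. This vanishes for
  distinct indices, but would be non-zero for \<open>i = j\<close>.\<close>

lemma heis_cons_reduce:
  "i \<noteq> j \<Longrightarrow> heis i j (cons_reduce a w) = expsum i [a] * expsum j w + heis i j w"
  by (cases w) (auto simp: inv_letter_def)

lemma carrier_free_group: "carrier free_group = {w. reduced w}"
  by (simp add: free_group_def)

lemma one_free_group: "\<one>\<^bsub>free_group\<^esub> = []"
  by (simp add: free_group_def)

lemma mult_free_group_Nil [simp]: "[] \<otimes>\<^bsub>free_group\<^esub> v = v"
  by (simp add: free_group_def)

lemma mult_free_group_Cons [simp]:
  "(a # u) \<otimes>\<^bsub>free_group\<^esub> v = cons_reduce a (u \<otimes>\<^bsub>free_group\<^esub> v)"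
  by (simp add: free_group_def)

lemma expsum_mult: "expsum i (u \<otimes>\<^bsub>free_group\<^esub> v) = expsum i u + expsum i v"
  by (induction u) (auto simp: expsum_cons_reduce)

lemma heis_mult:
  "i \<noteq> j \<Longrightarrow> heis i j (u \<otimes>\<^bsub>free_group\<^esub> v) = heis i j u + heis i j v + expsum i u * expsum j v"
  by (induction u) (auto simp: heis_cons_reduce expsum_mult algebra_simps)

lemma expsum_inv:
  assumes "w \<in> carrier free_group"
  shows "expsum i (inv\<^bsub>free_group\<^esub> w) = - expsum i w"
  using expsum_mult[of i "inv\<^bsub>free_group\<^esub> w" w] assms by (simp add: one_free_group)

lemma heis_inv:
  assumes "i \<noteq> j" "w \<in> carrier free_group"
  shows "heis i j (inv\<^bsub>free_group\<^esub> w) = expsum i w * expsum j w - heis i j w"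
  using heis_mult[OF assms(1), of "inv\<^bsub>free_group\<^esub> w" w] assms(2)
  by (simp add: one_free_group expsum_inv)

lemma expsum_pow: "expsum i (w [^]\<^bsub>free_group\<^esub> (n::nat)) = int n * expsum i w"
  by (induction n) (auto simp: one_free_group expsum_mult algebra_simps)

text \<open>Doubled in order to avoid the binomial coefficient \<open>n choose 2\<close> that
  multiplies the product of the exponent sums.\<close>

lemma heis_pow:
  "i \<noteq> j \<Longrightarrow> 2 * heis i j (w [^]\<^bsub>free_group\<^esub> (n::nat)) =
     int n * (2 * heis i j w + (int n - 1) * (expsum i w * expsum j w))"
  by (induction n) (auto simp: one_free_group expsum_pow heis_mult algebra_simps)

lemma commutator_closed:
  "group G \<Longrightarrow> x \<in> carrier G \<Longrightarrow> y \<in> carrier G \<Longrightarrow> commutator G x y \<in> carrier G"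
  unfolding commutator_def by (intro monoid.m_closed group.inv_closed) (auto intro: group.is_monoid)

lemma expsum_commutator:
  assumes "u \<in> carrier free_group" "v \<in> carrier free_group"
  shows "expsum i (commutator free_group u v) = 0"
  using assms by (simp add: commutator_def expsum_mult expsum_inv)

text \<open>A commutator has zero exponent sums, so every cross term with it vanishes: it is central
  as far as \<open>heis\<close> can see.\<close>

lemma heis_commutator_commutator:
  assumes "i \<noteq> j" "u \<in> carrier free_group" "v \<in> carrier free_group" "w \<in> carrier free_group"
  shows "heis i j (commutator free_group (commutator free_group u v) w) = 0"
proof -
  define c where "c = commutator free_group u v"
  have "c \<in> carrier free_group" using assms by (simp add: c_def commutator_closed F.is_group)
  moreover have "expsum k c = 0" for k using assms by (simp add: c_def expsum_commutator)
  ultimately show ?thesis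
    using assms unfolding c_def[symmetric]
    by (simp add: commutator_def[of _ c] expsum_mult expsum_inv heis_mult heis_inv)
qed

text \<open>For \<open>i \<noteq> j\<close> the kernel of the map to the Heisenberg group mod
  \<open>p\<close>; for \<open>i = j\<close> that of the exponent sum to the integers mod
  \<open>p\<close>. The diagonal convention lets one family of subgroups serve both vertices and
  edges.\<close>

definition kerU :: "nat \<Rightarrow> nat \<Rightarrow> nat \<Rightarrow> word set"
  where "kerU p i j = {w \<in> carrier free_group. int p dvd expsum i w \<and> int p dvd expsum j w \<and>
    (i \<noteq> j \<longrightarrow> int p dvd heis i j w)}"

lemma normal_kerU: "kerU p i j \<lhd> free_group"
  unfolding F.normal_inv_iff
proof (intro conjI ballI F.subgroupI)
  show "kerU p i j \<subseteq> carrier free_group" by (auto simp: kerU_def)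
  have "\<one>\<^bsub>free_group\<^esub> \<in> kerU p i j" by (simp add: kerU_def) (simp add: one_free_group)
  then show "kerU p i j \<noteq> {}" by blast
  show "inv\<^bsub>free_group\<^esub> w \<in> kerU p i j" if "w \<in> kerU p i j" for w
    using that by (auto simp: kerU_def expsum_inv heis_inv)
  show "u \<otimes>\<^bsub>free_group\<^esub> v \<in> kerU p i j" if "u \<in> kerU p i j" "v \<in> kerU p i j" for u v
    using that by (auto simp: kerU_def expsum_mult heis_mult)
  show "x \<otimes>\<^bsub>free_group\<^esub> h \<otimes>\<^bsub>free_group\<^esub> inv\<^bsub>free_group\<^esub> x \<in> kerU p i j"
    if "x \<in> carrier free_group" "h \<in> kerU p i j" for x h
    using that by (auto simp: kerU_def expsum_mult expsum_inv heis_mult heis_inv algebra_simps)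
qed

lemma coset_eq_kerU_iff:
  assumes "u \<in> carrier free_group" "v \<in> carrier free_group"
  shows "kerU p i j #>\<^bsub>free_group\<^esub> u = kerU p i j #>\<^bsub>free_group\<^esub> v \<longleftrightarrow>
    [expsum i u = expsum i v] (mod int p) \<and> [expsum j u = expsum j v] (mod int p) \<and>
    (i \<noteq> j \<longrightarrow> [heis i j u = heis i j v] (mod int p))"
proof -
  let ?U = "kerU p i j" and ?w = "u \<otimes>\<^bsub>free_group\<^esub> inv\<^bsub>free_group\<^esub> v"
  have sub: "subgroup ?U free_group" using normal_kerU by (rule normal_imp_subgroup)
  have "?U #>\<^bsub>free_group\<^esub> u = ?U #>\<^bsub>free_group\<^esub> v \<longleftrightarrow> u \<in> ?U #>\<^bsub>free_group\<^esub> v"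
    using F.repr_independence[OF _ assms(2) sub] F.rcos_self[OF assms(1) sub] by metis
  also have "\<dots> \<longleftrightarrow> ?w \<in> ?U"
    using subgroup.rcos_module[OF sub F.is_group assms(2,1)] .
  also have "\<dots> \<longleftrightarrow> int p dvd expsum i u - expsum i v \<and> int p dvd expsum j u - expsum j v \<and>
    (i \<noteq> j \<longrightarrow> int p dvd heis i j u - heis i j v - (expsum i u - expsum i v) * expsum j v)"
    using assms by (simp add: kerU_def expsum_mult expsum_inv heis_mult heis_inv algebra_simps)
  \<comment> \<open>The correction term is a multiple of \<open>expsum i u - expsum i v\<close>,
    which the first conjunct makes divisible by \<open>p\<close>.\<close>
  also have "\<dots> \<longleftrightarrow> int p dvd expsum i u - expsum i v \<and> int p dvd expsum j u - expsum j v \<and>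
    (i \<noteq> j \<longrightarrow> int p dvd heis i j u - heis i j v)"
    by (auto simp: dvd_diff_left_iff)
  finally show ?thesis by (simp add: cong_iff_dvd_diff)
qed

section \<open>The directed system of normal subgroups that define the completion\<close>

lemma finite_Mod:
  assumes "finite (c ` carrier free_group)"
    and "\<And>u v. u \<in> carrier free_group \<Longrightarrow> v \<in> carrier free_group \<Longrightarrow> c u = c v \<Longrightarrow>
      U #>\<^bsub>free_group\<^esub> u = U #>\<^bsub>free_group\<^esub> v"
  shows "finite (carrier (free_group Mod U))"
proof -
  let ?g = "\<lambda>y. U #>\<^bsub>free_group\<^esub> (SOME u. u \<in> carrier free_group \<and> c u = y)"
  have "carrier (free_group Mod U) \<subseteq> ?g ` (c ` carrier free_group)"
  proof
    fix C assume "C \<in> carrier (free_group Mod U)"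
    then obtain u where u: "u \<in> carrier free_group" "C = U #>\<^bsub>free_group\<^esub> u"
      by (auto simp: carrier_FactGroup)
    let ?v = "SOME v. v \<in> carrier free_group \<and> c v = c u"
    have "?v \<in> carrier free_group \<and> c ?v = c u"
      using u by (metis (mono_tags, lifting) someI)
    then have "C = ?g (c u)" using assms(2) u by metis
    then show "C \<in> ?g ` (c ` carrier free_group)" using u by blast
  qed
  then show ?thesis using assms(1) finite_surj by blast
qed

lemma free_gen_closed: "free_gen i \<in> carrier free_group"
  by (simp add: free_gen_def carrier_free_group)

lemma expsum_free_gen: "expsum i (free_gen k) = (if k = i then 1 else 0)"
  by (simp add: free_gen_def)

lemma heis_free_gen: "heis i j (free_gen k) = 0"
  by (simp add: free_gen_def)

lemma kerU_FI:
  assumes "p > 0"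
  shows "kerU p i j \<in> FI"
  unfolding fin_index_nsubgroups_def
proof (intro CollectI conjI)
  show "kerU p i j \<lhd> free_group" by (rule normal_kerU)
  let ?c = "\<lambda>w. (expsum i w mod int p, expsum j w mod int p, heis i j w mod int p)"
  show "finite (carrier (free_group Mod kerU p i j))"
  proof (rule finite_Mod[of ?c])
    show "finite (?c ` carrier free_group)"
      by (rule finite_subset[of _ "{0..<int p} \<times> {0..<int p} \<times> {0..<int p}"]) (use assms in auto)
  qed (auto simp: coset_eq_kerU_iff cong_def)
  have "{k. free_gen k \<notin> kerU p i j} \<subseteq> {i, j}"
    using free_gen_closed by (auto simp: kerU_def expsum_free_gen heis_free_gen)
  then show "finite {k. free_gen k \<notin> kerU p i j}" by (rule finite_subset) simp
qed

lemma carrier_FI: "carrier free_group \<in> FI"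
proof -
  have "carrier free_group \<lhd> free_group"
    unfolding F.normal_inv_iff by (auto intro: F.subgroup_self)
  moreover have "finite (carrier (free_group Mod carrier free_group))"
    by (rule finite_Mod[of "\<lambda>_. ()"]) (auto simp: F.coset_join2[OF _ F.subgroup_self])
  ultimately show ?thesis by (simp add: fin_index_nsubgroups_def free_gen_closed)
qed

lemma normal_FI: "U \<in> FI \<Longrightarrow> U \<lhd> free_group"
  by (simp add: fin_index_nsubgroups_def)

lemma subgroup_FI: "U \<in> FI \<Longrightarrow> subgroup U free_group"
  by (simp add: normal_FI normal_imp_subgroup)

lemma coset_eq_iff_FI:
  assumes "U \<in> FI" "u \<in> carrier free_group" "v \<in> carrier free_group"
  shows "U #>\<^bsub>free_group\<^esub> u = U #>\<^bsub>free_group\<^esub> v \<longleftrightarrow> u \<otimes>\<^bsub>free_group\<^esub> inv\<^bsub>free_group\<^esub> v \<in> U"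
  using F.repr_independence[OF _ assms(3) subgroup_FI[OF assms(1)]]
    F.rcos_self[OF assms(2) subgroup_FI[OF assms(1)]]
    subgroup.rcos_module[OF subgroup_FI[OF assms(1)] F.is_group assms(3,2)] by metis

lemma Int_FI:
  assumes U: "U \<in> FI" and V: "V \<in> FI"
  shows "U \<inter> V \<in> FI"
proof -
  have n: "U \<inter> V \<lhd> free_group"
    using F.normal_subgroup_intersect[OF normal_FI[OF U] normal_FI[OF V]] .
  have c: "(U \<inter> V) #>\<^bsub>free_group\<^esub> u = (U \<inter> V) #>\<^bsub>free_group\<^esub> v"
    if uv: "u \<in> carrier free_group" "v \<in> carrier free_group"
      and "U #>\<^bsub>free_group\<^esub> u = U #>\<^bsub>free_group\<^esub> v" "V #>\<^bsub>free_group\<^esub> u = V #>\<^bsub>free_group\<^esub> v" for u v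
  proof -
    have "u \<otimes>\<^bsub>free_group\<^esub> inv\<^bsub>free_group\<^esub> v \<in> U \<inter> V"
      using that coset_eq_iff_FI[OF U uv] coset_eq_iff_FI[OF V uv] by simp
    then have "u \<in> (U \<inter> V) #>\<^bsub>free_group\<^esub> v"
      using subgroup.rcos_module_rev[OF normal_imp_subgroup[OF n] F.is_group uv(2,1)] by simp
    then show ?thesis
      using F.repr_independence[OF _ uv(2) normal_imp_subgroup[OF n]] by simp
  qed
  have "finite (carrier (free_group Mod (U \<inter> V)))"
  proof (rule finite_Mod[of "\<lambda>w. (U #>\<^bsub>free_group\<^esub> w, V #>\<^bsub>free_group\<^esub> w)"])
    have "finite (carrier (free_group Mod U) \<times> carrier (free_group Mod V))"
      using U V by (auto simp: fin_index_nsubgroups_def)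
    then show "finite ((\<lambda>w. (U #>\<^bsub>free_group\<^esub> w, V #>\<^bsub>free_group\<^esub> w)) ` carrier free_group)"
      by (rule rev_finite_subset) (auto simp: carrier_FactGroup)
    show "(U \<inter> V) #>\<^bsub>free_group\<^esub> u = (U \<inter> V) #>\<^bsub>free_group\<^esub> v"
      if "u \<in> carrier free_group" "v \<in> carrier free_group"
        "(U #>\<^bsub>free_group\<^esub> u, V #>\<^bsub>free_group\<^esub> u) = (U #>\<^bsub>free_group\<^esub> v, V #>\<^bsub>free_group\<^esub> v)" for u v
      using c[OF that(1,2)] that(3) by simp
  qed
  moreover have "{i. free_gen i \<notin> U \<inter> V} = {i. free_gen i \<notin> U} \<union> {i. free_gen i \<notin> V}"
    by blast
  then have "finite {i. free_gen i \<notin> U \<inter> V}"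
    using U V by (simp add: fin_index_nsubgroups_def)
  ultimately show ?thesis using n by (simp add: fin_index_nsubgroups_def)
qed

lemma Inter_FI:
  assumes "finite \<V>" "\<V> \<subseteq> FI"
  shows "\<exists>U\<in>FI. \<forall>V\<in>\<V>. U \<subseteq> V"
  using assms
proof (induction \<V>)
  case empty
  then show ?case using carrier_FI by blast
next
  case (insert V \<V>)
  then obtain U where U: "U \<in> FI" "\<forall>V\<in>\<V>. U \<subseteq> V" by auto
  then have "U \<inter> V \<in> FI" using insert.prems by (simp add: Int_FI)
  then show ?case using U(2) by (intro bexI[of _ "U \<inter> V"]) auto
qed

subsection \<open>The free profinite group\<close>

lemma Fhat_apply_closed: "z \<in> carrier Fhat \<Longrightarrow> U \<in> FI \<Longrightarrow> z U \<in> carrier (free_group Mod U)"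
  by (auto simp: Fhat_def PiE_iff)

lemma Fhat_mono: "z \<in> carrier Fhat \<Longrightarrow> U \<in> FI \<Longrightarrow> V \<in> FI \<Longrightarrow> U \<subseteq> V \<Longrightarrow> z U \<subseteq> z V"
  by (simp add: Fhat_def)

lemma Fhat_repr:
  "z \<in> carrier Fhat \<Longrightarrow> U \<in> FI \<Longrightarrow> \<exists>w\<in>carrier free_group. z U = U #>\<^bsub>free_group\<^esub> w"
  using Fhat_apply_closed by (fastforce simp: carrier_FactGroup)

text \<open>Density of the free group. A word chosen at a common refinement of the given coordinates
  works at all of them, since the coset at the refinement is included in the others.\<close>

lemma Fhat_repr_common:
  assumes "finite \<V>" "\<V> \<subseteq> FI" "z \<in> carrier Fhat"
  shows "\<exists>w\<in>carrier free_group. \<forall>V\<in>\<V>. z V = V #>\<^bsub>free_group\<^esub> w"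
proof -
  obtain U where U: "U \<in> FI" "\<forall>V\<in>\<V>. U \<subseteq> V" using Inter_FI assms by blast
  obtain w where w: "w \<in> carrier free_group" "z U = U #>\<^bsub>free_group\<^esub> w"
    using Fhat_repr[OF assms(3) U(1)] by blast
  have "z V = V #>\<^bsub>free_group\<^esub> w" if V: "V \<in> \<V>" for V
  proof -
    have VF: "V \<in> FI" using V assms(2) by blast
    obtain v where v: "v \<in> carrier free_group" "z V = V #>\<^bsub>free_group\<^esub> v"
      using Fhat_repr[OF assms(3) VF] by blast
    have "w \<in> z U" using w F.rcos_self subgroup_FI[OF U(1)] by simp
    then have "w \<in> V #>\<^bsub>free_group\<^esub> v" using Fhat_mono[OF assms(3) U(1) VF] U(2) V v by auto
    then show ?thesis using F.repr_independence[OF _ v(1) subgroup_FI[OF VF]] v(2) by simp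
  qed
  then show ?thesis using w(1) by blast
qed

lemma Fhat_repr2:
  assumes "U \<in> FI" "V \<in> FI" "z \<in> carrier Fhat"
  obtains w where "w \<in> carrier free_group" "z U = U #>\<^bsub>free_group\<^esub> w" "z V = V #>\<^bsub>free_group\<^esub> w"
proof -
  have "finite {U, V}" "{U, V} \<subseteq> FI" using assms by simp_all
  from Fhat_repr_common[OF this assms(3)] show ?thesis using that by blast
qed

lemma Fhat_eqI:
  assumes "x \<in> carrier Fhat" "y \<in> carrier Fhat" "\<And>U. U \<in> FI \<Longrightarrow> x U = y U"
  shows "x = y"
proof (rule PiE_ext)
  show "x \<in> (\<Pi>\<^sub>E U\<in>FI. carrier (free_group Mod U))" "y \<in> (\<Pi>\<^sub>E U\<in>FI. carrier (free_group Mod U))"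
    using assms by (simp_all add: Fhat_def)
qed (rule assms(3))

lemma Fhat_mult: "U \<in> FI \<Longrightarrow> (x \<otimes>\<^bsub>Fhat\<^esub> y) U = x U \<otimes>\<^bsub>free_group Mod U\<^esub> y U"
  by (simp add: Fhat_def)

lemma group_hom_proj:
  assumes "U \<in> FI"
  shows "group_hom Fhat (free_group Mod U) (\<lambda>z. z U)"
  using assms
  by (intro group_hom.intro group_hom_axioms.intro group_Fhat normal.factorgroup_is_group normal_FI)
    (auto simp: hom_def Fhat_mult[simplified] Fhat_apply_closed)

lemma proj_one: "U \<in> FI \<Longrightarrow> \<one>\<^bsub>Fhat\<^esub> U = U"
  using group_hom.hom_one[OF group_hom_proj] by simp

lemma coset_mult_FI:
  assumes "U \<in> FI" "u \<in> carrier free_group" "v \<in> carrier free_group"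
  shows "(U #>\<^bsub>free_group\<^esub> u) \<otimes>\<^bsub>free_group Mod U\<^esub> (U #>\<^bsub>free_group\<^esub> v) =
    U #>\<^bsub>free_group\<^esub> (u \<otimes>\<^bsub>free_group\<^esub> v)"
  using normal.rcos_sum[OF normal_FI] assms by simp

lemma proj_mult:
  assumes "U \<in> FI" "u \<in> carrier free_group" "v \<in> carrier free_group"
    and "x U = U #>\<^bsub>free_group\<^esub> u" "y U = U #>\<^bsub>free_group\<^esub> v"
  shows "(x \<otimes>\<^bsub>Fhat\<^esub> y) U = U #>\<^bsub>free_group\<^esub> (u \<otimes>\<^bsub>free_group\<^esub> v)"
  using assms by (simp only: Fhat_mult coset_mult_FI)

lemma proj_inv:
  assumes "U \<in> FI" "x \<in> carrier Fhat" "u \<in> carrier free_group" "x U = U #>\<^bsub>free_group\<^esub> u"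
  shows "(inv\<^bsub>Fhat\<^esub> x) U = U #>\<^bsub>free_group\<^esub> (inv\<^bsub>free_group\<^esub> u)"
proof -
  have "(inv\<^bsub>Fhat\<^esub> x) U = inv\<^bsub>free_group Mod U\<^esub> (x U)"
    using group_hom.hom_inv[OF group_hom_proj[OF assms(1)]] assms(2) by simp
  also have "\<dots> = U #>\<^bsub>free_group\<^esub> (inv\<^bsub>free_group\<^esub> u)"
    using normal.inv_FactGroup[OF normal_FI[OF assms(1)]] normal.rcos_inv[OF normal_FI[OF assms(1)]]
      Fhat_apply_closed[OF assms(2,1)] assms(3,4) by simp
  finally show ?thesis .
qed

lemma proj_commutator:
  assumes "U \<in> FI" "x \<in> carrier Fhat" "y \<in> carrier Fhat"
    and "u \<in> carrier free_group" "v \<in> carrier free_group"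
    and "x U = U #>\<^bsub>free_group\<^esub> u" "y U = U #>\<^bsub>free_group\<^esub> v"
  shows "commutator Fhat x y U = U #>\<^bsub>free_group\<^esub> commutator free_group u v"
  unfolding commutator_def using assms by (simp add: proj_mult proj_inv)

lemma proj_pow:
  assumes "U \<in> FI" "u \<in> carrier free_group" "x U = U #>\<^bsub>free_group\<^esub> u"
  shows "(x [^]\<^bsub>Fhat\<^esub> (n::nat)) U = U #>\<^bsub>free_group\<^esub> (u [^]\<^bsub>free_group\<^esub> n)"
proof (induction n)
  case 0
  then show ?case
    using assms subgroup.subset[OF subgroup_FI[OF assms(1)]] by (simp add: proj_one)
next
  case (Suc n)
  then show ?case using assms by (simp add: proj_mult)
qed

section \<open>The canonical map of the free group into its completion, and basic open sets\<close>

definition hat :: "word \<Rightarrow> word set \<Rightarrow> word set"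
  where "hat w = (\<lambda>U\<in>FI. U #>\<^bsub>free_group\<^esub> w)"

lemma hat_apply: "U \<in> FI \<Longrightarrow> hat w U = U #>\<^bsub>free_group\<^esub> w"
  by (simp add: hat_def)

lemma hat_closed:
  assumes "w \<in> carrier free_group"
  shows "hat w \<in> carrier Fhat"
proof -
  have "U #>\<^bsub>free_group\<^esub> w \<subseteq> V #>\<^bsub>free_group\<^esub> w" if "U \<subseteq> V" for U V
    using that by (auto simp: r_coset_def)
  then show ?thesis using assms by (auto simp: Fhat_def hat_def carrier_FactGroup)
qed

lemma hat_mult:
  assumes "u \<in> carrier free_group" "v \<in> carrier free_group"
  shows "hat (u \<otimes>\<^bsub>free_group\<^esub> v) = hat u \<otimes>\<^bsub>Fhat\<^esub> hat v"
proof (rule Fhat_eqI)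
  show "hat (u \<otimes>\<^bsub>free_group\<^esub> v) U = (hat u \<otimes>\<^bsub>Fhat\<^esub> hat v) U" if "U \<in> FI" for U
    using that assms proj_mult[OF that assms, of "hat u" "hat v"] by (simp add: hat_apply)
qed (use assms hat_closed in auto)

lemma group_hom_hat: "group_hom free_group Fhat hat"
  by (intro group_hom.intro group_hom_axioms.intro group_Fhat group_free_group)
    (auto simp: hom_def hat_mult hat_closed)

lemma clopen_slice:
  assumes "U \<in> FI"
  shows "openin Fhat_top {z \<in> carrier Fhat. z U \<in> \<A>}"
    and "closedin Fhat_top {z \<in> carrier Fhat. z U \<in> \<A>}"
proof -
  have c: "continuous_map Fhat_top (discrete_topology (carrier (free_group Mod U))) (\<lambda>z. z U)"
    unfolding Fhat_top_def
    by (intro continuous_map_from_subtopology continuous_map_product_projection[OF assms])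
  have e: "{z \<in> topspace Fhat_top. z U \<in> \<A> \<inter> carrier (free_group Mod U)} = {z \<in> carrier Fhat. z U \<in> \<A>}"
    using Fhat_apply_closed[OF _ assms] by auto
  have "openin Fhat_top {z \<in> topspace Fhat_top. z U \<in> \<A> \<inter> carrier (free_group Mod U)}"
    by (rule openin_continuous_map_preimage[OF c]) auto
  then show "openin Fhat_top {z \<in> carrier Fhat. z U \<in> \<A>}" by (simp only: e)
  have "closedin Fhat_top {z \<in> topspace Fhat_top. z U \<in> \<A> \<inter> carrier (free_group Mod U)}"
    by (rule closedin_continuous_map_preimage[OF c]) auto
  then show "closedin Fhat_top {z \<in> carrier Fhat. z U \<in> \<A>}" by (simp only: e)
qed

lemma closedin_slice_eq: "U \<in> FI \<Longrightarrow> closedin Fhat_top {z \<in> carrier Fhat. z U = A}"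
  using clopen_slice(2)[of U "{A}"] by simp

text \<open>A basic open set of the product restricts finitely many coordinates, and all of these
  are determined by one coordinate below them.\<close>

lemma openin_Fhat_top_nbhd:
  assumes "openin Fhat_top O'" "x \<in> O'"
  shows "\<exists>U\<in>FI. \<forall>z\<in>carrier Fhat. z U = x U \<longrightarrow> z \<in> O'"
proof -
  let ?D = "\<lambda>U. discrete_topology (carrier (free_group Mod U))"
  obtain T where T: "openin (product_topology ?D FI) T" "O' = T \<inter> carrier Fhat"
    using assms(1) unfolding Fhat_top_def openin_subtopology by blast
  have xT: "x \<in> T" using T(2) assms(2) by simp
  have "\<exists>W. finite {U \<in> FI. W U \<noteq> topspace (?D U)} \<and> (\<forall>U\<in>FI. openin (?D U) (W U)) \<and>
      x \<in> Pi\<^sub>E FI W \<and> Pi\<^sub>E FI W \<subseteq> T"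
    using bspec[OF T(1)[unfolded openin_product_topology_alt] xT] .
  then obtain W where W: "finite {U \<in> FI. W U \<noteq> topspace (?D U)}" "x \<in> Pi\<^sub>E FI W" "Pi\<^sub>E FI W \<subseteq> T"
    by (elim exE conjE)
  have "{U \<in> FI. W U \<noteq> topspace (?D U)} \<subseteq> FI" by (rule Collect_restrict)
  from Inter_FI[OF W(1) this]
  obtain V where V: "V \<in> FI" "\<forall>U\<in>{U \<in> FI. W U \<noteq> topspace (?D U)}. V \<subseteq> U" by (rule bexE)
  have x: "x \<in> carrier Fhat" using T(2) assms(2) by blast
  have "z \<in> O'" if z: "z \<in> carrier Fhat" "z V = x V" for z
  proof -
    have "z U \<in> W U" if U: "U \<in> FI" for U
    proof (cases "W U = topspace (?D U)")
      case True
      then show ?thesis using Fhat_apply_closed[OF z(1) U] by simp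
    next
      case False
      then have "V \<subseteq> U" using U V(2) by (simp del: topspace_discrete_topology)
      obtain u where u: "u \<in> carrier free_group" "z U = U #>\<^bsub>free_group\<^esub> u" "z V = V #>\<^bsub>free_group\<^esub> u"
        by (rule Fhat_repr2[OF U V(1) z(1)])
      obtain v where v: "v \<in> carrier free_group" "x U = U #>\<^bsub>free_group\<^esub> v" "x V = V #>\<^bsub>free_group\<^esub> v"
        by (rule Fhat_repr2[OF U V(1) x])
      have "V #>\<^bsub>free_group\<^esub> u = V #>\<^bsub>free_group\<^esub> v" using z(2) by (simp only: u v)
      then have "U #>\<^bsub>free_group\<^esub> u = U #>\<^bsub>free_group\<^esub> v"
        using coset_eq_iff_FI[OF U u(1) v(1)] coset_eq_iff_FI[OF V(1) u(1) v(1)] \<open>V \<subseteq> U\<close> by blast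
      then have "z U = x U" by (simp only: u v)
      then show ?thesis using PiE_mem[OF W(2) U] by simp
    qed
    moreover have "z \<in> extensional FI" using z(1) by (simp add: Fhat_def PiE_def)
    ultimately have "z \<in> Pi\<^sub>E FI W" by (simp add: PiE_iff)
    then show ?thesis using W(3) T(2) z(1) by blast
  qed
  then show ?thesis using V(1) by blast
qed

subsection \<open>The kernel attached to a graph\<close>

definition kerN :: "nat \<Rightarrow> (nat \<Rightarrow> nat \<Rightarrow> bool) \<Rightarrow> (word set \<Rightarrow> word set) set"
  where "kerN p E = {z \<in> carrier Fhat. \<forall>i j. i = j \<or> E i j \<longrightarrow> z (kerU p i j) = kerU p i j}"

lemma kerN_closed: "z \<in> kerN p E \<Longrightarrow> z \<in> carrier Fhat"
  unfolding kerN_def by blast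

lemma kerN_apply: "z \<in> kerN p E \<Longrightarrow> i = j \<or> E i j \<Longrightarrow> z (kerU p i j) = kerU p i j"
  unfolding kerN_def by blast

lemma kerN_I:
  "z \<in> carrier Fhat \<Longrightarrow> (\<And>i j. i = j \<or> E i j \<Longrightarrow> z (kerU p i j) = kerU p i j) \<Longrightarrow> z \<in> kerN p E"
  unfolding kerN_def by blast

lemma normal_kerN:
  assumes "p > 0"
  shows "kerN p E \<lhd> Fhat"
  unfolding Fhat.normal_inv_iff
proof (intro conjI ballI Fhat.subgroupI)
  have U: "kerU p i j \<in> FI" for i j by (rule kerU_FI[OF assms])
  let ?one = "\<one>\<^bsub>free_group\<^esub>"
  have one: "kerU p i j #>\<^bsub>free_group\<^esub> ?one = kerU p i j" for i j
    using subgroup.subset[OF subgroup_FI[OF U]] by simp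
  have ker: "z (kerU p i j) = kerU p i j #>\<^bsub>free_group\<^esub> ?one" if "z \<in> kerN p E" "i = j \<or> E i j" for z i j
    using kerN_apply[OF that] by (simp only: one)
  show "kerN p E \<subseteq> carrier Fhat" using kerN_closed by blast
  have "\<one>\<^bsub>Fhat\<^esub> \<in> kerN p E" by (intro kerN_I Fhat.one_closed proj_one[OF U])
  then show "kerN p E \<noteq> {}" by blast
  show "inv\<^bsub>Fhat\<^esub> x \<in> kerN p E" if x: "x \<in> kerN p E" for x
  proof (rule kerN_I)
    show "(inv\<^bsub>Fhat\<^esub> x) (kerU p i j) = kerU p i j" if "i = j \<or> E i j" for i j
      using proj_inv[OF U kerN_closed[OF x] F.one_closed ker[OF x that]] by (simp only: F.inv_one one)
  qed (use kerN_closed[OF x] in simp)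
  show "x \<otimes>\<^bsub>Fhat\<^esub> y \<in> kerN p E" if x: "x \<in> kerN p E" and y: "y \<in> kerN p E" for x y
  proof (rule kerN_I)
    show "(x \<otimes>\<^bsub>Fhat\<^esub> y) (kerU p i j) = kerU p i j" if "i = j \<or> E i j" for i j
      using proj_mult[where x = x and y = y, OF U F.one_closed F.one_closed ker[OF x that] ker[OF y that]]
      by (simp only: F.r_one F.one_closed one)
  qed (use kerN_closed[OF x] kerN_closed[OF y] in simp)
  show "x \<otimes>\<^bsub>Fhat\<^esub> n \<otimes>\<^bsub>Fhat\<^esub> inv\<^bsub>Fhat\<^esub> x \<in> kerN p E"
    if x: "x \<in> carrier Fhat" and n: "n \<in> kerN p E" for x n
  proof (rule kerN_I)
    show "(x \<otimes>\<^bsub>Fhat\<^esub> n \<otimes>\<^bsub>Fhat\<^esub> inv\<^bsub>Fhat\<^esub> x) (kerU p i j) = kerU p i j" if ij: "i = j \<or> E i j" for i j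
    proof -
      obtain u where u: "u \<in> carrier free_group" "x (kerU p i j) = kerU p i j #>\<^bsub>free_group\<^esub> u"
        using Fhat_repr[OF x U] by blast
      have xn: "(x \<otimes>\<^bsub>Fhat\<^esub> n) (kerU p i j) = kerU p i j #>\<^bsub>free_group\<^esub> (u \<otimes>\<^bsub>free_group\<^esub> ?one)"
        by (rule proj_mult[where x = x and y = n, OF U u(1) F.one_closed u(2) ker[OF n ij]])
      have "(x \<otimes>\<^bsub>Fhat\<^esub> n \<otimes>\<^bsub>Fhat\<^esub> inv\<^bsub>Fhat\<^esub> x) (kerU p i j) = kerU p i j #>\<^bsub>free_group\<^esub>
        (u \<otimes>\<^bsub>free_group\<^esub> ?one \<otimes>\<^bsub>free_group\<^esub> inv\<^bsub>free_group\<^esub> u)"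
        by (rule proj_mult[where x = "x \<otimes>\<^bsub>Fhat\<^esub> n" and y = "inv\<^bsub>Fhat\<^esub> x", OF U _ _ xn proj_inv[OF U x u]])
          (use u in simp_all)
      then show ?thesis using u(1) by (simp only: F.r_one F.r_inv one)
    qed
  qed (use x kerN_closed[OF n] in simp)
qed

lemma closedin_kerN:
  assumes "p > 0"
  shows "closedin Fhat_top (kerN p E)"
proof -
  have "kerN p E = \<Inter>{{z \<in> carrier Fhat. z (kerU p i j) = kerU p i j} |i j. i = j \<or> E i j}"
    by (auto simp: kerN_def)
  moreover have "closedin Fhat_top \<dots>"
  proof (rule closedin_Inter)
    show "closedin Fhat_top K"
      if "K \<in> {{z \<in> carrier Fhat. z (kerU p i j) = kerU p i j} |i j. i = j \<or> E i j}" for K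
    proof -
      obtain i j where "K = {z \<in> carrier Fhat. z (kerU p i j) = kerU p i j}" using \<open>K \<in> _\<close> by blast
      then show ?thesis by (simp only: closedin_slice_eq[OF kerU_FI[OF assms]])
    qed
  qed blast
  ultimately show ?thesis by simp
qed

lemma (in normal) commutator_FactGroup:
  assumes "x \<in> carrier G" "y \<in> carrier G"
  shows "commutator (G Mod H) (H #> x) (H #> y) = H #> commutator G x y"
proof -
  have "group (G Mod H)" by (rule factorgroup_is_group)
  moreover have "inv\<^bsub>G Mod H\<^esub> (H #> x) = H #> (inv x)" if "x \<in> carrier G" for x
    using that inv_FactGroup[of "H #> x"] rcos_inv by (auto simp: carrier_FactGroup)
  ultimately show ?thesis
    using assms by (simp add: commutator_def rcos_sum)
qed

lemma kerU_coset_eq_self_iff: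
  assumes "w \<in> carrier free_group"
  shows "kerU p i j #>\<^bsub>free_group\<^esub> w = kerU p i j \<longleftrightarrow> w \<in> kerU p i j"
  using F.coset_join1 F.coset_join2[OF assms] assms normal_imp_subgroup[OF normal_kerU]
    subgroup.subset[OF normal_imp_subgroup[OF normal_kerU]] by metis

lemma coprime_of_odd:
  assumes "prime p" "p \<ge> 3"
  shows "coprime (int p) 2"
proof -
  have "odd p" using assms by (intro prime_odd_nat) auto
  then show ?thesis by simp
qed

text \<open>Both laws hold in every \<open>kerU\<close> coordinate, edge or not, hence modulo any
  intersection of these kernels.\<close>

lemma kerN_mem_kernels:
  assumes "prime p" "p \<ge> 3"
  shows "kerN p E \<in> nil2_exp_kernels p"
proof -
  let ?N = "kerN p E"
  have p: "p > 0" using assms by simp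
  have n: "?N \<lhd> Fhat" by (rule normal_kerN[OF p])
  have mem: "?N #>\<^bsub>Fhat\<^esub> z = ?N" if "z \<in> ?N" for z
    using that Fhat.coset_join2[OF _ normal_imp_subgroup[OF n]] by (simp add: kerN_def)
  have "nil2 (Fhat Mod ?N)"
    unfolding nil2_def
  proof (intro ballI)
    fix X Y Z assume "X \<in> carrier (Fhat Mod ?N)" "Y \<in> carrier (Fhat Mod ?N)" "Z \<in> carrier (Fhat Mod ?N)"
    then obtain x y z where xyz: "x \<in> carrier Fhat" "y \<in> carrier Fhat" "z \<in> carrier Fhat"
      and XYZ: "X = ?N #>\<^bsub>Fhat\<^esub> x" "Y = ?N #>\<^bsub>Fhat\<^esub> y" "Z = ?N #>\<^bsub>Fhat\<^esub> z"
      by (auto simp: carrier_FactGroup)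
    let ?c = "commutator Fhat (commutator Fhat x y) z"
    have "?c (kerU p i j) = kerU p i j" for i j
    proof -
      have U: "kerU p i j \<in> FI" by (rule kerU_FI[OF p])
      obtain u v w where uvw: "u \<in> carrier free_group" "v \<in> carrier free_group" "w \<in> carrier free_group"
        "x (kerU p i j) = kerU p i j #>\<^bsub>free_group\<^esub> u" "y (kerU p i j) = kerU p i j #>\<^bsub>free_group\<^esub> v"
        "z (kerU p i j) = kerU p i j #>\<^bsub>free_group\<^esub> w"
        using Fhat_repr[OF _ U] xyz by metis
      let ?d = "commutator free_group (commutator free_group u v) w"
      have "?c (kerU p i j) = kerU p i j #>\<^bsub>free_group\<^esub> ?d"
        using uvw xyz by (intro proj_commutator U commutator_closed group_Fhat group_free_group)
      moreover have "?d \<in> kerU p i j"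
        using uvw by (simp add: kerU_def commutator_closed group_free_group expsum_commutator
            heis_commutator_commutator)
      ultimately show ?thesis
        using uvw by (simp add: kerU_coset_eq_self_iff commutator_closed group_free_group)
    qed
    moreover have "?c \<in> carrier Fhat" using xyz by (intro commutator_closed group_Fhat)
    ultimately have "?c \<in> ?N" by (simp add: kerN_def)
    then show "commutator (Fhat Mod ?N) (commutator (Fhat Mod ?N) X Y) Z = \<one>\<^bsub>Fhat Mod ?N\<^esub>"
      using xyz XYZ mem by (simp add: normal.commutator_FactGroup[OF n] commutator_closed group_Fhat)
  qed
  moreover have "has_exponent (Fhat Mod ?N) p"
    unfolding has_exponent_def
  proof (intro ballI)
    fix X assume "X \<in> carrier (Fhat Mod ?N)"
    then obtain x where x: "x \<in> carrier Fhat" and X: "X = ?N #>\<^bsub>Fhat\<^esub> x"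
      by (auto simp: carrier_FactGroup)
    have "(x [^]\<^bsub>Fhat\<^esub> p) (kerU p i j) = kerU p i j" for i j
    proof -
      have U: "kerU p i j \<in> FI" by (rule kerU_FI[OF p])
      obtain u where u: "u \<in> carrier free_group" "x (kerU p i j) = kerU p i j #>\<^bsub>free_group\<^esub> u"
        using Fhat_repr[OF x U] by blast
      \<comment> \<open>By \<open>heis_pow\<close> twice the entry is divisible by \<open>p\<close>.
        For \<open>p = 2\<close> the conclusion would fail: the Heisenberg group mod 2 has elements
        of order 4.\<close>
      have "int p dvd heis i j (u [^]\<^bsub>free_group\<^esub> p)" if "i \<noteq> j"
      proof -
        have "int p dvd 2 * heis i j (u [^]\<^bsub>free_group\<^esub> p)" by (simp add: heis_pow[OF that])
        moreover have "coprime (int p) 2"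
          using coprime_of_odd[OF assms] by simp
        ultimately show ?thesis by (simp add: coprime_dvd_mult_right_iff)
      qed
      then have "u [^]\<^bsub>free_group\<^esub> p \<in> kerU p i j" using u by (simp add: kerU_def expsum_pow)
      then show ?thesis using u proj_pow[OF U u(1), of x p] by (simp add: kerU_coset_eq_self_iff)
    qed
    then have "x [^]\<^bsub>Fhat\<^esub> p \<in> ?N" using x by (simp add: kerN_def)
    then show "X [^]\<^bsub>Fhat Mod ?N\<^esub> p = \<one>\<^bsub>Fhat Mod ?N\<^esub>"
      using X x mem normal.FactGroup_pow[OF n x] by simp
  qed
  ultimately show ?thesis
    using n closedin_kerN[OF p] by (simp add: nil2_exp_kernels_def closed_normal_subgroups_def)
qed

subsection \<open>Borel measurability\<close>

lemma space_borel_of: "space (borel_of X) = topspace X"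
  unfolding borel_of_def by (rule space_measure_of) (auto dest: openin_subset)

lemma openin_borel_of: "openin X U \<Longrightarrow> U \<in> sets (borel_of X)"
  unfolding borel_of_def by (subst sets_measure_of) (auto dest: openin_subset)

lemma measurable_borel_ofI:
  assumes "f \<in> space M \<rightarrow> topspace Y" "\<And>W. openin Y W \<Longrightarrow> f -` W \<inter> space M \<in> sets M"
  shows "f \<in> M \<rightarrow>\<^sub>M borel_of Y"
  unfolding borel_of_def
  by (rule measurable_measure_of) (use assms in \<open>auto dest: openin_subset\<close>)

lemma hausdorff_metric_le:
  assumes "A \<in> \<C>" "B \<in> \<C>" "A \<noteq> {}" "B \<noteq> {}"
    and "\<And>x y. 0 \<le> \<delta> x y" "\<And>x y. \<delta> x y = \<delta> y x"
    and "\<And>x. x \<in> A \<Longrightarrow> \<exists>y\<in>B. \<delta> x y \<le> e" "\<And>y. y \<in> B \<Longrightarrow> \<exists>x\<in>A. \<delta> x y \<le> e"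
  shows "hausdorff_metric \<C> \<delta> A B \<le> e"
proof -
  have "(SUP x\<in>A. INF y\<in>B. \<delta> x y) \<le> e"
  proof (rule cSUP_least[OF assms(3)])
    fix x assume "x \<in> A"
    then obtain y where "y \<in> B" "\<delta> x y \<le> e" using assms(7) by blast
    then show "(INF y\<in>B. \<delta> x y) \<le> e"
      using assms(5) by (intro cINF_lower2) (auto intro!: bdd_belowI[of _ 0])
  qed
  moreover have "(SUP y\<in>B. INF x\<in>A. \<delta> x y) \<le> e"
  proof (rule cSUP_least[OF assms(4)])
    fix y assume "y \<in> B"
    then obtain x where "x \<in> A" "\<delta> x y \<le> e" using assms(8) by blast
    then show "(INF x\<in>A. \<delta> x y) \<le> e"
      using assms(5) by (intro cINF_lower2) (auto intro!: bdd_belowI[of _ 0])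
  qed
  ultimately show ?thesis using assms(1,2) by (simp add: hausdorff_metric_def)
qed

text \<open>Invariance makes the choice of \<open>U\<close> uniform: a coordinate whose kernel lies
  in the ball of radius \<open>e\<close> about 1 works everywhere, by right translation.\<close>

lemma small_cosets:
  assumes "compatible_metric Fhat_top \<delta>" "bi_invariant Fhat \<delta>" "e > 0"
  shows "\<exists>U\<in>FI. \<forall>x\<in>carrier Fhat. \<forall>y\<in>carrier Fhat. x U = y U \<longrightarrow> \<delta> x y < e"
proof -
  have ms: "Metric_space (carrier Fhat) \<delta>" and top: "Metric_space.mtopology (carrier Fhat) \<delta> = Fhat_top"
    using assms(1) by (simp_all add: compatible_metric_def)
  let ?B = "Metric_space.mball (carrier Fhat) \<delta> \<one>\<^bsub>Fhat\<^esub> e"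
  have "openin Fhat_top ?B"
    using Metric_space.openin_mball[OF ms] by (simp add: top)
  moreover have "\<one>\<^bsub>Fhat\<^esub> \<in> ?B"
    using Metric_space.centre_in_mball_iff[OF ms] assms(3) by simp
  ultimately obtain U where U: "U \<in> FI" "\<forall>z\<in>carrier Fhat. z U = \<one>\<^bsub>Fhat\<^esub> U \<longrightarrow> z \<in> ?B"
    using openin_Fhat_top_nbhd by blast
  have "\<delta> x y < e" if xy: "x \<in> carrier Fhat" "y \<in> carrier Fhat" "x U = y U" for x y
  proof -
    let ?z = "x \<otimes>\<^bsub>Fhat\<^esub> inv\<^bsub>Fhat\<^esub> y"
    interpret h: group_hom Fhat "free_group Mod U" "\<lambda>z. z U" by (rule group_hom_proj[OF U(1)])
    have "?z U = \<one>\<^bsub>free_group Mod U\<^esub>"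
      using xy h.hom_mult[of x "inv\<^bsub>Fhat\<^esub> y"] h.hom_inv[of y] h.H.r_inv[OF h.hom_closed[OF xy(2)]]
      by (simp del: mult_FactGroup one_FactGroup)
    then have "?z U = \<one>\<^bsub>Fhat\<^esub> U" by (simp only: h.hom_one)
    then have "?z \<in> ?B" using U(2) xy by simp
    then have "\<delta> \<one>\<^bsub>Fhat\<^esub> ?z < e" using Metric_space.in_mball[OF ms] by simp
    moreover have "\<delta> (\<one>\<^bsub>Fhat\<^esub> \<otimes>\<^bsub>Fhat\<^esub> y) (?z \<otimes>\<^bsub>Fhat\<^esub> y) = \<delta> \<one>\<^bsub>Fhat\<^esub> ?z"
      using assms(2) xy(1,2) unfolding bi_invariant_def by (meson Fhat.inv_closed Fhat.m_closed Fhat.one_closed)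
    moreover have "?z \<otimes>\<^bsub>Fhat\<^esub> y = x" using xy by (simp add: Fhat.m_assoc)
    ultimately show ?thesis using Metric_space.commute[OF ms] xy by simp
  qed
  then show ?thesis using U(1) by blast
qed

text \<open>Kernels with the same image in a sufficiently fine finite quotient are close in the
  Hausdorff metric. So an open set of kernels is a countable union of sets prescribing such an
  image, and by \<open>semi\<close> the preimage of each of these is a finite intersection of open
  and closed sets.\<close>

lemma measurable_kernel_map:
  assumes \<delta>: "compatible_metric Fhat_top \<delta>" "bi_invariant Fhat \<delta>"
    and g: "\<And>x. x \<in> topspace X \<Longrightarrow> g x \<in> nil2_exp_kernels p"
    and semi: "\<And>U A. U \<in> FI \<Longrightarrow> openin X {x \<in> topspace X. A \<notin> (\<lambda>z. z U) ` g x}"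
  shows "g \<in> borel_of X \<rightarrow>\<^sub>M borel_of (nil2_exp_space p \<delta>)"
proof (rule measurable_borel_ofI)
  let ?C = "closed_normal_subgroups Fhat Fhat_top"
  let ?H = "hausdorff_metric ?C \<delta>"
  have ms: "Metric_space ?C ?H" by (rule Metric_space_closed_normal_subgroups_Fhat[OF \<delta>(1)])
  have ms0: "Metric_space (carrier Fhat) \<delta>" using \<delta>(1) by (simp add: compatible_metric_def)
  have sub: "nil2_exp_kernels p \<subseteq> ?C" by (auto simp: nil2_exp_kernels_def)
  have top: "topspace (nil2_exp_space p \<delta>) = nil2_exp_kernels p"
    using sub Metric_space.topspace_mtopology[OF ms]
    by (auto simp: nil2_exp_space_def hausdorff_topology_def)
  show "g \<in> space (borel_of X) \<rightarrow> topspace (nil2_exp_space p \<delta>)"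
    using g by (simp add: space_borel_of top)
  have "\<exists>U. U \<in> FI \<and> (\<forall>x\<in>carrier Fhat. \<forall>y\<in>carrier Fhat.
      x U = y U \<longrightarrow> \<delta> x y < inverse (real (Suc n)))" for n
    using small_cosets[OF \<delta>, of "inverse (real (Suc n))"] by (simp add: Bex_def)
  then have "\<forall>n. \<exists>U. U \<in> FI \<and> (\<forall>x\<in>carrier Fhat. \<forall>y\<in>carrier Fhat.
      x U = y U \<longrightarrow> \<delta> x y < inverse (real (Suc n)))" ..
  from choice[OF this] obtain U where *: "\<forall>n. U n \<in> FI \<and> (\<forall>x\<in>carrier Fhat. \<forall>y\<in>carrier Fhat.
      x (U n) = y (U n) \<longrightarrow> \<delta> x y < inverse (real (Suc n)))" by (rule exE)
  have U: "U n \<in> FI" for n using * by blast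
  have Ud: "\<delta> x y < inverse (real (Suc n))"
    if "x \<in> carrier Fhat" "y \<in> carrier Fhat" "x (U n) = y (U n)" for n x y
    using * that by blast
  define pr where "pr n N = (\<lambda>z. z (U n)) ` N" for n and N :: "(word set \<Rightarrow> word set) set"
  have dist: "?H N N' \<le> inverse (real (Suc n))"
    if N: "N \<in> ?C" "N' \<in> ?C" and eq: "pr n N = pr n N'" for N N' n
  proof (rule hausdorff_metric_le[OF N])
    have ne: "N \<noteq> {} \<and> N \<subseteq> carrier Fhat" if "N \<in> ?C" for N
      using that subgroup.one_closed[OF normal_imp_subgroup] subgroup.subset[OF normal_imp_subgroup]
      by (force simp: closed_normal_subgroups_def)
    show "N \<noteq> {}" "N' \<noteq> {}" using ne N by auto
    show "\<exists>y\<in>N'. \<delta> x y \<le> inverse (real (Suc n))" if "x \<in> N" for x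
    proof -
      have "x (U n) \<in> pr n N'" using that eq by (auto simp: pr_def)
      then obtain y where "y \<in> N'" "x (U n) = y (U n)" by (auto simp: pr_def)
      then show ?thesis using Ud[of x y n] ne N that by (meson less_imp_le subsetD)
    qed
    show "\<exists>x\<in>N. \<delta> x y \<le> inverse (real (Suc n))" if "y \<in> N'" for y
    proof -
      have "y (U n) \<in> pr n N" using that eq by (auto simp: pr_def)
      then obtain x where "x \<in> N" "x (U n) = y (U n)" by (auto simp: pr_def)
      then show ?thesis using Ud[of x y n] ne N that by (meson less_imp_le subsetD)
    qed
  qed (use Metric_space.nonneg[OF ms0] Metric_space.commute[OF ms0] in auto)
  fix W assume W: "openin (nil2_exp_space p \<delta>) W"
  \<comment> \<open>The images in the \<open>n\<close>-th finite quotient that already force a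
    kernel to lie in \<open>W\<close>; every kernel in \<open>W\<close> has such an image for some
    \<open>n\<close>.\<close>
  define Good where "Good n = {S. S \<subseteq> carrier (free_group Mod U n) \<and>
    (\<forall>N\<in>nil2_exp_kernels p. pr n N = S \<longrightarrow> N \<in> W)}" for n
  have fin: "finite (carrier (free_group Mod U n))" for n
    using U[of n] by (simp add: fin_index_nsubgroups_def)
  have "Good n \<subseteq> Pow (carrier (free_group Mod U n))" for n by (auto simp: Good_def)
  then have cnt: "countable (Good n)" for n
    using fin[of n] by (meson countable_finite finite_Pow_iff finite_subset)
  have Cg: "N \<in> ?C" if "N \<in> nil2_exp_kernels p" for N using that sub by blast
  have prc: "pr n N \<subseteq> carrier (free_group Mod U n)" if "N \<in> nil2_exp_kernels p" for n N
  proof -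
    have "N \<subseteq> carrier Fhat"
      using Cg[OF that] subgroup.subset[OF normal_imp_subgroup, of N Fhat]
      by (simp add: closed_normal_subgroups_def)
    then show ?thesis using Fhat_apply_closed[OF _ U] unfolding pr_def by blast
  qed
  have ex: "\<exists>n. pr n N \<in> Good n" if N: "N \<in> nil2_exp_kernels p" "N \<in> W" for N
  proof -
    obtain T where T: "openin (Metric_space.mtopology ?C ?H) T" "W = T \<inter> nil2_exp_kernels p"
      using W by (auto simp: nil2_exp_space_def hausdorff_topology_def openin_subtopology)
    then obtain r where r: "r > 0" "Metric_space.mball ?C ?H N r \<subseteq> T"
      using N Metric_space.openin_mtopology[OF ms] by blast
    obtain n where n: "inverse (real (Suc n)) < r" using reals_Archimedean r(1) by blast
    have "N' \<in> W" if N': "N' \<in> nil2_exp_kernels p" "pr n N' = pr n N" for N'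
    proof -
      have "?H N N' < r"
        using dist[OF Cg[OF N(1)] Cg[OF N'(1)], of n] N'(2) n by simp
      then have "N' \<in> Metric_space.mball ?C ?H N r"
        using Metric_space.in_mball[OF ms] Cg N(1) N'(1) by blast
      then show ?thesis using r(2) T(2) N'(1) by blast
    qed
    then have "pr n N \<in> Good n" using prc[OF N(1)] by (auto simp: Good_def)
    then show ?thesis by blast
  qed
  have "g -` W \<inter> space (borel_of X) = (\<Union>n. \<Union>S\<in>Good n. {x \<in> topspace X. pr n (g x) = S})"
    using ex g by (fastforce simp: space_borel_of Good_def)
  moreover have "{x \<in> topspace X. pr n (g x) = S} \<in> sets (borel_of X)" if S: "S \<in> Good n" for n S
  proof -
    have b: "{x \<in> topspace X. A \<notin> pr n (g x)} \<in> sets (borel_of X)" for A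
      unfolding pr_def by (intro openin_borel_of semi U)
    have "{x \<in> topspace X. A \<in> pr n (g x)} = space (borel_of X) - {x \<in> topspace X. A \<notin> pr n (g x)}" for A
      by (auto simp: space_borel_of)
    then have c: "{x \<in> topspace X. A \<in> pr n (g x)} \<in> sets (borel_of X)" for A
      using sets.compl_sets[OF b[of A]] by simp
    have d: "{x \<in> topspace X. A \<in> pr n (g x) \<longleftrightarrow> A \<in> S} \<in> sets (borel_of X)" for A
      using b[of A] c[of A] by (cases "A \<in> S") auto
    have ne: "carrier (free_group Mod U n) \<noteq> {}"
      using F.one_closed unfolding carrier_FactGroup by blast
    \<comment> \<open>Equality of two sets of cosets is tested coset by coset; the quotient is
      finite and non-empty, as \<open>sets.finite_INT\<close> requires.\<close>
    have "{x \<in> topspace X. pr n (g x) = S} =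
      (\<Inter>A\<in>carrier (free_group Mod U n). {x \<in> topspace X. A \<in> pr n (g x) \<longleftrightarrow> A \<in> S})"
    proof -
      have "pr n (g x) = S \<longleftrightarrow> (\<forall>A\<in>carrier (free_group Mod U n). A \<in> pr n (g x) \<longleftrightarrow> A \<in> S)"
        if "x \<in> topspace X" for x
        using prc[OF g[OF that], of n] S by (auto simp: Good_def)
      then show ?thesis using ne by auto
    qed
    then show ?thesis by (simp only:) (intro sets.finite_INT d fin ne)
  qed
  ultimately show "g -` W \<inter> space (borel_of X) \<in> sets (borel_of X)"
    using cnt by (auto intro!: sets.countable_UN sets.countable_UN')
qed

text \<open>By compactness, only finitely many edges of \<open>E x\<close> are responsible for the kernel to miss a
  clopen set.\<close>

lemma openin_kerN_misses:
  assumes "p > 0" and U: "U \<in> FI"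
    and E: "\<And>i j. openin X {x \<in> topspace X. E x i j}"
  shows "openin X {x \<in> topspace X. A \<notin> (\<lambda>z. z U) ` kerN p (E x)}"
proof (subst openin_subopen, intro ballI)
  fix x assume x: "x \<in> {x \<in> topspace X. A \<notin> (\<lambda>z. z U) ` kerN p (E x)}"
  let ?K = "{z \<in> carrier Fhat. z U = A}"
  let ?S = "\<lambda>(i, j). {z \<in> carrier Fhat. z (kerU p i j) = kerU p i j}"
  let ?I = "{(i, j). i = j \<or> E x i j}"
  have False if z: "z \<in> \<Inter> (insert ?K (?S ` ?I))" for z
  proof -
    have "z (kerU p i j) = kerU p i j" if "i = j \<or> E x i j" for i j
    proof -
      have "z \<in> ?S (i, j)" using z that by blast
      then show ?thesis by simp
    qed
    moreover have zK: "z \<in> ?K" using z by blast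
    ultimately have "z \<in> kerN p (E x)" by (intro kerN_I) simp_all
    then show False using x zK by blast
  qed
  then have "\<Inter> (insert ?K (?S ` ?I)) = {}" by blast
  moreover have "\<forall>C\<in>insert ?K (?S ` ?I). closedin Fhat_top C"
    by (simp add: split_beta closedin_slice_eq[OF U] closedin_slice_eq[OF kerU_FI[OF assms(1)]])
  ultimately have "\<not> (\<forall>\<F>. finite \<F> \<and> \<F> \<subseteq> insert ?K (?S ` ?I) \<longrightarrow> \<Inter>\<F> \<noteq> {})"
    using compact_space_Fhat_top[unfolded compact_space_fip, THEN spec, of "insert ?K (?S ` ?I)"] by meson
  then obtain \<F> where \<F>: "finite \<F>" "\<F> \<subseteq> insert ?K (?S ` ?I)" "\<Inter>\<F> = {}"
    by blast
  have "finite (\<F> - {?K})" "\<F> - {?K} \<subseteq> ?S ` ?I" using \<F> by auto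
  then obtain Q where Q: "finite Q" "Q \<subseteq> ?I" "\<F> - {?K} = ?S ` Q"
    by (meson finite_subset_image)
  have "\<Inter> (insert ?K (?S ` Q)) \<subseteq> \<Inter>\<F>" unfolding Q(3)[symmetric] by blast
  then have em: "?K \<inter> \<Inter> (?S ` Q) = {}" using \<F>(3) by auto
  \<comment> \<open>The diagonal pairs in \<open>Q\<close> constrain every kernel, so only the
    finitely many proper edges restrict the point. The factor \<open>topspace X\<close> covers the
    case without proper edges, where the intersection is \<open>UNIV\<close>.\<close>
  let ?O = "topspace X \<inter> (\<Inter>(i, j)\<in>{(i, j) \<in> Q. i \<noteq> j}. {x \<in> topspace X. E x i j})"
  have "openin X ?O"
  proof (cases "{(i, j) \<in> Q. i \<noteq> j} = {}")
    case False
    have "finite {(i, j) \<in> Q. i \<noteq> j}" by (rule finite_subset[OF _ Q(1)]) auto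
    then have "openin X (\<Inter> ((\<lambda>(i, j). {x \<in> topspace X. E x i j}) ` {(i, j) \<in> Q. i \<noteq> j}))"
      using False E by (intro openin_Inter) auto
    then show ?thesis by (rule openin_Int[OF openin_topspace])
  qed (simp only: image_empty Inter_empty Int_UNIV_right openin_topspace)
  moreover have "x \<in> ?O" using x Q(2) by auto
  moreover have "?O \<subseteq> {x \<in> topspace X. A \<notin> (\<lambda>z. z U) ` kerN p (E x)}"
  proof
    fix y assume y: "y \<in> ?O"
    have "z \<in> ?S (i, j)" if "z \<in> kerN p (E y)" "(i, j) \<in> Q" for z i j
    proof -
      have "i = j \<or> E y i j" using y that(2) by blast
      then show ?thesis using kerN_apply[OF that(1)] kerN_closed[OF that(1)] by simp
    qed
    then have "kerN p (E y) \<subseteq> \<Inter> (?S ` Q)" by blast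
    then have "A \<notin> (\<lambda>z. z U) ` kerN p (E y)" using em kerN_closed by blast
    then show "y \<in> {x \<in> topspace X. A \<notin> (\<lambda>z. z U) ` kerN p (E x)}" using y by blast
  qed
  ultimately show "\<exists>T. openin X T \<and> x \<in> T \<and> T \<subseteq> {x \<in> topspace X. A \<notin> (\<lambda>z. z U) ` kerN p (E x)}"
    by blast
qed

subsection \<open>Characters\<close>

text \<open>The continuous homomorphisms to the integers mod \<open>p\<close>. Values are normalised
  to \<open>{0..<p}\<close> and fixed outside the carrier, so that equal characters are equal
  functions and can be counted.\<close>

definition chars :: "nat \<Rightarrow> ('a, 'b) monoid_scheme \<Rightarrow> 'a topology \<Rightarrow> ('a \<Rightarrow> int) set"
  where "chars p G T = {\<eta> \<in> extensional (carrier G). \<eta> ` carrier G \<subseteq> {0..<int p} \<and>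
    (\<forall>x\<in>carrier G. \<forall>y\<in>carrier G. [\<eta> (x \<otimes>\<^bsub>G\<^esub> y) = \<eta> x + \<eta> y] (mod int p)) \<and>
    continuous_map T (discrete_topology UNIV) \<eta>}"

text \<open>A substitute for the vanishing of the cup product of two characters that makes no reference to
  cohomology.\<close>

definition char_rel :: "nat \<Rightarrow> ('a, 'b) monoid_scheme \<Rightarrow> ('a \<Rightarrow> int) \<Rightarrow> ('a \<Rightarrow> int) \<Rightarrow> bool"
  where "char_rel p G \<eta> \<psi> \<longleftrightarrow> (\<forall>x\<in>carrier G. \<forall>y\<in>carrier G. x \<otimes>\<^bsub>G\<^esub> y = y \<otimes>\<^bsub>G\<^esub> x \<longrightarrow>
    [\<eta> x * \<psi> y = \<eta> y * \<psi> x] (mod int p))"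

text \<open>Characters and their relation depend only on multiplication and topology, so they pull
  back along the isomorphism. This reverses the direction: \<open>\<Phi>\<close> leads from the
  target back to the source.\<close>

lemma chars_iso:
  assumes iso: "top_group_iso G S H T" and grp: "group G" "group H"
    and top: "topspace S = carrier G" "topspace T = carrier H"
  shows "\<exists>\<Phi>. bij_betw \<Phi> (chars p H T) (chars p G S) \<and>
    (\<forall>\<eta>\<in>chars p H T. \<forall>\<psi>\<in>chars p H T. char_rel p H \<eta> \<psi> \<longleftrightarrow> char_rel p G (\<Phi> \<eta>) (\<Phi> \<psi>))"
proof -
  obtain h where h: "h \<in> iso G H" "homeomorphic_map S T h"
    using iso by (auto simp: top_group_iso_def)
  then obtain k where k: "homeomorphic_maps S T h k"
    using homeomorphic_map_maps by blast
  have hc: "h x \<in> carrier H" if "x \<in> carrier G" for x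
    using h(1) that by (auto simp: iso_def hom_def)
  have hm: "h (x \<otimes>\<^bsub>G\<^esub> y) = h x \<otimes>\<^bsub>H\<^esub> h y" if "x \<in> carrier G" "y \<in> carrier G" for x y
    using h(1) that by (simp add: iso_def hom_def)
  have cont: "continuous_map S T h" "continuous_map T S k"
    using k by (auto simp: homeomorphic_maps_def)
  have kh: "k (h x) = x" if "x \<in> carrier G" for x using k that top by (simp add: homeomorphic_maps_def)
  have hk: "h (k y) = y" if "y \<in> carrier H" for y using k that top by (simp add: homeomorphic_maps_def)
  have kc: "k y \<in> carrier G" if "y \<in> carrier H" for y
    using continuous_map_image_subset_topspace[OF cont(2)] that top by auto
  have cl: "x \<otimes>\<^bsub>G\<^esub> y \<in> carrier G" if "x \<in> carrier G" "y \<in> carrier G" for x y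
    using monoid.m_closed[OF group.is_monoid[OF grp(1)]] that .
  have cl': "x \<otimes>\<^bsub>H\<^esub> y \<in> carrier H" if "x \<in> carrier H" "y \<in> carrier H" for x y
    using monoid.m_closed[OF group.is_monoid[OF grp(2)]] that .
  have km: "k (x \<otimes>\<^bsub>H\<^esub> y) = k x \<otimes>\<^bsub>G\<^esub> k y" if "x \<in> carrier H" "y \<in> carrier H" for x y
    using hm[OF kc[OF that(1)] kc[OF that(2)]] kh[OF cl[OF kc[OF that(1)] kc[OF that(2)]]] hk that
    by simp
  define \<Phi> where "\<Phi> \<eta> = restrict (\<eta> \<circ> h) (carrier G)" for \<eta> :: "'c \<Rightarrow> int"
  define \<Psi> where "\<Psi> \<eta> = restrict (\<eta> \<circ> k) (carrier H)" for \<eta> :: "'a \<Rightarrow> int"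
  have "\<Phi> \<eta> \<in> chars p G S" if \<eta>: "\<eta> \<in> chars p H T" for \<eta>
  proof -
    have "continuous_map S (discrete_topology UNIV) (\<eta> \<circ> h)"
      using \<eta> by (intro continuous_map_compose[OF cont(1)]) (simp add: chars_def)
    then have "continuous_map S (discrete_topology UNIV) (\<Phi> \<eta>)"
      by (rule continuous_map_eq) (simp add: \<Phi>_def top)
    then show ?thesis using \<eta> hc hm cl by (auto simp: chars_def \<Phi>_def)
  qed
  moreover have "\<Psi> \<eta> \<in> chars p H T" if \<eta>: "\<eta> \<in> chars p G S" for \<eta>
  proof -
    have "continuous_map T (discrete_topology UNIV) (\<eta> \<circ> k)"
      using \<eta> by (intro continuous_map_compose[OF cont(2)]) (simp add: chars_def)
    then have "continuous_map T (discrete_topology UNIV) (\<Psi> \<eta>)"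
      by (rule continuous_map_eq) (simp add: \<Psi>_def top)
    then show ?thesis using \<eta> kc km cl' by (auto simp: chars_def \<Psi>_def)
  qed
  moreover have "\<Psi> (\<Phi> \<eta>) = \<eta>" if "\<eta> \<in> chars p H T" for \<eta>
  proof (rule extensionalityI)
    show "\<Psi> (\<Phi> \<eta>) \<in> extensional (carrier H)" by (simp add: \<Psi>_def)
    show "\<eta> \<in> extensional (carrier H)" using that by (simp add: chars_def)
  qed (simp add: \<Phi>_def \<Psi>_def kc hk)
  moreover have "\<Phi> (\<Psi> \<eta>) = \<eta>" if "\<eta> \<in> chars p G S" for \<eta>
  proof (rule extensionalityI)
    show "\<Phi> (\<Psi> \<eta>) \<in> extensional (carrier G)" by (simp add: \<Phi>_def)
    show "\<eta> \<in> extensional (carrier G)" using that by (simp add: chars_def)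
  qed (simp add: \<Phi>_def \<Psi>_def hc kh)
  ultimately have "bij_betw \<Phi> (chars p H T) (chars p G S)"
    by (intro bij_betwI[of _ _ _ \<Psi>]) auto
  moreover have "char_rel p H \<eta> \<psi> \<longleftrightarrow> char_rel p G (\<Phi> \<eta>) (\<Phi> \<psi>)" for \<eta> \<psi>
  proof
    assume L: "char_rel p H \<eta> \<psi>"
    show "char_rel p G (\<Phi> \<eta>) (\<Phi> \<psi>)"
      unfolding char_rel_def
    proof (intro ballI impI)
      fix x y assume xy: "x \<in> carrier G" "y \<in> carrier G" "x \<otimes>\<^bsub>G\<^esub> y = y \<otimes>\<^bsub>G\<^esub> x"
      then have "h x \<otimes>\<^bsub>H\<^esub> h y = h y \<otimes>\<^bsub>H\<^esub> h x" using hm by metis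
      then show "[\<Phi> \<eta> x * \<Phi> \<psi> y = \<Phi> \<eta> y * \<Phi> \<psi> x] (mod int p)"
        using L hc xy by (simp add: char_rel_def \<Phi>_def)
    qed
  next
    assume R: "char_rel p G (\<Phi> \<eta>) (\<Phi> \<psi>)"
    show "char_rel p H \<eta> \<psi>"
      unfolding char_rel_def
    proof (intro ballI impI)
      fix x y assume xy: "x \<in> carrier H" "y \<in> carrier H" "x \<otimes>\<^bsub>H\<^esub> y = y \<otimes>\<^bsub>H\<^esub> x"
      then have "k x \<otimes>\<^bsub>G\<^esub> k y = k y \<otimes>\<^bsub>G\<^esub> k x" using km by metis
      then have "[\<Phi> \<eta> (k x) * \<Phi> \<psi> (k y) = \<Phi> \<eta> (k y) * \<Phi> \<psi> (k x)] (mod int p)"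
        using R kc xy by (simp add: char_rel_def)
      then show "[\<eta> x * \<psi> y = \<eta> y * \<psi> x] (mod int p)" using kc hk xy by (simp add: \<Phi>_def)
    qed
  qed
  ultimately show ?thesis by blast
qed

text \<open>Characters of the free profinite group factor through some \<open>F/U\<close>, hence are given by
  finitely many coefficients.\<close>

locale Fhat_char =
  fixes p :: nat and \<eta> :: "(word set \<Rightarrow> word set) \<Rightarrow> int"
  assumes hom: "\<And>x y. x \<in> carrier Fhat \<Longrightarrow> y \<in> carrier Fhat \<Longrightarrow>
      [\<eta> (x \<otimes>\<^bsub>Fhat\<^esub> y) = \<eta> x + \<eta> y] (mod int p)"
    and cont: "continuous_map Fhat_top (discrete_topology UNIV) \<eta>"
begin

abbreviation coeff :: "nat \<Rightarrow> int"
  where "coeff i \<equiv> \<eta> (hat (free_gen i))"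

lemma one: "int p dvd \<eta> \<one>\<^bsub>Fhat\<^esub>"
proof -
  have "[\<eta> \<one>\<^bsub>Fhat\<^esub> + 0 = \<eta> \<one>\<^bsub>Fhat\<^esub> + \<eta> \<one>\<^bsub>Fhat\<^esub>] (mod int p)"
    using hom[of "\<one>\<^bsub>Fhat\<^esub>" "\<one>\<^bsub>Fhat\<^esub>"] by simp
  then have "[0 = \<eta> \<one>\<^bsub>Fhat\<^esub>] (mod int p)" by (simp only: cong_add_lcancel)
  then show ?thesis using cong_0_iff cong_sym by blast
qed

lemma inv_cong:
  assumes "x \<in> carrier Fhat"
  shows "[\<eta> (inv\<^bsub>Fhat\<^esub> x) = - \<eta> x] (mod int p)"
proof -
  have "[\<eta> \<one>\<^bsub>Fhat\<^esub> = \<eta> (inv\<^bsub>Fhat\<^esub> x) + \<eta> x] (mod int p)"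
    using hom[of "inv\<^bsub>Fhat\<^esub> x" x] assms by simp
  then have "int p dvd \<eta> (inv\<^bsub>Fhat\<^esub> x) + \<eta> x"
    using one cong_dvd_iff by blast
  then show ?thesis by (simp add: cong_iff_dvd_diff)
qed

text \<open>Any finite superset of the support is allowed as index set, so that two characters can
  be expanded over the same one.\<close>

lemma word_cong:
  assumes "finite S" "{i. \<not> int p dvd coeff i} \<subseteq> S" "w \<in> carrier free_group"
  shows "[\<eta> (hat w) = (\<Sum>i\<in>S. coeff i * expsum i w)] (mod int p)"
  using assms(3)
proof (induction w)
  case Nil
  have "hat [] = \<one>\<^bsub>Fhat\<^esub>" using group_hom.hom_one[OF group_hom_hat] by (simp add: one_free_group)
  then show ?case using one by (simp add: cong_0_iff)
next
  case (Cons a w)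
  have w: "w \<in> carrier free_group" and a: "[a] \<in> carrier free_group"
    using Cons.prems reduced_Cons by (auto simp: carrier_free_group)
  obtain k b where ab: "a = (k, b)" by (cases a)
  have aw: "a # w = [a] \<otimes>\<^bsub>free_group\<^esub> w"
    using Cons.prems by (cases w) (auto simp: carrier_free_group)
  have 1: "[\<eta> (hat (a # w)) = \<eta> (hat [a]) + \<eta> (hat w)] (mod int p)"
    using hom[OF hat_closed[OF a] hat_closed[OF w]] hat_mult[OF a w] by (simp only: aw)
  \<comment> \<open>If \<open>k\<close> lies outside \<open>S\<close>, the sum is 0 and
    \<open>coeff k\<close> is divisible by \<open>p\<close>.\<close>
  have k: "[(\<Sum>i\<in>S. coeff i * expsum i [a]) = (if b then 1 else - 1) * coeff k] (mod int p)"
  proof -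
    have "(\<Sum>i\<in>S. coeff i * expsum i [a]) = (\<Sum>i\<in>S. if i = k then (if b then 1 else - 1) * coeff k else 0)"
      by (rule sum.cong) (auto simp: ab)
    also have "\<dots> = (if k \<in> S then (if b then 1 else - 1) * coeff k else 0)"
      using assms(1) by (simp add: sum.delta)
    finally show ?thesis using assms(2) by (auto simp: cong_0_iff cong_sym_eq[of 0])
  qed
  have "[\<eta> (hat [a]) = (if b then 1 else - 1) * coeff k] (mod int p)"
  proof (cases b)
    case True
    then show ?thesis by (simp add: ab free_gen_def)
  next
    case False
    have "[a] \<otimes>\<^bsub>free_group\<^esub> free_gen k = \<one>\<^bsub>free_group\<^esub>"
      using False by (simp add: ab free_gen_def inv_letter_def one_free_group)
    then have "[a] = inv\<^bsub>free_group\<^esub> free_gen k"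
      using F.inv_equality[OF _ free_gen_closed a] by simp
    then have "hat [a] = inv\<^bsub>Fhat\<^esub> (hat (free_gen k))"
      using group_hom.hom_inv[OF group_hom_hat free_gen_closed] by simp
    then show ?thesis using False inv_cong[OF hat_closed[OF free_gen_closed]] by simp
  qed
  then have "[\<eta> (hat [a]) + \<eta> (hat w) =
      (\<Sum>i\<in>S. coeff i * expsum i [a]) + (\<Sum>i\<in>S. coeff i * expsum i w)] (mod int p)"
    by (intro cong_add Cons.IH[OF w] cong_trans[OF _ cong_sym[OF k]])
  moreover have "(\<Sum>i\<in>S. coeff i * expsum i [a]) + (\<Sum>i\<in>S. coeff i * expsum i w) =
      (\<Sum>i\<in>S. coeff i * expsum i (a # w))"
    by (simp add: sum.distrib[symmetric] distrib_left)
  ultimately show ?case using cong_trans[OF 1] by simp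
qed

text \<open>Continuity at 1: the elements with value divisible by \<open>p\<close> form an open
  neighbourhood of 1.\<close>

lemma factors:
  "\<exists>U\<in>FI. \<forall>z\<in>carrier Fhat. z U = U \<longrightarrow> int p dvd \<eta> z"
proof -
  have "openin Fhat_top {z \<in> topspace Fhat_top. \<eta> z \<in> {m. int p dvd m}}"
    by (rule openin_continuous_map_preimage[OF cont]) simp
  moreover have "\<one>\<^bsub>Fhat\<^esub> \<in> {z \<in> topspace Fhat_top. \<eta> z \<in> {m. int p dvd m}}"
    using one by simp
  ultimately obtain U where "U \<in> FI" "\<forall>z\<in>carrier Fhat. z U = \<one>\<^bsub>Fhat\<^esub> U \<longrightarrow>
      z \<in> {z \<in> topspace Fhat_top. \<eta> z \<in> {m. int p dvd m}}"
    using openin_Fhat_top_nbhd by blast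
  then show ?thesis by (auto simp: proj_one)
qed

text \<open>This is where the convergence of the generators to 1 enters: the subgroup through which
  the character factors contains almost all of them.\<close>

lemma finite_support: "finite {i. \<not> int p dvd coeff i}"
proof -
  obtain U where U: "U \<in> FI" "\<forall>z\<in>carrier Fhat. z U = U \<longrightarrow> int p dvd \<eta> z"
    using factors by blast
  have "int p dvd coeff i" if "free_gen i \<in> U" for i
  proof -
    have "hat (free_gen i) U = U"
      using F.coset_join2[OF free_gen_closed subgroup_FI[OF U(1)] that] by (simp add: hat_apply U(1))
    then show ?thesis using U(2) hat_closed[OF free_gen_closed] by blast
  qed
  then have "{i. \<not> int p dvd coeff i} \<subseteq> {i. free_gen i \<notin> U}" by blast
  moreover have "finite {i. free_gen i \<notin> U}" using U(1) by (simp add: fin_index_nsubgroups_def)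
  ultimately show ?thesis by (rule finite_subset)
qed

text \<open>At a coordinate through which the character factors, an element may be replaced by a
  word representing it.\<close>

lemma value_cong:
  assumes "finite S" "{i. \<not> int p dvd coeff i} \<subseteq> S"
  shows "\<exists>U\<in>FI. \<forall>z\<in>carrier Fhat. \<forall>w\<in>carrier free_group. z U = U #>\<^bsub>free_group\<^esub> w \<longrightarrow>
    [\<eta> z = (\<Sum>i\<in>S. coeff i * expsum i w)] (mod int p)"
proof -
  obtain U where U: "U \<in> FI" "\<forall>z\<in>carrier Fhat. z U = U \<longrightarrow> int p dvd \<eta> z"
    using factors by blast
  have "[\<eta> z = (\<Sum>i\<in>S. coeff i * expsum i w)] (mod int p)"
    if z: "z \<in> carrier Fhat" and w: "w \<in> carrier free_group" and zw: "z U = U #>\<^bsub>free_group\<^esub> w" for z w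
  proof -
    let ?y = "z \<otimes>\<^bsub>Fhat\<^esub> inv\<^bsub>Fhat\<^esub> (hat w)"
    have hw: "hat w \<in> carrier Fhat" by (rule hat_closed[OF w])
    have "(inv\<^bsub>Fhat\<^esub> (hat w)) U = U #>\<^bsub>free_group\<^esub> (inv\<^bsub>free_group\<^esub> w)"
      by (rule proj_inv[OF U(1) hw w hat_apply[OF U(1)]])
    then have "?y U = U #>\<^bsub>free_group\<^esub> (w \<otimes>\<^bsub>free_group\<^esub> inv\<^bsub>free_group\<^esub> w)"
      by (rule proj_mult[where x = z and y = "inv\<^bsub>Fhat\<^esub> (hat w)", OF U(1) w F.inv_closed[OF w] zw])
    then have "?y U = U" using w subgroup.subset[OF subgroup_FI[OF U(1)]] by simp
    then have "int p dvd \<eta> ?y" using U(2) z hw by simp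
    then have "[\<eta> ?y + \<eta> (hat w) = 0 + \<eta> (hat w)] (mod int p)"
      by (intro cong_add cong_refl) (simp add: cong_0_iff)
    moreover have "[\<eta> z = \<eta> ?y + \<eta> (hat w)] (mod int p)"
      using hom[of ?y "hat w"] z hw by (simp add: Fhat.m_assoc)
    ultimately have "[\<eta> z = \<eta> (hat w)] (mod int p)" using cong_trans by fastforce
    then show ?thesis using word_cong[OF assms w] cong_trans by blast
  qed
  then show ?thesis using U(1) by blast
qed

end

text \<open>The character dual to the \<open>i\<close>-th generator. The value does not depend on
  the chosen word, as \<open>eps_eq\<close> shows.\<close>

definition eps :: "nat \<Rightarrow> nat \<Rightarrow> (word set \<Rightarrow> word set) \<Rightarrow> int"
  where "eps p i z = expsum i (SOME w. w \<in> carrier free_group \<and>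
    z (kerU p i i) = kerU p i i #>\<^bsub>free_group\<^esub> w) mod int p"

lemma eps_eq:
  assumes "w \<in> carrier free_group" "z (kerU p i i) = kerU p i i #>\<^bsub>free_group\<^esub> w"
  shows "eps p i z = expsum i w mod int p"
proof -
  let ?v = "SOME w. w \<in> carrier free_group \<and> z (kerU p i i) = kerU p i i #>\<^bsub>free_group\<^esub> w"
  have "?v \<in> carrier free_group \<and> z (kerU p i i) = kerU p i i #>\<^bsub>free_group\<^esub> ?v"
    by (rule someI[of _ w]) (use assms in simp)
  then have "kerU p i i #>\<^bsub>free_group\<^esub> ?v = kerU p i i #>\<^bsub>free_group\<^esub> w" "?v \<in> carrier free_group"
    using assms(2) by simp_all
  then have "[expsum i ?v = expsum i w] (mod int p)"
    using coset_eq_kerU_iff assms(1) by blast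
  then show ?thesis by (simp add: eps_def cong_def)
qed

lemma continuous_map_eps:
  assumes "p > 0"
  shows "continuous_map Fhat_top (discrete_topology UNIV) (eps p i)"
proof -
  let ?U = "kerU p i i"
  have U: "?U \<in> FI" by (rule kerU_FI[OF assms])
  have "continuous_map Fhat_top (discrete_topology (carrier (free_group Mod ?U))) (\<lambda>z. z ?U)"
    unfolding Fhat_top_def
    by (intro continuous_map_from_subtopology continuous_map_product_projection[OF U])
  moreover have "continuous_map (discrete_topology (carrier (free_group Mod ?U))) (discrete_topology UNIV)
    (\<lambda>C. expsum i (SOME w. w \<in> carrier free_group \<and> C = ?U #>\<^bsub>free_group\<^esub> w) mod int p)"
    by simp
  ultimately have "continuous_map Fhat_top (discrete_topology UNIV)
    ((\<lambda>C. expsum i (SOME w. w \<in> carrier free_group \<and> C = ?U #>\<^bsub>free_group\<^esub> w) mod int p) \<circ> (\<lambda>z. z ?U))"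
    by (rule continuous_map_compose)
  then show ?thesis by (simp add: eps_def[abs_def] o_def)
qed

subsection \<open>Characters of the quotient attached to a graph\<close>

lemma coset_kerN_eq_iff:
  assumes "p > 0" "x \<in> carrier Fhat" "y \<in> carrier Fhat"
  shows "kerN p E #>\<^bsub>Fhat\<^esub> x = kerN p E #>\<^bsub>Fhat\<^esub> y \<longleftrightarrow>
    (\<forall>i j. i = j \<or> E i j \<longrightarrow> x (kerU p i j) = y (kerU p i j))"
proof -
  let ?N = "kerN p E" and ?z = "x \<otimes>\<^bsub>Fhat\<^esub> inv\<^bsub>Fhat\<^esub> y"
  have sub: "subgroup ?N Fhat" by (rule normal_imp_subgroup[OF normal_kerN[OF assms(1)]])
  have U: "kerU p i j \<in> FI" for i j by (rule kerU_FI[OF assms(1)])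
  have "?z (kerU p i j) = kerU p i j \<longleftrightarrow> x (kerU p i j) = y (kerU p i j)" for i j
  proof -
    obtain u where u: "u \<in> carrier free_group" "x (kerU p i j) = kerU p i j #>\<^bsub>free_group\<^esub> u"
      using Fhat_repr[OF assms(2) U] by blast
    obtain v where v: "v \<in> carrier free_group" "y (kerU p i j) = kerU p i j #>\<^bsub>free_group\<^esub> v"
      using Fhat_repr[OF assms(3) U] by blast
    have "?z (kerU p i j) = kerU p i j #>\<^bsub>free_group\<^esub> (u \<otimes>\<^bsub>free_group\<^esub> inv\<^bsub>free_group\<^esub> v)"
      by (rule proj_mult[where x = x and y = "inv\<^bsub>Fhat\<^esub> y", OF U u(1) F.inv_closed[OF v(1)] u(2)
            proj_inv[OF U assms(3) v]])
    then have "?z (kerU p i j) = kerU p i j \<longleftrightarrow> u \<otimes>\<^bsub>free_group\<^esub> inv\<^bsub>free_group\<^esub> v \<in> kerU p i j"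
      using u(1) v(1) by (simp add: kerU_coset_eq_self_iff)
    then show ?thesis using coset_eq_iff_FI[OF U u(1) v(1)] u(2) v(2) by simp
  qed
  moreover have "?z \<in> ?N \<longleftrightarrow> (\<forall>i j. i = j \<or> E i j \<longrightarrow> ?z (kerU p i j) = kerU p i j)"
    using assms unfolding kerN_def by blast
  moreover have "?N #>\<^bsub>Fhat\<^esub> x = ?N #>\<^bsub>Fhat\<^esub> y \<longleftrightarrow> ?z \<in> ?N"
    using Fhat.repr_independence[OF _ assms(3) sub] Fhat.rcos_self[OF assms(2) sub]
      subgroup.rcos_module[OF sub group_Fhat assms(3,2)] by metis
  ultimately show ?thesis by simp
qed

definition vecs :: "nat \<Rightarrow> (nat \<Rightarrow> int) set"
  where "vecs p = {a. (\<forall>i. a i \<in> {0..<int p}) \<and> finite {i. a i \<noteq> 0}}"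

text \<open>The 2 by 2 minors of the pair of vectors vanish mod \<open>p\<close> at all non-edges;
  equivalently, the wedge product of \<open>a\<close> and \<open>b\<close> is supported on
  edges.\<close>

definition vec_rel :: "nat \<Rightarrow> (nat \<Rightarrow> nat \<Rightarrow> bool) \<Rightarrow> (nat \<Rightarrow> int) \<Rightarrow> (nat \<Rightarrow> int) \<Rightarrow> bool"
  where "vec_rel p E a b \<longleftrightarrow> (\<forall>i j. i \<noteq> j \<longrightarrow> \<not> E i j \<longrightarrow> [a i * b j = a j * b i] (mod int p))"

locale graph_group =
  fixes p :: nat and E :: "nat \<Rightarrow> nat \<Rightarrow> bool"
  assumes p: "prime p" "p \<ge> 3" and sym: "\<And>i j. E i j \<Longrightarrow> E j i"
begin

abbreviation "N \<equiv> kerN p E"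
abbreviation "Q \<equiv> Fhat Mod N"
abbreviation "T \<equiv> Mod_top Fhat Fhat_top N"

definition coord :: "((word set \<Rightarrow> word set) set \<Rightarrow> int) \<Rightarrow> nat \<Rightarrow> int"
  where "coord \<eta> i = \<eta> (N #>\<^bsub>Fhat\<^esub> hat (free_gen i))"

lemma p0: "p > 0"
  using p by simp

lemma normal_N: "N \<lhd> Fhat"
  by (rule normal_kerN[OF p0])

lemma group_Q: "group Q"
  by (rule normal.factorgroup_is_group[OF normal_N])

lemma topspace_T: "topspace T = carrier Q"
  by (simp add: Mod_top_def carrier_FactGroup)

lemma coset_closed: "z \<in> carrier Fhat \<Longrightarrow> N #>\<^bsub>Fhat\<^esub> z \<in> carrier Q"
  by (simp add: carrier_FactGroup)

lemma coset_mult: "x \<in> carrier Fhat \<Longrightarrow> y \<in> carrier Fhat \<Longrightarrow>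
  (N #>\<^bsub>Fhat\<^esub> x) \<otimes>\<^bsub>Q\<^esub> (N #>\<^bsub>Fhat\<^esub> y) = N #>\<^bsub>Fhat\<^esub> (x \<otimes>\<^bsub>Fhat\<^esub> y)"
  using normal.rcos_sum[OF normal_N] by simp

lemma char_range: "\<eta> \<in> chars p Q T \<Longrightarrow> z \<in> carrier Fhat \<Longrightarrow> \<eta> (N #>\<^bsub>Fhat\<^esub> z) \<in> {0..<int p}"
  using coset_closed unfolding chars_def by blast

lemma Fhat_char:
  assumes "\<eta> \<in> chars p Q T"
  shows "Fhat_char p (\<lambda>z. \<eta> (N #>\<^bsub>Fhat\<^esub> z))"
proof
  show "[\<eta> (N #>\<^bsub>Fhat\<^esub> (x \<otimes>\<^bsub>Fhat\<^esub> y)) = \<eta> (N #>\<^bsub>Fhat\<^esub> x) + \<eta> (N #>\<^bsub>Fhat\<^esub> y)] (mod int p)"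
    if "x \<in> carrier Fhat" "y \<in> carrier Fhat" for x y
    using assms that coset_closed unfolding coset_mult[OF that, symmetric] chars_def by blast
  have "continuous_map Fhat_top T (\<lambda>z. N #>\<^bsub>Fhat\<^esub> z)"
    unfolding Mod_top_def by (intro quotient_imp_continuous_map quotient_map_quotient_topology)
  moreover have "continuous_map T (discrete_topology UNIV) \<eta>" using assms by (simp add: chars_def)
  ultimately show "continuous_map Fhat_top (discrete_topology UNIV) (\<lambda>z. \<eta> (N #>\<^bsub>Fhat\<^esub> z))"
    using continuous_map_compose[of Fhat_top T _ _ \<eta>] by (simp add: o_def)
qed

lemma dvd_iff_zero: "m \<in> {0..<int p} \<Longrightarrow> int p dvd m \<longleftrightarrow> m = 0"
  by (metis atLeastLessThan_iff dvd_0_right order_le_less zdvd_not_zless)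

lemma coord_range: "\<eta> \<in> chars p Q T \<Longrightarrow> coord \<eta> i \<in> {0..<int p}"
  unfolding coord_def by (intro char_range hat_closed free_gen_closed)

lemma coord_support:
  assumes "\<eta> \<in> chars p Q T"
  shows "finite {i. coord \<eta> i \<noteq> 0}"
proof -
  have "{i. coord \<eta> i \<noteq> 0} = {i. \<not> int p dvd coord \<eta> i}"
    using dvd_iff_zero[OF coord_range[OF assms]] by simp
  then show ?thesis using Fhat_char.finite_support[OF Fhat_char[OF assms]] by (simp add: coord_def)
qed

lemma coord_vecs: "\<eta> \<in> chars p Q T \<Longrightarrow> coord \<eta> \<in> vecs p"
  using coord_support coord_range by (simp add: vecs_def)

lemma char_value:
  assumes "\<eta> \<in> chars p Q T" "finite S" "{i. coord \<eta> i \<noteq> 0} \<subseteq> S"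
  shows "\<exists>U\<in>FI. \<forall>z\<in>carrier Fhat. \<forall>w\<in>carrier free_group. z U = U #>\<^bsub>free_group\<^esub> w \<longrightarrow>
    [\<eta> (N #>\<^bsub>Fhat\<^esub> z) = (\<Sum>i\<in>S. coord \<eta> i * expsum i w)] (mod int p)"
proof -
  have "{i. \<not> int p dvd coord \<eta> i} \<subseteq> S"
    using assms(3) dvd_iff_zero[OF coord_range[OF assms(1)]] by simp
  then show ?thesis
    using Fhat_char.value_cong[OF Fhat_char[OF assms(1)] assms(2)] by (simp add: coord_def)
qed

text \<open>One word represents a given element at both coordinates through which the two characters
  factor, and its exponent sums together with the common coefficients determine both values.\<close>

lemma coord_inj: "inj_on coord (chars p Q T)"
proof (rule inj_onI)
  fix \<eta> \<psi> assume \<eta>: "\<eta> \<in> chars p Q T" and \<psi>: "\<psi> \<in> chars p Q T" and eq: "coord \<eta> = coord \<psi>"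
  let ?S = "{i. coord \<eta> i \<noteq> 0}"
  have sub: "{i. coord \<psi> i \<noteq> 0} \<subseteq> ?S" by (simp add: eq)
  obtain U where U: "U \<in> FI" "\<forall>z\<in>carrier Fhat. \<forall>w\<in>carrier free_group. z U = U #>\<^bsub>free_group\<^esub> w \<longrightarrow>
      [\<eta> (N #>\<^bsub>Fhat\<^esub> z) = (\<Sum>i\<in>?S. coord \<eta> i * expsum i w)] (mod int p)"
    using char_value[OF \<eta> coord_support[OF \<eta>] order_refl] by blast
  obtain V where V: "V \<in> FI" "\<forall>z\<in>carrier Fhat. \<forall>w\<in>carrier free_group. z V = V #>\<^bsub>free_group\<^esub> w \<longrightarrow>
      [\<psi> (N #>\<^bsub>Fhat\<^esub> z) = (\<Sum>i\<in>?S. coord \<psi> i * expsum i w)] (mod int p)"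
    using char_value[OF \<psi> coord_support[OF \<eta>] sub] by blast
  show "\<eta> = \<psi>"
  proof (rule extensionalityI)
    show "\<eta> \<in> extensional (carrier Q)" "\<psi> \<in> extensional (carrier Q)"
      using \<eta> \<psi> by (simp_all add: chars_def)
    fix C assume "C \<in> carrier Q"
    then obtain z where z: "z \<in> carrier Fhat" and C: "C = N #>\<^bsub>Fhat\<^esub> z" by (auto simp: carrier_FactGroup)
    obtain w where "w \<in> carrier free_group" "z U = U #>\<^bsub>free_group\<^esub> w" "z V = V #>\<^bsub>free_group\<^esub> w"
      by (rule Fhat_repr2[OF U(1) V(1) z])
    then have "[\<eta> C = (\<Sum>i\<in>?S. coord \<psi> i * expsum i w)] (mod int p)"
      "[\<psi> C = (\<Sum>i\<in>?S. coord \<psi> i * expsum i w)] (mod int p)"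
      using U(2) V(2) z unfolding C eq by blast+
    then have "[\<eta> C = \<psi> C] (mod int p)" by (rule cong_trans[OF _ cong_sym])
    then show "\<eta> C = \<psi> C"
      using char_range[OF \<eta> z] char_range[OF \<psi> z] by (simp add: C cong_def)
  qed
qed

definition char_of :: "(nat \<Rightarrow> int) \<Rightarrow> (word set \<Rightarrow> word set) set \<Rightarrow> int"
  where "char_of a = (\<lambda>C\<in>carrier Q. (\<Sum>i | a i \<noteq> 0. a i * eps p i (SOME z. z \<in> carrier Fhat \<and> C = N #>\<^bsub>Fhat\<^esub> z)) mod int p)"

lemma eps_coset:
  assumes "x \<in> carrier Fhat" "y \<in> carrier Fhat" "N #>\<^bsub>Fhat\<^esub> x = N #>\<^bsub>Fhat\<^esub> y"
  shows "eps p i x = eps p i y"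
  using assms(3) unfolding coset_kerN_eq_iff[OF p0 assms(1,2)] by (simp add: eps_def)

lemma char_of_coset:
  assumes "z \<in> carrier Fhat"
  shows "char_of a (N #>\<^bsub>Fhat\<^esub> z) = (\<Sum>i | a i \<noteq> 0. a i * eps p i z) mod int p"
proof -
  let ?y = "SOME y. y \<in> carrier Fhat \<and> N #>\<^bsub>Fhat\<^esub> z = N #>\<^bsub>Fhat\<^esub> y"
  have "?y \<in> carrier Fhat \<and> N #>\<^bsub>Fhat\<^esub> z = N #>\<^bsub>Fhat\<^esub> ?y"
    by (rule someI[of _ z]) (use assms in simp)
  then have "?y \<in> carrier Fhat" "N #>\<^bsub>Fhat\<^esub> ?y = N #>\<^bsub>Fhat\<^esub> z" by simp_all
  then have "eps p i ?y = eps p i z" for i using eps_coset[OF _ assms] by blast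
  then show ?thesis using coset_closed[OF assms] by (simp add: char_of_def)
qed

lemma char_of_chars: "char_of a \<in> chars p Q T"
  unfolding chars_def
proof (intro CollectI conjI ballI)
  show "char_of a \<in> extensional (carrier Q)" by (simp add: char_of_def)
  show "char_of a ` carrier Q \<subseteq> {0..<int p}" using p0 by (auto simp: char_of_def)
  have ee: "[eps p i (x \<otimes>\<^bsub>Fhat\<^esub> y) = eps p i x + eps p i y] (mod int p)"
    if x: "x \<in> carrier Fhat" and y: "y \<in> carrier Fhat" for x y i
  proof -
    have U: "kerU p i i \<in> FI" by (rule kerU_FI[OF p0])
    obtain u where u: "u \<in> carrier free_group" "x (kerU p i i) = kerU p i i #>\<^bsub>free_group\<^esub> u"
      using Fhat_repr[OF x U] by blast
    obtain v where v: "v \<in> carrier free_group" "y (kerU p i i) = kerU p i i #>\<^bsub>free_group\<^esub> v"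
      using Fhat_repr[OF y U] by blast
    have xy: "(x \<otimes>\<^bsub>Fhat\<^esub> y) (kerU p i i) = kerU p i i #>\<^bsub>free_group\<^esub> (u \<otimes>\<^bsub>free_group\<^esub> v)"
      by (rule proj_mult[where x = x and y = y, OF U u(1) v(1) u(2) v(2)])
    show ?thesis
      using eps_eq[where z = x, OF u] eps_eq[where z = y, OF v]
        eps_eq[where z = "x \<otimes>\<^bsub>Fhat\<^esub> y", OF F.m_closed[OF u(1) v(1)] xy]
      by (simp add: expsum_mult cong_def mod_add_eq)
  qed
  fix X Y assume "X \<in> carrier Q" "Y \<in> carrier Q"
  then obtain x y where x: "x \<in> carrier Fhat" "X = N #>\<^bsub>Fhat\<^esub> x" and y: "y \<in> carrier Fhat" "Y = N #>\<^bsub>Fhat\<^esub> y"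
    by (auto simp: carrier_FactGroup)
  have "[(\<Sum>i | a i \<noteq> 0. a i * eps p i (x \<otimes>\<^bsub>Fhat\<^esub> y)) = (\<Sum>i | a i \<noteq> 0. a i * (eps p i x + eps p i y))] (mod int p)"
    by (intro cong_sum cong_scalar_left ee x y)
  also have "(\<Sum>i | a i \<noteq> 0. a i * (eps p i x + eps p i y)) =
    (\<Sum>i | a i \<noteq> 0. a i * eps p i x) + (\<Sum>i | a i \<noteq> 0. a i * eps p i y)"
    by (simp add: distrib_left sum.distrib)
  finally show "[char_of a (X \<otimes>\<^bsub>Q\<^esub> Y) = char_of a X + char_of a Y] (mod int p)"
    unfolding x(2) y(2) coset_mult[OF x(1) y(1)] char_of_coset[OF x(1)] char_of_coset[OF y(1)]
      char_of_coset[OF Fhat.m_closed[OF x(1) y(1)]]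
    by (simp add: cong_def mod_add_eq)
next
  have "continuous_map Fhat_top (discrete_topology UNIV) (char_of a \<circ> (\<lambda>z. N #>\<^bsub>Fhat\<^esub> z))"
  proof (cases "finite {i. a i \<noteq> 0}")
    case True
    have "continuous_map Fhat_top (discrete_topology UNIV) (\<lambda>z. \<Sum>i\<in>S. a i * eps p i z)" if "finite S" for S
      using that
    proof (induction S)
      case (insert k S)
      have "continuous_map Fhat_top (prod_topology (discrete_topology UNIV) (discrete_topology UNIV))
          (\<lambda>z. (eps p k z, \<Sum>i\<in>S. a i * eps p i z))"
        using insert.IH continuous_map_eps[OF p0] by (simp add: continuous_map_paired)
      then have "continuous_map Fhat_top (discrete_topology UNIV)
          ((\<lambda>(u, v). a k * u + v) \<circ> (\<lambda>z. (eps p k z, \<Sum>i\<in>S. a i * eps p i z)))"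
        by (rule continuous_map_compose) (simp flip: prod_topology_discrete_topology)
      then show ?case using insert by (simp add: o_def)
    qed simp
    from continuous_map_compose[OF this[OF True], of "discrete_topology UNIV" "\<lambda>m. m mod int p"]
    have "continuous_map Fhat_top (discrete_topology UNIV) (\<lambda>z. (\<Sum>i | a i \<noteq> 0. a i * eps p i z) mod int p)"
      by (simp add: o_def)
    then show ?thesis by (rule continuous_map_eq) (simp add: char_of_coset)
  next
    \<comment> \<open>A sum over an infinite set is 0 by convention, so \<open>char_of a\<close> is
      the trivial character here.\<close>
    case False
    have "continuous_map Fhat_top (discrete_topology UNIV) (\<lambda>z. 0 :: int)" by simp
    then show ?thesis by (rule continuous_map_eq) (simp add: char_of_coset False)
  qed
  then show "continuous_map T (discrete_topology UNIV) (char_of a)"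
    unfolding Mod_top_def by (rule continuous_compose_quotient_map[OF quotient_map_quotient_topology])
qed

lemma coord_char_of:
  assumes "a \<in> vecs p"
  shows "coord (char_of a) = a"
proof
  fix k
  have e: "eps p i (hat (free_gen k)) = (if i = k then 1 else 0)" for i
    using eps_eq[where z = "hat (free_gen k)", OF free_gen_closed hat_apply[OF kerU_FI[OF p0]]] p
    by (simp add: expsum_free_gen)
  have "(\<Sum>i | a i \<noteq> 0. a i * eps p i (hat (free_gen k))) = (\<Sum>i | a i \<noteq> 0. if i = k then a k else 0)"
    by (rule sum.cong) (auto simp: e)
  also have "\<dots> = a k" using assms by (simp add: vecs_def sum.delta)
  finally show "coord (char_of a) k = a k"
    using assms by (simp add: coord_def char_of_coset hat_closed free_gen_closed vecs_def)
qed

lemma bij_coord: "bij_betw coord (chars p Q T) (vecs p)"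
  unfolding bij_betw_def
proof
  show "coord ` chars p Q T = vecs p"
    using coord_vecs coord_char_of char_of_chars by (metis (no_types, lifting) image_subset_iff subsetI subset_antisym imageI)
qed (rule coord_inj)

section \<open>Commuting elements of the quotient and related characters\<close>

lemma commuting_generators:
  assumes "i \<noteq> j" "\<not> E i j"
  shows "N #>\<^bsub>Fhat\<^esub> (hat (free_gen i) \<otimes>\<^bsub>Fhat\<^esub> hat (free_gen j)) =
    N #>\<^bsub>Fhat\<^esub> (hat (free_gen j) \<otimes>\<^bsub>Fhat\<^esub> hat (free_gen i))"
proof -
  have "hat (free_gen i \<otimes>\<^bsub>free_group\<^esub> free_gen j) (kerU p k l) = hat (free_gen j \<otimes>\<^bsub>free_group\<^esub> free_gen i) (kerU p k l)"
    if "k = l \<or> E k l" for k l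
  proof -
    \<comment> \<open>The two products have equal exponent sums, and \<open>heis k l\<close> tells
      them apart only if \<open>k\<close>, \<open>l\<close> are \<open>i\<close>, \<open>j\<close>
      in some order. Neither order is an edge, by symmetry.\<close>
    have "\<not> (k \<noteq> l \<and> (k = i \<and> l = j \<or> k = j \<and> l = i))" using that assms sym by blast
    then show ?thesis
      by (auto simp: hat_apply[OF kerU_FI[OF p0]] coset_eq_kerU_iff free_gen_closed F.m_closed
          expsum_mult heis_mult expsum_free_gen heis_free_gen)
  qed
  then show ?thesis
    by (simp add: coset_kerN_eq_iff[OF p0] hat_mult[OF free_gen_closed free_gen_closed, symmetric]
        hat_closed free_gen_closed)
qed

text \<open>The entries of \<open>u v\<close> and \<open>v u\<close> differ by the alternating form
  in the exponent sums, which is the commutator in the Heisenberg group.\<close>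

lemma commuting_cosets:
  assumes "x \<in> carrier Fhat" "y \<in> carrier Fhat" "u \<in> carrier free_group" "v \<in> carrier free_group"
    and comm: "N #>\<^bsub>Fhat\<^esub> (x \<otimes>\<^bsub>Fhat\<^esub> y) = N #>\<^bsub>Fhat\<^esub> (y \<otimes>\<^bsub>Fhat\<^esub> x)"
    and "E k l" "k \<noteq> l"
    and x: "x (kerU p k l) = kerU p k l #>\<^bsub>free_group\<^esub> u"
    and y: "y (kerU p k l) = kerU p k l #>\<^bsub>free_group\<^esub> v"
  shows "int p dvd expsum k u * expsum l v - expsum k v * expsum l u"
proof -
  have U: "kerU p k l \<in> FI" by (rule kerU_FI[OF p0])
  have "(x \<otimes>\<^bsub>Fhat\<^esub> y) (kerU p k l) = (y \<otimes>\<^bsub>Fhat\<^esub> x) (kerU p k l)"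
    using comm assms(1,2,6) by (simp add: coset_kerN_eq_iff[OF p0])
  then have "kerU p k l #>\<^bsub>free_group\<^esub> (u \<otimes>\<^bsub>free_group\<^esub> v) = kerU p k l #>\<^bsub>free_group\<^esub> (v \<otimes>\<^bsub>free_group\<^esub> u)"
    unfolding proj_mult[where x = x and y = y, OF U assms(3,4) x y]
      proj_mult[where x = y and y = x, OF U assms(4,3) y x] .
  then have "[heis k l (u \<otimes>\<^bsub>free_group\<^esub> v) = heis k l (v \<otimes>\<^bsub>free_group\<^esub> u)] (mod int p)"
    using assms by (simp add: coset_eq_kerU_iff)
  then show ?thesis
    using \<open>k \<noteq> l\<close> by (simp add: heis_mult cong_iff_dvd_diff algebra_simps)
qed

text \<open>From left to right, non-adjacent generators commute and can be tested. Conversely, for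
  commuting elements twice the difference to be shown divisible is a sum of products of a minor of
  the coefficients and an alternating form in the exponent sums: at an edge the second factor is
  divisible by \<open>p\<close>, at a non-edge the first.\<close>

lemma char_rel_iff:
  assumes \<eta>: "\<eta> \<in> chars p Q T" and \<psi>: "\<psi> \<in> chars p Q T"
  shows "char_rel p Q \<eta> \<psi> \<longleftrightarrow> vec_rel p E (coord \<eta>) (coord \<psi>)"
proof
  assume L: "char_rel p Q \<eta> \<psi>"
  show "vec_rel p E (coord \<eta>) (coord \<psi>)"
    unfolding vec_rel_def
  proof (intro allI impI)
    fix i j assume ij: "i \<noteq> j" "\<not> E i j"
    let ?c = "\<lambda>i. hat (free_gen i)"
    have c: "?c i \<in> carrier Fhat" for i by (intro hat_closed free_gen_closed)
    have "(N #>\<^bsub>Fhat\<^esub> ?c i) \<otimes>\<^bsub>Q\<^esub> (N #>\<^bsub>Fhat\<^esub> ?c j) = (N #>\<^bsub>Fhat\<^esub> ?c j) \<otimes>\<^bsub>Q\<^esub> (N #>\<^bsub>Fhat\<^esub> ?c i)"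
      using commuting_generators[OF ij] by (simp only: coset_mult[OF c c])
    then show "[coord \<eta> i * coord \<psi> j = coord \<eta> j * coord \<psi> i] (mod int p)"
      using L coset_closed[OF c] unfolding char_rel_def coord_def by blast
  qed
next
  assume R: "vec_rel p E (coord \<eta>) (coord \<psi>)"
  let ?S = "{i. coord \<eta> i \<noteq> 0} \<union> {i. coord \<psi> i \<noteq> 0}"
  have fin: "finite ?S" using coord_support \<eta> \<psi> by simp
  obtain U where U: "U \<in> FI" "\<forall>z\<in>carrier Fhat. \<forall>w\<in>carrier free_group. z U = U #>\<^bsub>free_group\<^esub> w \<longrightarrow>
      [\<eta> (N #>\<^bsub>Fhat\<^esub> z) = (\<Sum>i\<in>?S. coord \<eta> i * expsum i w)] (mod int p)"
    using char_value[OF \<eta> fin] by blast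
  obtain V where V: "V \<in> FI" "\<forall>z\<in>carrier Fhat. \<forall>w\<in>carrier free_group. z V = V #>\<^bsub>free_group\<^esub> w \<longrightarrow>
      [\<psi> (N #>\<^bsub>Fhat\<^esub> z) = (\<Sum>i\<in>?S. coord \<psi> i * expsum i w)] (mod int p)"
    using char_value[OF \<psi> fin] by blast
  \<comment> \<open>A single word for each element must serve the values of both characters and all
    edges inside the joint support; these are finitely many coordinates.\<close>
  let ?K = "(\<lambda>(k, l). kerU p k l) ` (?S \<times> ?S)"
  have "finite ({U, V} \<union> ?K)" "{U, V} \<union> ?K \<subseteq> FI" using fin U(1) V(1) kerU_FI[OF p0] by auto
  note repr = Fhat_repr_common[OF this]
  show "char_rel p Q \<eta> \<psi>"
    unfolding char_rel_def
  proof (intro ballI impI)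
    fix X Y assume "X \<in> carrier Q" "Y \<in> carrier Q" and XY: "X \<otimes>\<^bsub>Q\<^esub> Y = Y \<otimes>\<^bsub>Q\<^esub> X"
    then obtain x y where x: "x \<in> carrier Fhat" "X = N #>\<^bsub>Fhat\<^esub> x" and y: "y \<in> carrier Fhat" "Y = N #>\<^bsub>Fhat\<^esub> y"
      by (auto simp: carrier_FactGroup)
    have comm: "N #>\<^bsub>Fhat\<^esub> (x \<otimes>\<^bsub>Fhat\<^esub> y) = N #>\<^bsub>Fhat\<^esub> (y \<otimes>\<^bsub>Fhat\<^esub> x)"
      using XY unfolding x(2) y(2) coset_mult[OF x(1) y(1)] coset_mult[OF y(1) x(1)] .
    obtain u where u: "u \<in> carrier free_group" "\<forall>W\<in>{U, V} \<union> ?K. x W = W #>\<^bsub>free_group\<^esub> u"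
      using repr[OF x(1)] by blast
    obtain v where v: "v \<in> carrier free_group" "\<forall>W\<in>{U, V} \<union> ?K. y W = W #>\<^bsub>free_group\<^esub> v"
      using repr[OF y(1)] by blast
    let ?b = "\<lambda>i j. expsum i u * expsum j v - expsum i v * expsum j u"
    let ?c = "coord \<eta>" and ?d = "coord \<psi>"
    have X: "[\<eta> X = (\<Sum>i\<in>?S. ?c i * expsum i u)] (mod int p)" "[\<psi> X = (\<Sum>i\<in>?S. ?d i * expsum i u)] (mod int p)"
      using U(2) V(2) x u by blast+
    have Y: "[\<eta> Y = (\<Sum>i\<in>?S. ?c i * expsum i v)] (mod int p)" "[\<psi> Y = (\<Sum>i\<in>?S. ?d i * expsum i v)] (mod int p)"
      using U(2) V(2) y v by blast+
    have "[\<eta> X * \<psi> Y - \<eta> Y * \<psi> X = (\<Sum>i\<in>?S. ?c i * expsum i u) * (\<Sum>j\<in>?S. ?d j * expsum j v) -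
        (\<Sum>i\<in>?S. ?c i * expsum i v) * (\<Sum>j\<in>?S. ?d j * expsum j u)] (mod int p)"
      by (intro cong_diff cong_mult X Y)
    also have "(\<Sum>i\<in>?S. ?c i * expsum i u) * (\<Sum>j\<in>?S. ?d j * expsum j v) -
        (\<Sum>i\<in>?S. ?c i * expsum i v) * (\<Sum>j\<in>?S. ?d j * expsum j u) = (\<Sum>i\<in>?S. \<Sum>j\<in>?S. ?c i * ?d j * ?b i j)"
      by (simp only: sum_product sum_subtractf[symmetric] right_diff_distrib) (simp only: mult_ac)
    finally have 1: "[\<eta> X * \<psi> Y - \<eta> Y * \<psi> X = (\<Sum>i\<in>?S. \<Sum>j\<in>?S. ?c i * ?d j * ?b i j)] (mod int p)" .
    \<comment> \<open>Exchanging the indices changes the sign of \<open>?b\<close>, which turns the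
      doubled sum into one over the minors of the coefficients.\<close>
    have "(\<Sum>i\<in>?S. \<Sum>j\<in>?S. ?c i * ?d j * ?b i j) = (\<Sum>j\<in>?S. \<Sum>i\<in>?S. ?c i * ?d j * ?b i j)"
      by (rule sum.swap)
    also have "\<dots> = - (\<Sum>i\<in>?S. \<Sum>j\<in>?S. ?c j * ?d i * ?b i j)"
      by (simp add: sum_negf[symmetric] algebra_simps)
    finally have "2 * (\<Sum>i\<in>?S. \<Sum>j\<in>?S. ?c i * ?d j * ?b i j) =
        (\<Sum>i\<in>?S. \<Sum>j\<in>?S. ?c i * ?d j * ?b i j) - (\<Sum>i\<in>?S. \<Sum>j\<in>?S. ?c j * ?d i * ?b i j)"
      by linarith
    also have "\<dots> = (\<Sum>i\<in>?S. \<Sum>j\<in>?S. (?c i * ?d j - ?c j * ?d i) * ?b i j)"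
      by (simp add: sum_subtractf[symmetric] left_diff_distrib)
    also have "int p dvd \<dots>"
    proof (intro dvd_sum)
      fix i j assume ij: "i \<in> ?S" "j \<in> ?S"
      show "int p dvd (?c i * ?d j - ?c j * ?d i) * ?b i j"
      proof (cases "i \<noteq> j \<and> E i j")
        case True
        have K: "kerU p i j \<in> {U, V} \<union> ?K" using ij by blast
        have "int p dvd ?b i j"
          by (rule commuting_cosets[OF x(1) y(1) u(1) v(1) comm _ _ bspec[OF u(2) K] bspec[OF v(2) K]])
            (use True in simp_all)
        then show ?thesis by (rule dvd_mult)
      next
        case False
        then have "[?c i * ?d j = ?c j * ?d i] (mod int p)" using R by (cases "i = j") (auto simp: vec_rel_def)
        then show ?thesis by (intro dvd_mult2) (simp add: cong_iff_dvd_diff)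
      qed
    qed
    finally have "int p dvd (\<Sum>i\<in>?S. \<Sum>j\<in>?S. ?c i * ?d j * ?b i j)"
      using coprime_of_odd[OF p] by (simp add: coprime_dvd_mult_right_iff)
    then have "int p dvd \<eta> X * \<psi> Y - \<eta> Y * \<psi> X" using cong_dvd_iff[OF 1] by blast
    then show "[\<eta> X * \<psi> Y = \<eta> Y * \<psi> X] (mod int p)" by (simp add: cong_iff_dvd_diff)
  qed
qed

end

text \<open>Only a bijection preserving the relation is extracted, since the hubs are recovered from
  set-theoretic data: inclusions, intersections and cardinalities of sets of related
  vectors.\<close>

lemma vec_rel_bijection:
  assumes "graph_group p E" "graph_group p E'"
    and "top_group_iso (Fhat Mod kerN p E) (Mod_top Fhat Fhat_top (kerN p E))
      (Fhat Mod kerN p E') (Mod_top Fhat Fhat_top (kerN p E'))"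
  obtains \<Phi> where "bij_betw \<Phi> (vecs p) (vecs p)"
    and "\<And>a b. a \<in> vecs p \<Longrightarrow> b \<in> vecs p \<Longrightarrow> vec_rel p E' a b \<longleftrightarrow> vec_rel p E (\<Phi> a) (\<Phi> b)"
proof -
  interpret A: graph_group p E by fact
  interpret B: graph_group p E' by fact
  obtain f where f: "bij_betw f (chars p B.Q B.T) (chars p A.Q A.T)"
    "\<forall>\<eta>\<in>chars p B.Q B.T. \<forall>\<psi>\<in>chars p B.Q B.T. char_rel p B.Q \<eta> \<psi> \<longleftrightarrow> char_rel p A.Q (f \<eta>) (f \<psi>)"
    using chars_iso[OF assms(3) A.group_Q B.group_Q A.topspace_T B.topspace_T] by blast
  define c where "c = the_inv_into (chars p B.Q B.T) B.coord"
  have c: "bij_betw c (vecs p) (chars p B.Q B.T)"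
    unfolding c_def by (rule bij_betw_the_inv_into[OF B.bij_coord])
  have cc: "B.coord (c a) = a" if "a \<in> vecs p" for a
    unfolding c_def by (rule f_the_inv_into_f_bij_betw[OF B.bij_coord]) (use that in simp)
  have "bij_betw (A.coord \<circ> f \<circ> c) (vecs p) (vecs p)"
    using bij_betw_trans[OF c bij_betw_trans[OF f(1) A.bij_coord]] by (simp add: o_assoc)
  moreover have "vec_rel p E' a b \<longleftrightarrow> vec_rel p E ((A.coord \<circ> f \<circ> c) a) ((A.coord \<circ> f \<circ> c) b)"
    if a: "a \<in> vecs p" and b: "b \<in> vecs p" for a b
  proof -
    have ca: "c a \<in> chars p B.Q B.T" "f (c a) \<in> chars p A.Q A.T" if "a \<in> vecs p" for a
      using bij_betwE[OF c] bij_betwE[OF f(1)] that by blast+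
    show ?thesis
      using B.char_rel_iff[OF ca(1)[OF a] ca(1)[OF b]] A.char_rel_iff[OF ca(2)[OF a] ca(2)[OF b]]
        f(2) ca(1)[OF a] ca(1)[OF b] cc[OF a] cc[OF b] by simp
  qed
  ultimately show ?thesis using that by blast
qed

subsection \<open>Recovering the hubs of a graph\<close>

definition vecs_on :: "nat \<Rightarrow> nat set \<Rightarrow> (nat \<Rightarrow> int) set"
  where "vecs_on p S = {b. \<forall>i. (i \<in> S \<longrightarrow> b i \<in> {0..<int p}) \<and> (i \<notin> S \<longrightarrow> b i = 0)}"

lemma finite_vecs_on: "finite S \<Longrightarrow> finite (vecs_on p S)"
  unfolding vecs_on_def by (intro finite_set_of_finite_funs) auto

lemma card_vecs_on:
  assumes "finite S"
  shows "card (vecs_on p S) = p ^ card S"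
proof -
  have "bij_betw (\<lambda>b. restrict b S) (vecs_on p S) (S \<rightarrow>\<^sub>E {0..<int p})"
  proof (rule bij_betwI[of _ _ _ "\<lambda>b i. if i \<in> S then b i else 0"])
    show "(\<lambda>b. restrict b S) \<in> vecs_on p S \<rightarrow> S \<rightarrow>\<^sub>E {0..<int p}" by (auto simp: vecs_on_def)
    show "(\<lambda>b i. if i \<in> S then b i else 0) \<in> (S \<rightarrow>\<^sub>E {0..<int p}) \<rightarrow> vecs_on p S"
      by (auto simp: vecs_on_def PiE_iff)
    show "(\<lambda>i. if i \<in> S then restrict b S i else 0) = b" if "b \<in> vecs_on p S" for b
      using that by (auto simp: vecs_on_def)
    show "restrict (\<lambda>i. if i \<in> S then b i else 0) S = b" if "b \<in> S \<rightarrow>\<^sub>E {0..<int p}" for b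
      using that by (auto simp: restrict_def PiE_iff extensional_def)
  qed
  then have "card (vecs_on p S) = card (S \<rightarrow>\<^sub>E {0..<int p})" by (rule bij_betw_same_card)
  also have "\<dots> = p ^ card S" using assms by (simp add: card_PiE)
  finally show ?thesis .
qed

definition unit_vec :: "nat \<Rightarrow> nat \<Rightarrow> int"
  where "unit_vec i = (\<lambda>k. if k = i then 1 else 0)"

definition rels :: "nat \<Rightarrow> (nat \<Rightarrow> nat \<Rightarrow> bool) \<Rightarrow> (nat \<Rightarrow> int) \<Rightarrow> (nat \<Rightarrow> int) set"
  where "rels p E a = {b \<in> vecs p. vec_rel p E a b}"

definition star_vecs :: "nat \<Rightarrow> (nat \<Rightarrow> nat \<Rightarrow> bool) \<Rightarrow> nat \<Rightarrow> (nat \<Rightarrow> int) set"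
  where "star_vecs p E i = {b \<in> vecs p. \<forall>k. b k \<noteq> 0 \<longrightarrow> k = i \<or> E i k}"

definition hubs :: "(nat \<Rightarrow> nat \<Rightarrow> bool) \<Rightarrow> nat set"
  where "hubs E = {i. infinite {k. E i k}}"

text \<open>\<open>common\<close> makes the sets of related vectors finite unless the vector has at
  most one non-zero entry; \<open>nonadjacent\<close> separates the unit vectors from the zero
  vector, which is related to everything; \<open>hubs_nonadjacent\<close> makes the stars of
  distinct hubs distinct and keeps their centres out of the intersections.\<close>

locale hub_graph = graph_group +
  assumes common: "\<And>i j. i \<noteq> j \<Longrightarrow> finite {k. E i k \<and> E j k}"
    and nonadjacent: "\<And>i. \<exists>k. k \<noteq> i \<and> \<not> E i k"
    and hubs_nonadjacent: "\<And>i j. i \<in> hubs E \<Longrightarrow> j \<in> hubs E \<Longrightarrow> \<not> E i j"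
begin

lemma unit_vec: "unit_vec i \<in> vecs p"
  using p by (simp add: vecs_def unit_vec_def)

lemma not_dvd_mult:
  assumes "a \<in> vecs p" "b \<in> vecs p" "a i \<noteq> 0" "b k \<noteq> 0"
  shows "\<not> [a i * b k = 0] (mod int p)"
proof -
  have "\<not> int p dvd a i" "\<not> int p dvd b k"
    using assms dvd_iff_zero by (simp_all add: vecs_def)
  moreover have "prime (int p)" using p by simp
  ultimately show ?thesis by (simp add: cong_0_iff prime_dvd_mult_iff)
qed

text \<open>If \<open>b k \<noteq> 0\<close> at a vertex \<open>k\<close> outside the support of
  \<open>a\<close>, the minors force \<open>k\<close> to be adjacent to the whole support, hence to
  be a common neighbour of \<open>i\<close> and \<open>j\<close>.\<close>

lemma finite_rels:
  assumes a: "a \<in> vecs p" and ij: "i \<noteq> j" "a i \<noteq> 0" "a j \<noteq> 0"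
  shows "finite (rels p E a)"
proof (rule finite_subset)
  let ?S = "{k. a k \<noteq> 0} \<union> {k. E i k \<and> E j k}"
  show "finite (vecs_on p ?S)" using a common[OF ij(1)] by (intro finite_vecs_on) (simp add: vecs_def)
  show "rels p E a \<subseteq> vecs_on p ?S"
  proof
    fix b assume "b \<in> rels p E a"
    then have b: "b \<in> vecs p" and r: "vec_rel p E a b" by (simp_all add: rels_def)
    have "E l k" if k: "b k \<noteq> 0" "a k = 0" and l: "a l \<noteq> 0" for k l
    proof (rule ccontr)
      assume "\<not> E l k"
      moreover have "l \<noteq> k" using k(2) l by blast
      ultimately have "[a l * b k = a k * b l] (mod int p)" using r by (simp add: vec_rel_def)
      then show False using not_dvd_mult[OF a b l k(1)] k(2) by simp
    qed
    then have "b k = 0" if "k \<notin> ?S" for k using that ij by blast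
    then show "b \<in> vecs_on p ?S" using b by (simp add: vecs_on_def vecs_def)
  qed
qed

text \<open>For \<open>a\<close> supported at \<open>i\<close>, the condition at a non-edge
  \<open>ik\<close> reads \<open>a i * b k = 0\<close> mod \<open>p\<close>; non-edges avoiding
  \<open>i\<close> impose nothing.\<close>

lemma rels_single:
  assumes a: "a \<in> vecs p" "a i \<noteq> 0" "\<And>k. k \<noteq> i \<Longrightarrow> a k = 0"
  shows "rels p E a = star_vecs p E i"
proof (intro equalityI subsetI)
  fix b assume "b \<in> rels p E a"
  then have b: "b \<in> vecs p" and r: "vec_rel p E a b" by (simp_all add: rels_def)
  have "E i k" if k: "b k \<noteq> 0" "k \<noteq> i" for k
  proof (rule ccontr)
    assume "\<not> E i k"
    then have "[a i * b k = a k * b i] (mod int p)" using r k(2) by (simp add: vec_rel_def)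
    then show False using not_dvd_mult[OF a(1) b a(2) k(1)] a(3)[OF k(2)] by simp
  qed
  then show "b \<in> star_vecs p E i" using b by (auto simp: star_vecs_def)
next
  fix b assume b: "b \<in> star_vecs p E i"
  have "a k * b l = a l * b k" if kl: "k \<noteq> l" "\<not> E k l" for k l
  proof (cases "k = i")
    case True
    then have "b l = 0" "a l = 0" using b kl a(3) by (auto simp: star_vecs_def)
    then show ?thesis by simp
  next
    case False
    then have "b k = 0 \<or> l \<noteq> i" using b kl sym by (auto simp: star_vecs_def)
    then show ?thesis using a(3) False by auto
  qed
  then have "vec_rel p E a b" unfolding vec_rel_def by (metis cong_refl)
  then show "b \<in> rels p E a" using b by (simp add: rels_def star_vecs_def)
qed

lemma rels_unit_vec: "rels p E (unit_vec i) = star_vecs p E i"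
  by (rule rels_single[OF unit_vec]) (simp_all add: unit_vec_def)

lemma unit_vec_star: "unit_vec k \<in> star_vecs p E i \<longleftrightarrow> k = i \<or> E i k"
  using unit_vec by (auto simp: star_vecs_def) (simp_all add: unit_vec_def split: if_splits)

lemma star_vecs_neq: "star_vecs p E i \<noteq> vecs p"
  using nonadjacent unit_vec unit_vec_star by metis

lemma infinite_star_iff: "infinite (star_vecs p E i) \<longleftrightarrow> i \<in> hubs E"
proof
  assume "infinite (star_vecs p E i)"
  moreover have "star_vecs p E i \<subseteq> vecs_on p (insert i {k. E i k})"
    by (auto simp: star_vecs_def vecs_on_def vecs_def)
  ultimately show "i \<in> hubs E"
    using finite_vecs_on finite_subset unfolding hubs_def by blast
next
  assume "i \<in> hubs E"
  moreover have "inj unit_vec" by (rule injI) (metis unit_vec_def zero_neq_one)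
  ultimately have "infinite (unit_vec ` {k. E i k})"
    by (metis (no_types, lifting) finite_imageD hubs_def inj_on_subset mem_Collect_eq subset_UNIV)
  moreover have "unit_vec ` {k. E i k} \<subseteq> star_vecs p E i" using unit_vec_star by blast
  ultimately show "infinite (star_vecs p E i)" using finite_subset by blast
qed

text \<open>The zero vector is excluded because it is related to all vectors, and two non-zero
  entries are excluded by \<open>finite_rels\<close>.\<close>

lemma infinite_rels:
  assumes a: "a \<in> vecs p" and inf: "infinite (rels p E a)" "rels p E a \<noteq> vecs p"
  shows "\<exists>i\<in>hubs E. rels p E a = star_vecs p E i"
proof -
  have "\<exists>i. a i \<noteq> 0"
  proof (rule ccontr)
    assume "\<nexists>i. a i \<noteq> 0"
    then have "rels p E a = vecs p" by (auto simp: rels_def vec_rel_def)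
    then show False using inf(2) by blast
  qed
  then obtain i where i: "a i \<noteq> 0" by blast
  have "a k = 0" if "k \<noteq> i" for k using finite_rels[OF a] i that inf(1) by blast
  then have "rels p E a = star_vecs p E i" by (rule rels_single[OF a i])
  then show ?thesis using inf(1) infinite_star_iff by auto
qed

lemma star_vecs_inj: "inj_on (star_vecs p E) (hubs E)"
  by (rule inj_onI) (metis hubs_nonadjacent unit_vec_star)

lemma card_star_Int:
  assumes "i \<in> hubs E" "j \<in> hubs E" "i \<noteq> j"
  shows "card (star_vecs p E i \<inter> star_vecs p E j) = p ^ card {k. E i k \<and> E j k}"
proof -
  have "\<not> E i j" "\<not> E j i" using hubs_nonadjacent assms by blast+
  \<comment> \<open>The centre of one star is not in the other, so only common neighbours remain in
    the support.\<close>
  then have sub: "(\<forall>k. b k \<noteq> 0 \<longrightarrow> k = i \<or> E i k) \<and> (\<forall>k. b k \<noteq> 0 \<longrightarrow> k = j \<or> E j k) \<longleftrightarrow>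
      (\<forall>k. b k \<noteq> 0 \<longrightarrow> E i k \<and> E j k)" for b :: "nat \<Rightarrow> int"
    using assms(3) by blast
  have "vecs_on p {k. E i k \<and> E j k} \<subseteq> vecs p"
  proof
    fix b assume b: "b \<in> vecs_on p {k. E i k \<and> E j k}"
    then have "{k. b k \<noteq> 0} \<subseteq> {k. E i k \<and> E j k}" by (auto simp: vecs_on_def)
    then have "finite {k. b k \<noteq> 0}" using common[OF assms(3)] finite_subset by blast
    moreover have "b k \<in> {0..<int p}" for k using b p0 by (cases "E i k \<and> E j k") (auto simp: vecs_on_def)
    ultimately show "b \<in> vecs p" by (simp add: vecs_def)
  qed
  moreover have "star_vecs p E i \<inter> star_vecs p E j = {b \<in> vecs p. \<forall>k. b k \<noteq> 0 \<longrightarrow> E i k \<and> E j k}"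
    using sub unfolding star_vecs_def by blast
  ultimately have "star_vecs p E i \<inter> star_vecs p E j = vecs_on p {k. E i k \<and> E j k}"
    unfolding vecs_on_def by (auto simp: vecs_def)
  then show ?thesis using card_vecs_on[OF common[OF assms(3)]] by simp
qed

end

text \<open>The stars of hubs are exactly the infinite proper subsets of \<open>vecs p\<close> of
  the form \<open>rels p E a\<close>, a description that \<open>\<Phi>\<close> preserves. So
  \<open>\<Phi>\<close> maps stars to stars, and intersections of stars to intersections.\<close>

lemma hubs_bijection:
  assumes "hub_graph p E" "hub_graph p E'"
    and "top_group_iso (Fhat Mod kerN p E) (Mod_top Fhat Fhat_top (kerN p E))
      (Fhat Mod kerN p E') (Mod_top Fhat Fhat_top (kerN p E'))"
  obtains f where "bij_betw f (hubs E') (hubs E)"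
    and "\<And>i j. i \<in> hubs E' \<Longrightarrow> j \<in> hubs E' \<Longrightarrow> i \<noteq> j \<Longrightarrow>
      card {k. E' i k \<and> E' j k} = card {k. E (f i) k \<and> E (f j) k}"
proof -
  interpret A: hub_graph p E by fact
  interpret B: hub_graph p E' by fact
  obtain \<Phi> where \<Phi>: "bij_betw \<Phi> (vecs p) (vecs p)"
    and rel: "\<And>a b. a \<in> vecs p \<Longrightarrow> b \<in> vecs p \<Longrightarrow> vec_rel p E' a b \<longleftrightarrow> vec_rel p E (\<Phi> a) (\<Phi> b)"
    using vec_rel_bijection[OF A.graph_group_axioms B.graph_group_axioms assms(3)] by blast
  have cl: "\<Phi> a \<in> vecs p" if "a \<in> vecs p" for a using bij_betwE[OF \<Phi>] that by blast
  have inj: "inj_on \<Phi> (vecs p)" using \<Phi> by (simp add: bij_betw_def)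
  have sur: "\<exists>a\<in>vecs p. \<Phi> a = b" if "b \<in> vecs p" for b
    using \<Phi> that by (metis bij_betw_imp_surj_on imageE)
  have img: "\<Phi> ` rels p E' a = rels p E (\<Phi> a)" if a: "a \<in> vecs p" for a
  proof (intro equalityI subsetI)
    fix b assume "b \<in> \<Phi> ` rels p E' a"
    then show "b \<in> rels p E (\<Phi> a)" using rel[OF a] cl by (auto simp: rels_def)
  next
    fix b assume b: "b \<in> rels p E (\<Phi> a)"
    then obtain c where "c \<in> vecs p" "\<Phi> c = b" using sur by (auto simp: rels_def)
    then show "b \<in> \<Phi> ` rels p E' a" using b rel[OF a] by (auto simp: rels_def)
  qed
  have sv: "star_vecs p E' i \<subseteq> vecs p" for i by (auto simp: star_vecs_def)
  have sub: "rels p E' a \<subseteq> vecs p" for a by (auto simp: rels_def)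
  have inf: "infinite (rels p E (\<Phi> a)) \<longleftrightarrow> infinite (rels p E' a)" if "a \<in> vecs p" for a
    using finite_image_iff[OF inj_on_subset[OF inj sub]] img[OF that] by metis
  have full: "rels p E (\<Phi> a) = vecs p \<longleftrightarrow> rels p E' a = vecs p" if "a \<in> vecs p" for a
    using img[OF that] inj_on_image_eq_iff[OF inj sub order_refl] \<Phi> by (metis bij_betw_imp_surj_on)
  have ex: "\<exists>j\<in>hubs E. \<Phi> ` star_vecs p E' i = star_vecs p E j" if i: "i \<in> hubs E'" for i
  proof -
    let ?a = "unit_vec i"
    have "infinite (rels p E (\<Phi> ?a))" "rels p E (\<Phi> ?a) \<noteq> vecs p"
      using inf[OF B.unit_vec] full[OF B.unit_vec] B.rels_unit_vec B.infinite_star_iff i B.star_vecs_neq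
      by simp_all
    then show ?thesis
      using A.infinite_rels[OF cl[OF B.unit_vec]] img[OF B.unit_vec] B.rels_unit_vec by metis
  qed
  define f where "f i = (SOME j. j \<in> hubs E \<and> \<Phi> ` star_vecs p E' i = star_vecs p E j)" for i
  have f: "f i \<in> hubs E" "\<Phi> ` star_vecs p E' i = star_vecs p E (f i)" if "i \<in> hubs E'" for i
    using someI_ex[of "\<lambda>j. j \<in> hubs E \<and> \<Phi> ` star_vecs p E' i = star_vecs p E j"] ex[OF that]
    unfolding f_def by blast+
  have "bij_betw f (hubs E') (hubs E)"
    unfolding bij_betw_def
  proof
    show "inj_on f (hubs E')"
    proof (rule inj_onI)
      fix i j assume ij: "i \<in> hubs E'" "j \<in> hubs E'" "f i = f j"
      then have "\<Phi> ` star_vecs p E' i = \<Phi> ` star_vecs p E' j" using f by simp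
      then have "star_vecs p E' i = star_vecs p E' j"
        using inj_on_image_eq_iff[OF inj sv sv] by blast
      then show "i = j" using B.star_vecs_inj ij by (meson inj_onD)
    qed
    show "f ` hubs E' = hubs E"
    proof (intro equalityI subsetI)
      fix j assume j: "j \<in> hubs E"
      \<comment> \<open>The preimage \<open>a\<close> need not be a unit vector, but its set of
        related vectors is a star nevertheless.\<close>
      obtain a where a: "a \<in> vecs p" "\<Phi> a = unit_vec j" using sur[OF A.unit_vec] by blast
      have "infinite (rels p E' a)" "rels p E' a \<noteq> vecs p"
        using inf[OF a(1)] full[OF a(1)] a(2) A.rels_unit_vec A.infinite_star_iff j A.star_vecs_neq
        by simp_all
      then obtain i where i: "i \<in> hubs E'" "rels p E' a = star_vecs p E' i"
        using B.infinite_rels[OF a(1)] by blast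
      have "star_vecs p E (f i) = star_vecs p E j"
        using f(2)[OF i(1)] i(2) img[OF a(1)] a(2) A.rels_unit_vec by simp
      then have "f i = j" using A.star_vecs_inj f(1)[OF i(1)] j by (meson inj_onD)
      then show "j \<in> f ` hubs E'" using i(1) by blast
    qed (use f in blast)
  qed
  moreover have "card {k. E' i k \<and> E' j k} = card {k. E (f i) k \<and> E (f j) k}"
    if ij: "i \<in> hubs E'" "j \<in> hubs E'" "i \<noteq> j" for i j
  proof -
    have "f i \<noteq> f j" using calculation ij by (meson bij_betw_imp_inj_on inj_onD)
    have "\<Phi> ` (star_vecs p E' i \<inter> star_vecs p E' j) = star_vecs p E (f i) \<inter> star_vecs p E (f j)"
      using inj_on_image_Int[OF inj sv sv] f ij by metis
    then have "card (star_vecs p E (f i) \<inter> star_vecs p E (f j)) = card (star_vecs p E' i \<inter> star_vecs p E' j)"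
      using card_image[OF inj_on_subset[OF inj]] sv by (metis inf.coboundedI1)
    then have "p ^ card {k. E (f i) k \<and> E (f j) k} = p ^ card {k. E' i k \<and> E' j k}"
      using A.card_star_Int[OF f(1) f(1)] B.card_star_Int ij \<open>f i \<noteq> f j\<close> by simp
    \<comment> \<open>The exponents can be compared because the base \<open>p\<close> exceeds
      1.\<close>
    then show ?thesis using A.p by (simp add: power_inject_exp)
  qed
  ultimately show ?thesis using that by blast
qed

subsection \<open>Relabelling generators\<close>

definition relabel :: "(nat \<Rightarrow> nat) \<Rightarrow> word \<Rightarrow> word"
  where "relabel \<tau> w = map (map_prod \<tau> id) w"

text \<open>The coordinate at \<open>U\<close> is read off at the preimage of \<open>U\<close> under
  \<open>relabel \<tau>\<close>, which is its image under \<open>relabel \<sigma>\<close> when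
  \<open>\<sigma>\<close> inverts \<open>\<tau>\<close>. With both maps as arguments, the inverse is
  the same function with the arguments exchanged.\<close>

definition relabel_hat ::
  "(nat \<Rightarrow> nat) \<Rightarrow> (nat \<Rightarrow> nat) \<Rightarrow> (word set \<Rightarrow> word set) \<Rightarrow> word set \<Rightarrow> word set"
  where "relabel_hat \<tau> \<sigma> z = (\<lambda>U\<in>FI. relabel \<tau> ` z (relabel \<sigma> ` U))"

locale relabelling =
  fixes \<tau> \<sigma> :: "nat \<Rightarrow> nat"
  assumes \<sigma>\<tau> [simp]: "\<sigma> (\<tau> i) = i" and \<tau>\<sigma> [simp]: "\<tau> (\<sigma> i) = i"
begin

lemma inverse: "relabelling \<sigma> \<tau>"
  by unfold_locales simp_all

lemma \<tau>_eq_iff [simp]: "\<tau> i = \<tau> j \<longleftrightarrow> i = j"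
  by (metis \<sigma>\<tau>)

lemma relabel_relabel [simp]: "relabel \<sigma> (relabel \<tau> w) = w"
  by (simp add: relabel_def map_prod.compositionality o_def map_idI)

lemma reduced_relabel: "reduced (relabel \<tau> w) \<longleftrightarrow> reduced w"
  by (induction w rule: reduced.induct) (auto simp: relabel_def inv_letter_def)

lemma relabel_closed: "w \<in> carrier free_group \<Longrightarrow> relabel \<tau> w \<in> carrier free_group"
  by (simp add: carrier_free_group reduced_relabel)

lemma relabel_cons_reduce: "relabel \<tau> (cons_reduce a w) = cons_reduce (map_prod \<tau> id a) (relabel \<tau> w)"
  by (cases w) (auto simp: relabel_def inv_letter_def prod_eq_iff)

lemma relabel_mult:
  "relabel \<tau> (u \<otimes>\<^bsub>free_group\<^esub> v) = relabel \<tau> u \<otimes>\<^bsub>free_group\<^esub> relabel \<tau> v"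
proof (induction u)
  case (Cons a u)
  then show ?case by (simp add: relabel_cons_reduce) (simp add: relabel_def)
qed (simp add: relabel_def)

lemma expsum_relabel: "expsum (\<tau> i) (relabel \<tau> w) = expsum i w"
  by (induction w) (auto simp: relabel_def)

lemma heis_relabel: "heis (\<tau> i) (\<tau> j) (relabel \<tau> w) = heis i j w"
  by (induction w) (use expsum_relabel in \<open>auto simp: relabel_def\<close>)

lemma relabel_coset: "relabel \<tau> ` (U #>\<^bsub>free_group\<^esub> w) = relabel \<tau> ` U #>\<^bsub>free_group\<^esub> relabel \<tau> w"
  unfolding r_coset_eq_set_mult set_mult_def by (force simp: relabel_mult)

lemma relabel_relabel' [simp]: "relabel \<tau> (relabel \<sigma> w) = w"
  by (simp add: relabel_def map_prod.compositionality o_def map_idI)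

lemma relabel_image_image' [simp]: "relabel \<tau> ` relabel \<sigma> ` U = U"
  by (simp add: image_image)

lemma group_hom_relabel: "group_hom free_group free_group (relabel \<tau>)"
  by (simp add: group_hom_def group_hom_axioms_def group_free_group hom_def relabel_closed relabel_mult)

lemma relabel_image_image [simp]: "relabel \<sigma> ` relabel \<tau> ` U = U"
  by (simp add: image_image)

lemma relabel_free_gen: "relabel \<tau> (free_gen i) = free_gen (\<tau> i)"
  by (simp add: relabel_def free_gen_def)

lemma relabel_inv:
  assumes "w \<in> carrier free_group"
  shows "relabel \<tau> (inv\<^bsub>free_group\<^esub> w) = inv\<^bsub>free_group\<^esub> (relabel \<tau> w)"
  using group_hom.hom_inv[OF group_hom_relabel assms] .

text \<open>A permutation of the generators merely moves the finite set of generators outside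
  \<open>U\<close>, so the condition of convergence to 1 survives.\<close>

lemma relabel_FI:
  assumes "U \<in> FI"
  shows "relabel \<tau> ` U \<in> FI"
proof -
  have mem: "w \<in> relabel \<tau> ` U \<longleftrightarrow> relabel \<sigma> w \<in> U" for w
    by (metis image_iff relabel_relabel' relabel_relabel)
  have sub: "U \<subseteq> carrier free_group" using subgroup.subset[OF subgroup_FI[OF assms]] .
  have n: "relabel \<tau> ` U \<lhd> free_group"
    unfolding F.normal_inv_iff
  proof (intro conjI ballI F.subgroupI)
    show "relabel \<tau> ` U \<subseteq> carrier free_group" using sub relabel_closed by blast
    show "relabel \<tau> ` U \<noteq> {}" using subgroup.one_closed[OF subgroup_FI[OF assms]] by blast
    show "inv\<^bsub>free_group\<^esub> w \<in> relabel \<tau> ` U" if "w \<in> relabel \<tau> ` U" for w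
    proof -
      have "w \<in> carrier free_group" using that sub relabel_closed by blast
      then show ?thesis
        using that subgroup.m_inv_closed[OF subgroup_FI[OF assms]] by (simp add: mem relabelling.relabel_inv[OF inverse])
    qed
    show "u \<otimes>\<^bsub>free_group\<^esub> v \<in> relabel \<tau> ` U" if "u \<in> relabel \<tau> ` U" "v \<in> relabel \<tau> ` U" for u v
      using that subgroup.m_closed[OF subgroup_FI[OF assms]] by (simp add: mem relabelling.relabel_mult[OF inverse])
    show "x \<otimes>\<^bsub>free_group\<^esub> h \<otimes>\<^bsub>free_group\<^esub> inv\<^bsub>free_group\<^esub> x \<in> relabel \<tau> ` U"
      if "x \<in> carrier free_group" "h \<in> relabel \<tau> ` U" for x h
      using that normal.inv_op_closed2[OF normal_FI[OF assms], of "relabel \<sigma> x" "relabel \<sigma> h"]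
      by (simp add: mem relabelling.relabel_mult[OF inverse] relabelling.relabel_inv[OF inverse] relabelling.relabel_closed[OF inverse])
  qed
  have "finite (carrier (free_group Mod relabel \<tau> ` U))"
  proof (rule finite_Mod[of "\<lambda>w. U #>\<^bsub>free_group\<^esub> relabel \<sigma> w"])
    have "finite (carrier (free_group Mod U))" using assms by (simp add: fin_index_nsubgroups_def)
    then show "finite ((\<lambda>w. U #>\<^bsub>free_group\<^esub> relabel \<sigma> w) ` carrier free_group)"
      by (rule rev_finite_subset) (auto simp: carrier_FactGroup relabelling.relabel_closed[OF inverse])
    show "relabel \<tau> ` U #>\<^bsub>free_group\<^esub> u = relabel \<tau> ` U #>\<^bsub>free_group\<^esub> v"
      if "U #>\<^bsub>free_group\<^esub> relabel \<sigma> u = U #>\<^bsub>free_group\<^esub> relabel \<sigma> v" for u v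
      using arg_cong[OF that, of "image (relabel \<tau>)"] by (simp add: relabel_coset)
  qed
  moreover have "finite {i. free_gen i \<notin> relabel \<tau> ` U}"
  proof -
    have "{i. free_gen i \<notin> relabel \<tau> ` U} \<subseteq> \<tau> ` {i. free_gen i \<notin> U}"
    proof
      fix i assume "i \<in> {i. free_gen i \<notin> relabel \<tau> ` U}"
      then have "\<sigma> i \<in> {i. free_gen i \<notin> U}" by (simp add: mem relabelling.relabel_free_gen[OF inverse])
      then show "i \<in> \<tau> ` {i. free_gen i \<notin> U}" by (metis \<tau>\<sigma> imageI)
    qed
    moreover have "finite {i. free_gen i \<notin> U}" using assms by (simp add: fin_index_nsubgroups_def)
    ultimately show ?thesis by (meson finite_imageI finite_subset)
  qed
  ultimately show ?thesis using n by (simp add: fin_index_nsubgroups_def)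
qed

lemma relabel_kerU: "relabel \<tau> ` kerU p i j = kerU p (\<tau> i) (\<tau> j)"
proof (intro equalityI subsetI)
  fix w assume "w \<in> relabel \<tau> ` kerU p i j"
  then show "w \<in> kerU p (\<tau> i) (\<tau> j)"
    by (auto simp: kerU_def relabel_closed expsum_relabel heis_relabel)
next
  fix w assume w: "w \<in> kerU p (\<tau> i) (\<tau> j)"
  have "relabel \<sigma> w \<in> kerU p i j"
    using w relabelling.expsum_relabel[OF inverse, of "\<tau> i" w] relabelling.expsum_relabel[OF inverse, of "\<tau> j" w] relabelling.heis_relabel[OF inverse, of "\<tau> i" "\<tau> j" w]
    by (simp add: kerU_def relabelling.relabel_closed[OF inverse])
  then show "w \<in> relabel \<tau> ` kerU p i j" by (metis imageI relabel_relabel')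
qed

section \<open>The automorphism of the completion induced by a permutation of the generators\<close>

lemma relabel_hat_apply: "U \<in> FI \<Longrightarrow> relabel_hat \<tau> \<sigma> z U = relabel \<tau> ` z (relabel \<sigma> ` U)"
  by (simp add: relabel_hat_def)

lemma relabel_hat_repr:
  assumes "U \<in> FI" "z (relabel \<sigma> ` U) = relabel \<sigma> ` U #>\<^bsub>free_group\<^esub> w"
  shows "relabel_hat \<tau> \<sigma> z U = U #>\<^bsub>free_group\<^esub> relabel \<tau> w"
  using assms by (simp add: relabel_hat_apply relabel_coset)

lemma relabel_hat_closed:
  assumes z: "z \<in> carrier Fhat"
  shows "relabel_hat \<tau> \<sigma> z \<in> carrier Fhat"
proof -
  have "relabel_hat \<tau> \<sigma> z U \<in> carrier (free_group Mod U)" if U: "U \<in> FI" for U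
  proof -
    obtain w where w: "w \<in> carrier free_group" "z (relabel \<sigma> ` U) = relabel \<sigma> ` U #>\<^bsub>free_group\<^esub> w"
      using Fhat_repr[OF z relabelling.relabel_FI[OF inverse U]] by blast
    then show ?thesis using relabel_hat_repr[where z = z, OF U w(2)] relabel_closed[OF w(1)]
      by (simp add: carrier_FactGroup)
  qed
  moreover have "relabel_hat \<tau> \<sigma> z U \<subseteq> relabel_hat \<tau> \<sigma> z V" if "U \<in> FI" "V \<in> FI" "U \<subseteq> V" for U V
    unfolding relabel_hat_apply[OF that(1)] relabel_hat_apply[OF that(2)]
    using that by (intro image_mono Fhat_mono[OF z] relabelling.relabel_FI[OF inverse])
  moreover have "relabel_hat \<tau> \<sigma> z \<in> extensional FI" by (simp add: relabel_hat_def)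
  ultimately show ?thesis by (simp add: Fhat_def PiE_iff)
qed

lemma relabel_hat_mult:
  assumes x: "x \<in> carrier Fhat" and y: "y \<in> carrier Fhat"
  shows "relabel_hat \<tau> \<sigma> (x \<otimes>\<^bsub>Fhat\<^esub> y) = relabel_hat \<tau> \<sigma> x \<otimes>\<^bsub>Fhat\<^esub> relabel_hat \<tau> \<sigma> y"
proof (rule Fhat_eqI)
  fix U assume U: "U \<in> FI"
  have V: "relabel \<sigma> ` U \<in> FI" (is "?V \<in> _") by (rule relabelling.relabel_FI[OF inverse U])
  obtain u where u: "u \<in> carrier free_group" "x ?V = ?V #>\<^bsub>free_group\<^esub> u" using Fhat_repr[OF x V] by blast
  obtain v where v: "v \<in> carrier free_group" "y ?V = ?V #>\<^bsub>free_group\<^esub> v" using Fhat_repr[OF y V] by blast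
  have "(x \<otimes>\<^bsub>Fhat\<^esub> y) ?V = ?V #>\<^bsub>free_group\<^esub> (u \<otimes>\<^bsub>free_group\<^esub> v)"
    by (rule proj_mult[where x = x and y = y, OF V u(1) v(1) u(2) v(2)])
  then have "relabel_hat \<tau> \<sigma> (x \<otimes>\<^bsub>Fhat\<^esub> y) U = U #>\<^bsub>free_group\<^esub> (relabel \<tau> u \<otimes>\<^bsub>free_group\<^esub> relabel \<tau> v)"
    unfolding relabel_mult[symmetric] by (rule relabel_hat_repr[OF U])
  also have "\<dots> = (relabel_hat \<tau> \<sigma> x \<otimes>\<^bsub>Fhat\<^esub> relabel_hat \<tau> \<sigma> y) U"
    by (rule proj_mult[symmetric, where x = "relabel_hat \<tau> \<sigma> x" and y = "relabel_hat \<tau> \<sigma> y",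
          OF U relabel_closed[OF u(1)] relabel_closed[OF v(1)]
          relabel_hat_repr[where z = x, OF U u(2)] relabel_hat_repr[where z = y, OF U v(2)]])
  finally show "relabel_hat \<tau> \<sigma> (x \<otimes>\<^bsub>Fhat\<^esub> y) U = (relabel_hat \<tau> \<sigma> x \<otimes>\<^bsub>Fhat\<^esub> relabel_hat \<tau> \<sigma> y) U" .
qed (use x y relabel_hat_closed in simp_all)

lemma relabel_hat_inverse:
  assumes "z \<in> carrier Fhat"
  shows "relabel_hat \<sigma> \<tau> (relabel_hat \<tau> \<sigma> z) = z"
  by (rule Fhat_eqI)
    (simp_all add: assms relabel_hat_closed relabelling.relabel_hat_closed[OF inverse] relabelling.relabel_hat_apply[OF inverse]
      relabel_hat_apply relabel_FI)

text \<open>The coordinate at \<open>U\<close> of the image depends on a single coordinate of the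
  argument.\<close>

lemma continuous_map_relabel_hat: "continuous_map Fhat_top Fhat_top (relabel_hat \<tau> \<sigma>)"
  unfolding continuous_map_def
proof (intro conjI allI impI)
  show "relabel_hat \<tau> \<sigma> \<in> topspace Fhat_top \<rightarrow> topspace Fhat_top" by (simp add: relabel_hat_closed)
  fix W assume W: "openin Fhat_top W"
  show "openin Fhat_top {z \<in> topspace Fhat_top. relabel_hat \<tau> \<sigma> z \<in> W}"
  proof (subst openin_subopen, intro ballI)
    fix z assume "z \<in> {z \<in> topspace Fhat_top. relabel_hat \<tau> \<sigma> z \<in> W}"
    then have z: "z \<in> carrier Fhat" "relabel_hat \<tau> \<sigma> z \<in> W" by simp_all
    obtain U where U: "U \<in> FI" "\<forall>y\<in>carrier Fhat. y U = relabel_hat \<tau> \<sigma> z U \<longrightarrow> y \<in> W"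
      using openin_Fhat_top_nbhd[OF W z(2)] by blast
    let ?V = "relabel \<sigma> ` U"
    let ?O = "{y \<in> carrier Fhat. y ?V \<in> {z ?V}}"
    have "openin Fhat_top ?O" by (rule clopen_slice(1)[OF relabelling.relabel_FI[OF inverse U(1)]])
    moreover have "z \<in> ?O" using z(1) by simp
    moreover have "?O \<subseteq> {z \<in> topspace Fhat_top. relabel_hat \<tau> \<sigma> z \<in> W}"
      using U by (auto simp: relabel_hat_closed relabel_hat_apply)
    ultimately show "\<exists>O'. openin Fhat_top O' \<and> z \<in> O' \<and>
        O' \<subseteq> {z \<in> topspace Fhat_top. relabel_hat \<tau> \<sigma> z \<in> W}" by blast
  qed
qed

lemma relabel_hat_kerN:
  assumes "p > 0" "\<And>i j. E' (\<tau> i) (\<tau> j) \<longleftrightarrow> E i j" and z: "z \<in> kerN p E"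
  shows "relabel_hat \<tau> \<sigma> z \<in> kerN p E'"
proof (rule kerN_I)
  show "relabel_hat \<tau> \<sigma> z \<in> carrier Fhat" by (rule relabel_hat_closed[OF kerN_closed[OF z]])
  fix i j assume "i = j \<or> E' i j"
  then have "\<sigma> i = \<sigma> j \<or> E (\<sigma> i) (\<sigma> j)" using assms(2)[of "\<sigma> i" "\<sigma> j"] by auto
  then have "z (kerU p (\<sigma> i) (\<sigma> j)) = kerU p (\<sigma> i) (\<sigma> j)" by (rule kerN_apply[OF z])
  then have "relabel \<tau> ` z (relabel \<sigma> ` kerU p i j) = kerU p i j"
    by (simp add: relabelling.relabel_kerU[OF inverse] relabel_kerU)
  then show "relabel_hat \<tau> \<sigma> z (kerU p i j) = kerU p i j"
    by (simp add: relabel_hat_apply[OF kerU_FI[OF assms(1)]])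
qed

lemma relabel_hat_image_kerN:
  assumes "p > 0" "\<And>i j. E' (\<tau> i) (\<tau> j) \<longleftrightarrow> E i j"
  shows "relabel_hat \<tau> \<sigma> ` kerN p E = kerN p E'"
proof (intro equalityI subsetI)
  fix z assume z: "z \<in> kerN p E'"
  have "E (\<sigma> i) (\<sigma> j) \<longleftrightarrow> E' i j" for i j using assms(2)[of "\<sigma> i" "\<sigma> j"] by simp
  then have "relabel_hat \<sigma> \<tau> z \<in> kerN p E" using relabelling.relabel_hat_kerN[where E = E' and E' = E, OF inverse assms(1) _ z]
    by blast
  then show "z \<in> relabel_hat \<tau> \<sigma> ` kerN p E"
    using relabelling.relabel_hat_inverse[OF inverse kerN_closed[OF z]] by (metis imageI)
qed (use relabel_hat_kerN[where E = E and E' = E', OF assms] in blast)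

lemma relabel_hat_coset:
  assumes "p > 0" "\<And>i j. E' (\<tau> i) (\<tau> j) \<longleftrightarrow> E i j" and z: "z \<in> carrier Fhat"
  shows "relabel_hat \<tau> \<sigma> ` (kerN p E #>\<^bsub>Fhat\<^esub> z) = kerN p E' #>\<^bsub>Fhat\<^esub> relabel_hat \<tau> \<sigma> z"
proof -
  have "relabel_hat \<tau> \<sigma> ` (kerN p E #>\<^bsub>Fhat\<^esub> z) =
      (\<lambda>n. relabel_hat \<tau> \<sigma> (n \<otimes>\<^bsub>Fhat\<^esub> z)) ` kerN p E" by (auto simp: r_coset_def)
  also have "\<dots> = (\<lambda>n. relabel_hat \<tau> \<sigma> n \<otimes>\<^bsub>Fhat\<^esub> relabel_hat \<tau> \<sigma> z) ` kerN p E"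
    by (rule image_cong) (simp_all add: relabel_hat_mult[OF kerN_closed z])
  also have "\<dots> = (\<lambda>n. n \<otimes>\<^bsub>Fhat\<^esub> relabel_hat \<tau> \<sigma> z) ` relabel_hat \<tau> \<sigma> ` kerN p E"
    by (simp add: image_image)
  also have "\<dots> = kerN p E' #>\<^bsub>Fhat\<^esub> relabel_hat \<tau> \<sigma> z"
    unfolding relabel_hat_image_kerN[where E = E and E' = E', OF assms(1,2)] by (auto simp: r_coset_def)
  finally show ?thesis .
qed

lemma continuous_map_relabel_Mod:
  assumes "p > 0" "\<And>i j. E' (\<tau> i) (\<tau> j) \<longleftrightarrow> E i j"
  shows "continuous_map (Mod_top Fhat Fhat_top (kerN p E)) (Mod_top Fhat Fhat_top (kerN p E'))
    (image (relabel_hat \<tau> \<sigma>))"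
proof -
  have q: "continuous_map Fhat_top (Mod_top Fhat Fhat_top M) (\<lambda>x. M #>\<^bsub>Fhat\<^esub> x)" for M
    unfolding Mod_top_def by (intro quotient_imp_continuous_map quotient_map_quotient_topology)
  have "continuous_map Fhat_top (Mod_top Fhat Fhat_top (kerN p E'))
      ((\<lambda>x. kerN p E' #>\<^bsub>Fhat\<^esub> x) \<circ> relabel_hat \<tau> \<sigma>)"
    by (rule continuous_map_compose[OF continuous_map_relabel_hat q])
  then have "continuous_map Fhat_top (Mod_top Fhat Fhat_top (kerN p E'))
      (image (relabel_hat \<tau> \<sigma>) \<circ> (\<lambda>x. kerN p E #>\<^bsub>Fhat\<^esub> x))"
    by (rule continuous_map_eq) (simp add: relabel_hat_coset[where E = E and E' = E', OF assms])
  then show ?thesis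
    unfolding Mod_top_def[of _ _ "kerN p E"]
    by (rule continuous_compose_quotient_map[OF quotient_map_quotient_topology])
qed

text \<open>A graph isomorphism carries one kernel onto the other, so taking images maps cosets to
  cosets; continuity in both directions follows from the universal property of the quotient
  topology.\<close>

lemma top_group_iso_relabel:
  assumes p: "p > 0" and E: "\<And>i j. E' (\<tau> i) (\<tau> j) \<longleftrightarrow> E i j"
  shows "top_group_iso (Fhat Mod kerN p E) (Mod_top Fhat Fhat_top (kerN p E))
    (Fhat Mod kerN p E') (Mod_top Fhat Fhat_top (kerN p E'))"
proof -
  let ?h = "image (relabel_hat \<tau> \<sigma>)" and ?k = "image (relabel_hat \<sigma> \<tau>)"
  have E': "E (\<sigma> i) (\<sigma> j) \<longleftrightarrow> E' i j" for i j using E[of "\<sigma> i" "\<sigma> j"] by simp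
  note coset = relabel_hat_coset[where E = E and E' = E', OF p E]
    and coset' = relabelling.relabel_hat_coset[where E = E' and E' = E, OF inverse p E']
  note closed = relabel_hat_closed relabelling.relabel_hat_closed[OF inverse]
  have kh: "?k (?h C) = C" if C: "C \<in> carrier (Fhat Mod kerN p E)" for C
  proof -
    obtain z where "z \<in> carrier Fhat" "C = kerN p E #>\<^bsub>Fhat\<^esub> z" using C by (auto simp: carrier_FactGroup)
    then show ?thesis by (simp only: coset coset' closed relabel_hat_inverse)
  qed
  have hk: "?h (?k C) = C" if C: "C \<in> carrier (Fhat Mod kerN p E')" for C
  proof -
    obtain z where "z \<in> carrier Fhat" "C = kerN p E' #>\<^bsub>Fhat\<^esub> z" using C by (auto simp: carrier_FactGroup)
    then show ?thesis
      by (simp only: coset coset' closed relabelling.relabel_hat_inverse[OF inverse])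
  qed
  have hc: "?h C \<in> carrier (Fhat Mod kerN p E')" if "C \<in> carrier (Fhat Mod kerN p E)" for C
    using that by (auto simp: carrier_FactGroup coset relabel_hat_closed)
  have kc: "?k C \<in> carrier (Fhat Mod kerN p E)" if "C \<in> carrier (Fhat Mod kerN p E')" for C
    using that by (auto simp: carrier_FactGroup coset' relabelling.relabel_hat_closed[OF inverse])
  have ts: "topspace (Mod_top Fhat Fhat_top M) = carrier (Fhat Mod M)" for M
    by (simp add: Mod_top_def carrier_FactGroup)
  have "?h \<in> iso (Fhat Mod kerN p E) (Fhat Mod kerN p E')"
    unfolding iso_def
  proof (intro CollectI conjI)
    show "bij_betw ?h (carrier (Fhat Mod kerN p E)) (carrier (Fhat Mod kerN p E'))"
      by (rule bij_betwI[of _ _ _ ?k]) (use hc kc hk kh in blast)+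
    show "?h \<in> hom (Fhat Mod kerN p E) (Fhat Mod kerN p E')"
      unfolding hom_def
    proof (intro CollectI conjI ballI)
      show "?h \<in> carrier (Fhat Mod kerN p E) \<rightarrow> carrier (Fhat Mod kerN p E')" using hc by blast
      fix X Y assume "X \<in> carrier (Fhat Mod kerN p E)" "Y \<in> carrier (Fhat Mod kerN p E)"
      then obtain x y where x: "x \<in> carrier Fhat" "X = kerN p E #>\<^bsub>Fhat\<^esub> x"
        and y: "y \<in> carrier Fhat" "Y = kerN p E #>\<^bsub>Fhat\<^esub> y" by (auto simp: carrier_FactGroup)
      show "?h (X \<otimes>\<^bsub>Fhat Mod kerN p E\<^esub> Y) = ?h X \<otimes>\<^bsub>Fhat Mod kerN p E'\<^esub> ?h Y"
        using x y normal.rcos_sum[OF normal_kerN[OF p]]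
        by (simp add: coset relabel_hat_mult relabel_hat_closed)
    qed
  qed
  moreover have "homeomorphic_maps (Mod_top Fhat Fhat_top (kerN p E)) (Mod_top Fhat Fhat_top (kerN p E')) ?h ?k"
    unfolding homeomorphic_maps_def
    using continuous_map_relabel_Mod[where E = E and E' = E', OF p E] relabelling.continuous_map_relabel_Mod[where E = E' and E' = E, OF inverse p E'] hk kh
    by (simp only: ts) blast
  then have "homeomorphic_map (Mod_top Fhat Fhat_top (kerN p E)) (Mod_top Fhat Fhat_top (kerN p E')) ?h"
    using homeomorphic_map_maps by blast
  ultimately show ?thesis unfolding top_group_iso_def by blast
qed

end

subsection \<open>Coding structures as graphs\<close>

text \<open>The future hubs: the elements of the universe, one vertex for every relation index and
  tuple, and a reference vertex \<open>Star\<close> whose labels reveal the kind of every other main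
  vertex.\<close>

datatype main = Star | El nat | Tup nat "nat list"

text \<open>\<open>Leaf\<close> vertices are pendant. The \<open>Conn\<close> vertices of a pair
  realise its label as a number of common neighbours; they belong to ordered pairs, so the labels of
  the two orders add up.\<close>

datatype vert = Main main | Leaf main nat | Conn main main nat

instance main :: countable
  by countable_datatype

instance vert :: countable
  by countable_datatype

text \<open>With \<open>Star\<close>, elements have label 1 and tuples a label at least 2, which
  gives the relation index and, by parity, the truth value. Truth increases the label, so that it
  only adds edges. An element and a tuple are labelled by the set of positions at which the element
  occurs. At most one order of a pair has a non-zero label, so the sum over both orders loses
  nothing.\<close>

fun label :: "(nat \<Rightarrow> nat list \<Rightarrow> bool) \<Rightarrow> main \<Rightarrow> main \<Rightarrow> nat" where
  "label R Star (El a) = 1"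
| "label R Star (Tup n s) = 2 + 2 * n + of_bool (R n s)"
| "label R (El a) (Tup n s) = set_encode {i. i < length s \<and> s ! i = a}"
| "label R p q = 0"

text \<open>The label of a pair of main vertices becomes a number of common neighbours, and the leaves
  give the main vertices infinite degree, which distinguishes them from all other vertices.\<close>

fun inc :: "(nat \<Rightarrow> nat list \<Rightarrow> bool) \<Rightarrow> vert \<Rightarrow> vert \<Rightarrow> bool" where
  "inc R (Main p) (Leaf q k) \<longleftrightarrow> p = q"
| "inc R (Main p) (Conn q r k) \<longleftrightarrow> (p = q \<or> p = r) \<and> q \<noteq> r \<and> k < label R q r"
| "inc R u v \<longleftrightarrow> False"

definition adj :: "(nat \<Rightarrow> nat list \<Rightarrow> bool) \<Rightarrow> vert \<Rightarrow> vert \<Rightarrow> bool"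
  where "adj R u v \<longleftrightarrow> inc R u v \<or> inc R v u"

definition code_graph :: "(nat \<Rightarrow> nat list \<Rightarrow> bool) \<Rightarrow> nat \<Rightarrow> nat \<Rightarrow> bool"
  where "code_graph R i j \<longleftrightarrow> (\<exists>u v. i = to_nat u \<and> j = to_nat v \<and> adj R u v)"

section \<open>Degrees and common neighbours in the coded graph\<close>

lemma adj_sym: "adj R u v \<longleftrightarrow> adj R v u"
  by (auto simp: adj_def)

lemma code_graph_to_nat [simp]: "code_graph R (to_nat u) (to_nat v) \<longleftrightarrow> adj R u v"
  by (auto simp: code_graph_def)

lemma code_graph_neighbours: "{k. code_graph R (to_nat u) k} = to_nat ` {v. adj R u v}"
  by (auto simp: code_graph_def)

lemma finite_adj_Leaf: "finite {v. adj R (Leaf p k) v}"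
proof (rule finite_subset)
  show "{v. adj R (Leaf p k) v} \<subseteq> {Main p}"
  proof
    fix v assume "v \<in> {v. adj R (Leaf p k) v}"
    then show "v \<in> {Main p}" by (cases v) (auto simp: adj_def)
  qed
qed simp

lemma finite_adj_Conn: "finite {v. adj R (Conn p q k) v}"
proof (rule finite_subset)
  show "{v. adj R (Conn p q k) v} \<subseteq> {Main p, Main q}"
  proof
    fix v assume "v \<in> {v. adj R (Conn p q k) v}"
    then show "v \<in> {Main p, Main q}" by (cases v) (auto simp: adj_def)
  qed
qed simp

lemma infinite_adj_Main: "infinite {v. adj R (Main p) v}"
proof
  assume "finite {v. adj R (Main p) v}"
  moreover have "range (Leaf p) \<subseteq> {v. adj R (Main p) v}" by (auto simp: adj_def)
  ultimately have "finite (range (Leaf p))" by (rule rev_finite_subset)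
  moreover have "inj (Leaf p)" by (rule injI) simp
  ultimately show False using finite_imageD infinite_UNIV_nat by blast
qed

lemma hubs_code_graph: "hubs (code_graph R) = range (\<lambda>p. to_nat (Main p))"
proof -
  have "i \<in> hubs (code_graph R) \<longleftrightarrow> (\<exists>p. i = to_nat (Main p))" for i
  proof (cases "\<exists>u::vert. i = to_nat u")
    case True
    then obtain u :: vert where u: "i = to_nat u" by blast
    have "i \<in> hubs (code_graph R) \<longleftrightarrow> infinite {v. adj R u v}"
      unfolding hubs_def u mem_Collect_eq code_graph_neighbours
      by (simp add: finite_image_iff inj_on_def)
    then show ?thesis
      using finite_adj_Leaf finite_adj_Conn infinite_adj_Main u by (cases u) auto
  next
    \<comment> \<open>The encoding \<open>to_nat\<close> need not be onto; the numbers it omits are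
      isolated vertices.\<close>
    case False
    then have "{k. code_graph R i k} = {}" unfolding code_graph_def by blast
    then have "finite {k. code_graph R i k}" by (simp only: finite.emptyI)
    then have "i \<notin> hubs (code_graph R)" unfolding hubs_def by blast
    then show ?thesis using False by blast
  qed
  then show ?thesis by auto
qed

lemma common_neighbours:
  assumes "p \<noteq> q"
  shows "{k. code_graph R (to_nat (Main p)) k \<and> code_graph R (to_nat (Main q)) k} =
    to_nat ` (Conn p q ` {..<label R p q} \<union> Conn q p ` {..<label R q p})"
proof -
  have "adj R (Main p) v \<and> adj R (Main q) v \<longleftrightarrow>
      v \<in> Conn p q ` {..<label R p q} \<union> Conn q p ` {..<label R q p}" for v
    using assms by (cases v) (auto simp: adj_def)
  then have "{v. adj R (Main p) v \<and> adj R (Main q) v} =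
      Conn p q ` {..<label R p q} \<union> Conn q p ` {..<label R q p}" by blast
  moreover have "{k. code_graph R (to_nat (Main p)) k \<and> code_graph R (to_nat (Main q)) k} =
      to_nat ` {v. adj R (Main p) v \<and> adj R (Main q) v}"
    by (auto simp: code_graph_def)
  ultimately show ?thesis by (simp only:)
qed

lemma card_common_neighbours:
  assumes "p \<noteq> q"
  shows "card {k. code_graph R (to_nat (Main p)) k \<and> code_graph R (to_nat (Main q)) k} =
    label R p q + label R q p"
proof -
  have "card (to_nat ` (Conn p q ` {..<label R p q} \<union> Conn q p ` {..<label R q p})) =
      card (Conn p q ` {..<label R p q} \<union> Conn q p ` {..<label R q p})"
    by (rule card_image) (simp add: inj_on_def)
  also have "\<dots> = card (Conn p q ` {..<label R p q}) + card (Conn q p ` {..<label R q p})"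
    by (rule card_Un_disjoint) (use assms in auto)
  also have "\<dots> = label R p q + label R q p"
    by (simp add: card_image inj_on_def)
  finally show ?thesis by (simp only: common_neighbours[OF assms])
qed

text \<open>Two main vertices share only their finitely many connecting vertices and are never
  adjacent; all other vertices have finite degree.\<close>

lemma hub_graph_code_graph:
  assumes "prime p" "p \<ge> 3"
  shows "hub_graph p (code_graph R)"
proof
  let ?E = "code_graph R"
  show "prime p" "p \<ge> 3" by fact+
  show "?E j i" if "?E i j" for i j using that adj_sym unfolding code_graph_def by blast
  show non: "\<not> ?E i j" if ij: "i \<in> hubs ?E" "j \<in> hubs ?E" for i j
    using ij unfolding hubs_code_graph by (auto simp: adj_def)
  show "finite {k. ?E i k \<and> ?E j k}" if "i \<noteq> j" for i j
  proof (cases "i \<in> hubs ?E \<and> j \<in> hubs ?E")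
    case True
    then obtain q r where qr: "i = to_nat (Main q)" "j = to_nat (Main r)"
      unfolding hubs_code_graph by blast
    then have "q \<noteq> r" using that by blast
    then show ?thesis by (simp add: qr common_neighbours)
  next
    case False
    then have "finite {k. ?E i k} \<or> finite {k. ?E j k}" by (simp add: hubs_def)
    moreover have "{k. ?E i k \<and> ?E j k} \<subseteq> {k. ?E i k}" "{k. ?E i k \<and> ?E j k} \<subseteq> {k. ?E j k}" by auto
    ultimately show ?thesis using finite_subset by blast
  qed
  show "\<exists>k. k \<noteq> i \<and> \<not> ?E i k" for i
  proof (cases "i \<in> hubs ?E")
    case True
    obtain q where "i = to_nat (Main q)" using True unfolding hubs_code_graph by blast
    moreover obtain r where "r \<noteq> q" using main.distinct(1) by metis
    moreover have "to_nat (Main r) \<in> hubs ?E" by (simp add: hubs_code_graph)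
    ultimately have "to_nat (Main r) \<noteq> i" "\<not> ?E i (to_nat (Main r))"
      using non[OF True] by (simp, blast)
    then show ?thesis by blast
  next
    case False
    then have "finite (insert i {k. ?E i k})" by (simp add: hubs_def)
    then have "\<exists>k. k \<notin> insert i {k. ?E i k}" using ex_new_if_finite infinite_UNIV_nat by metis
    then show ?thesis by blast
  qed
qed

text \<open>\<open>Star\<close> is the only main vertex with non-zero labels to all others, so it is
  fixed. The labels with \<open>Star\<close> then show that elements go to elements, and tuples to
  tuples with the same index and truth value; the position sets identify the image of a
  tuple.\<close>

lemma label_isomorphism:
  assumes bij: "bij \<Psi>"
    and lab: "\<And>p q. p \<noteq> q \<Longrightarrow> label R' p q + label R' q p = label R (\<Psi> p) (\<Psi> q) + label R (\<Psi> q) (\<Psi> p)"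
  shows "\<exists>h. bij h \<and> (\<forall>n s. R' n s \<longleftrightarrow> R n (map h s))"
proof -
  have inj: "\<Psi> p = \<Psi> q \<longleftrightarrow> p = q" for p q using bij by (meson bij_is_inj injD)
  have sur: "\<exists>p. \<Psi> p = q" for q using bij by (metis bij_pointE)
  have star: "\<Psi> Star = Star"
  proof -
    obtain q where q: "\<Psi> q = Star" using sur by blast
    have "label R Star x + label R x Star \<noteq> 0" if "x \<noteq> Star" for x
      using that by (cases x) auto
    then have pos: "label R' q y + label R' y q \<noteq> 0" if "y \<noteq> q" for y
      using lab[of q y] that q inj by metis
    \<comment> \<open>Any other vertex has label 0 with a further vertex of its own kind.\<close>
    have "q = Star"
    proof (cases q)
      case (El a)
      then show ?thesis using pos[of "El (Suc a)"] by simp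
    next
      case (Tup n s)
      then show ?thesis using pos[of "Tup (Suc n) s"] by simp
    qed simp
    then show ?thesis using q by simp
  qed
  have "\<exists>b. \<Psi> (El a) = El b" for a
  proof -
    have "\<Psi> (El a) \<noteq> Star" using star inj by (metis main.distinct(1))
    moreover have "label R Star (\<Psi> (El a)) + label R (\<Psi> (El a)) Star = 1"
      using lab[of Star "El a"] star by simp
    ultimately show ?thesis by (cases "\<Psi> (El a)") auto
  qed
  then obtain h where h: "\<And>a. \<Psi> (El a) = El (h a)" by metis
  have tup: "\<exists>s'. \<Psi> (Tup n s) = Tup n s' \<and> R' n s = R n s'" for n s
  proof -
    have "\<Psi> (Tup n s) \<noteq> Star" using star inj by (metis main.distinct(3))
    moreover have "label R Star (\<Psi> (Tup n s)) + label R (\<Psi> (Tup n s)) Star = 2 + 2 * n + of_bool (R' n s)"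
      using lab[of Star "Tup n s"] star by simp
    ultimately show ?thesis
    proof (cases "\<Psi> (Tup n s)")
      case (Tup m t)
      then have "2 * m + of_bool (R m t) = 2 * n + (of_bool (R' n s) :: nat)"
        using lab[of Star "Tup n s"] star by simp
      \<comment> \<open>Parity separates the truth value from the relation index.\<close>
      then have "m = n \<and> (R m t \<longleftrightarrow> R' n s)" by (cases "R m t"; cases "R' n s") (simp_all, presburger+)
      then show ?thesis using Tup by auto
    qed simp_all
  qed
  have "bij h"
  proof (rule bijI)
    show "inj h" using h inj by (metis injI main.inject(1))
    show "surj h"
    proof (rule surjI)
      fix b
      show "h (SOME a. h a = b) = b"
      proof (rule someI_ex)
        obtain q where q: "\<Psi> q = El b" using sur by blast
        then show "\<exists>a. h a = b"
        proof (cases q)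
          case (Tup n s)
          then show ?thesis using tup[of n s] q by auto
        qed (use q star h in auto)
      qed
    qed
  qed
  have "R' n s \<longleftrightarrow> R n (map h s)" for n s
  proof -
    obtain t where t: "\<Psi> (Tup n s) = Tup n t" "R' n s = R n t" using tup by blast
    have pos: "{i. i < length s \<and> s ! i = a} = {i. i < length t \<and> t ! i = h a}" for a
      using lab[of "El a" "Tup n s"] h t(1) by (simp add: set_encode_eq)
    have 1: "i < length t \<and> t ! i = h (s ! i)" if "i < length s" for i
      using that pos[of "s ! i"] by blast
    \<comment> \<open>Each entry of \<open>t\<close> is some \<open>h a\<close>, and
      \<open>h a\<close> occurs in \<open>t\<close> only where \<open>a\<close> occurs in
      \<open>s\<close>; thus the lengths agree.\<close>
    have 2: "i < length s" if "i < length t" for i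
    proof -
      obtain a where "h a = t ! i" using \<open>bij h\<close> by (metis bij_pointE)
      then show ?thesis using that pos[of a] by auto
    qed
    have "t = map h s"
    proof (rule nth_equalityI)
      show "length t = length (map h s)" using 1 2 by (metis length_map linorder_neqE_nat less_irrefl)
      show "t ! i = map h s ! i" if "i < length t" for i using 1 2 that by simp
    qed
    then show ?thesis using t(2) by simp
  qed
  then show ?thesis using \<open>bij h\<close> by blast
qed

section \<open>From isomorphic quotients to isomorphic structures\<close>

lemma isomorphic_structures_of_iso:
  assumes "prime p" "p \<ge> 3"
    and "top_group_iso (Fhat Mod kerN p (code_graph R)) (Mod_top Fhat Fhat_top (kerN p (code_graph R)))
      (Fhat Mod kerN p (code_graph R')) (Mod_top Fhat Fhat_top (kerN p (code_graph R')))"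
  shows "\<exists>h. bij h \<and> (\<forall>n s. R' n s \<longleftrightarrow> R n (map h s))"
proof -
  let ?m = "\<lambda>q. to_nat (Main q)"
  obtain f where f: "bij_betw f (range ?m) (range ?m)"
    and card: "\<And>q r. q \<noteq> r \<Longrightarrow>
      card {k. code_graph R' (?m q) k \<and> code_graph R' (?m r) k} =
      card {k. code_graph R (f (?m q)) k \<and> code_graph R (f (?m r)) k}"
  proof (rule hubs_bijection[OF hub_graph_code_graph[OF assms(1,2)] hub_graph_code_graph[OF assms(1,2)] assms(3)])
    fix f assume f: "bij_betw f (hubs (code_graph R')) (hubs (code_graph R))"
      and c: "\<And>i j. i \<in> hubs (code_graph R') \<Longrightarrow> j \<in> hubs (code_graph R') \<Longrightarrow> i \<noteq> j \<Longrightarrow>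
        card {k. code_graph R' i k \<and> code_graph R' j k} = card {k. code_graph R (f i) k \<and> code_graph R (f j) k}"
    show thesis
    proof (rule that)
      show "bij_betw f (range ?m) (range ?m)" using f by (simp add: hubs_code_graph)
      show "card {k. code_graph R' (?m q) k \<and> code_graph R' (?m r) k} =
        card {k. code_graph R (f (?m q)) k \<and> code_graph R (f (?m r)) k}" if "q \<noteq> r" for q r
        using that by (intro c) (simp_all add: hubs_code_graph)
    qed
  qed
  have m: "bij_betw ?m UNIV (range ?m)" by (rule inj_on_imp_bij_betw) (simp add: inj_on_def)
  define \<Psi> where "\<Psi> = the_inv_into UNIV ?m \<circ> (f \<circ> ?m)"
  have "bij \<Psi>"
    unfolding \<Psi>_def by (intro bij_betw_trans[OF bij_betw_trans[OF m f]] bij_betw_the_inv_into m)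
  moreover have m\<Psi>: "?m (\<Psi> q) = f (?m q)" for q
    unfolding \<Psi>_def o_def by (rule f_the_inv_into_f_bij_betw[OF m]) (use bij_betwE[OF f] in blast)
  moreover have "label R' q r + label R' r q = label R (\<Psi> q) (\<Psi> r) + label R (\<Psi> r) (\<Psi> q)"
    if "q \<noteq> r" for q r
  proof -
    have "\<Psi> q \<noteq> \<Psi> r" using \<open>bij \<Psi>\<close> that by (meson bij_is_inj injD)
    then show ?thesis
      using card[OF that] card_common_neighbours[OF that, of R'] card_common_neighbours[of "\<Psi> q" "\<Psi> r" R]
      by (simp add: m\<Psi>[symmetric])
  qed
  ultimately show ?thesis by (intro label_isomorphism) auto
qed

section \<open>From isomorphic structures to isomorphic quotients\<close>

fun map_main :: "(nat \<Rightarrow> nat) \<Rightarrow> main \<Rightarrow> main" where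
  "map_main h Star = Star"
| "map_main h (El a) = El (h a)"
| "map_main h (Tup n s) = Tup n (map h s)"

fun map_vert :: "(nat \<Rightarrow> nat) \<Rightarrow> vert \<Rightarrow> vert" where
  "map_vert h (Main q) = Main (map_main h q)"
| "map_vert h (Leaf q k) = Leaf (map_main h q) k"
| "map_vert h (Conn q r k) = Conn (map_main h q) (map_main h r) k"

text \<open>The identity on numbers that code no vertex, so that a bijection \<open>h\<close>
  induces a permutation of all generators.\<close>

definition map_code :: "(nat \<Rightarrow> nat) \<Rightarrow> nat \<Rightarrow> nat"
  where "map_code h i = (if i \<in> range (to_nat :: vert \<Rightarrow> nat) then to_nat (map_vert h (from_nat i)) else i)"

lemma map_main_inverse: "(\<And>a. g (h a) = a) \<Longrightarrow> map_main g (map_main h q) = q"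
  by (cases q) (simp_all add: map_idI)

lemma map_vert_inverse: "(\<And>a. g (h a) = a) \<Longrightarrow> map_vert g (map_vert h v) = v"
  by (cases v) (simp_all add: map_main_inverse)

lemma map_code_to_nat [simp]: "map_code h (to_nat v) = to_nat (map_vert h v)"
  by (simp add: map_code_def)

lemma map_code_inverse: "(\<And>a. g (h a) = a) \<Longrightarrow> map_code g (map_code h i) = i"
  by (cases "i \<in> range (to_nat :: vert \<Rightarrow> nat)") (auto simp: map_vert_inverse, simp add: map_code_def)

lemma iso_of_isomorphic_structures:
  assumes "p > 0" "bij h" "\<And>n s. R' n s \<longleftrightarrow> R n (map h s)"
  shows "top_group_iso (Fhat Mod kerN p (code_graph R')) (Mod_top Fhat Fhat_top (kerN p (code_graph R')))
      (Fhat Mod kerN p (code_graph R)) (Mod_top Fhat Fhat_top (kerN p (code_graph R)))"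
proof -
  let ?g = "inv_into UNIV h"
  have gh: "?g (h a) = a" and hg: "h (?g a) = a" for a
    using assms(2) by (simp_all add: bij_is_inj bij_is_surj surj_f_inv_f)
  interpret relabelling "map_code h" "map_code ?g"
    by unfold_locales (simp_all add: map_code_inverse gh hg)
  have eq: "map_main h q = map_main h r \<longleftrightarrow> q = r" for q r
    using map_main_inverse[of ?g h] gh by metis
  have heq: "h a = h b \<longleftrightarrow> a = b" for a b using gh by metis
  have lab: "label R (map_main h q) (map_main h r) = label R' q r" for q r
  proof (cases q; cases r)
    fix a n s assume "q = El a" "r = Tup n s"
    moreover have "{i. i < length s \<and> map h s ! i = h a} = {i. i < length s \<and> s ! i = a}"
      by (auto simp: heq)
    ultimately show ?thesis by simp
  qed (simp_all add: assms(3))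
  have inc: "inc R (map_vert h u) (map_vert h v) \<longleftrightarrow> inc R' u v" for u v
    by (cases u; cases v) (simp_all add: eq lab)
  have "code_graph R (map_code h i) (map_code h j) \<longleftrightarrow> code_graph R' i j" for i j
  proof (cases "i \<in> range (to_nat :: vert \<Rightarrow> nat) \<and> j \<in> range (to_nat :: vert \<Rightarrow> nat)")
    case True
    then show ?thesis by (auto simp: adj_def inc)
  next
    case False
    then show ?thesis by (auto simp: code_graph_def map_code_def)
  qed
  then show ?thesis using top_group_iso_relabel[OF assms(1)] by blast
qed

text \<open>Relations occur only positively: one that holds raises a label from
  \<open>2 + 2 * n\<close> to \<open>3 + 2 * n\<close>, so lower bounds on labels, and with them
  edges, are open conditions.\<close>

lemma openin_code_graph:
  assumes "\<And>n s. openin X {x \<in> topspace X. R x n s}"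
  shows "openin X {x \<in> topspace X. code_graph (R x) i j}"
proof -
  have c: "openin X {x \<in> topspace X. b}" for b by (cases b) auto
  have lab: "openin X {x \<in> topspace X. k < label (R x) q r}" for k q r
  proof (cases "\<exists>n s. q = Star \<and> r = Tup n s")
    case True
    then obtain n s where qr: "q = Star" "r = Tup n s" by blast
    \<comment> \<open>Only the threshold \<open>k = 2 + 2 * n\<close> depends on the point.\<close>
    have "{x \<in> topspace X. k < label (R x) q r} =
        {x \<in> topspace X. k < 2 + 2 * n} \<union> {x \<in> topspace X. k = 2 + 2 * n} \<inter> {x \<in> topspace X. R x n s}"
      by (auto simp: qr)
    then show ?thesis by (simp only:) (intro openin_Un openin_Int c assms)
  next
    case False
    then have "label (R x) q r = label (\<lambda>n s. False) q r" for x
      by (cases q; cases r) simp_all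
    then show ?thesis using c by simp
  qed
  have inc: "openin X {x \<in> topspace X. inc (R x) u v}" for u v
  proof (cases "\<exists>q r s k. u = Main q \<and> v = Conn r s k")
    case True
    then obtain q r s k where uv: "u = Main q" "v = Conn r s k" by blast
    have "{x \<in> topspace X. inc (R x) u v} =
        {x \<in> topspace X. (q = r \<or> q = s) \<and> r \<noteq> s} \<inter> {x \<in> topspace X. k < label (R x) r s}"
      by (auto simp: uv)
    then show ?thesis by (simp only:) (intro openin_Int c lab)
  next
    case False
    then have "inc (R x) u v = inc (\<lambda>n s. False) u v" for x
      by (cases u; cases v) simp_all
    then show ?thesis using c by simp
  qed
  have adj: "openin X {x \<in> topspace X. adj (R x) u v}" for u v
  proof -
    have "{x \<in> topspace X. adj (R x) u v} = {x \<in> topspace X. inc (R x) u v} \<union> {x \<in> topspace X. inc (R x) v u}"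
      by (auto simp: adj_def)
    then show ?thesis by (simp only:) (intro openin_Un inc)
  qed
  have "{x \<in> topspace X. code_graph (R x) i j} =
      \<Union>{{x \<in> topspace X. adj (R x) u v} |u v. i = to_nat u \<and> j = to_nat v}"
    unfolding code_graph_def by blast
  moreover have "openin X \<dots>" using adj by (intro openin_Union) auto
  ultimately show ?thesis by simp
qed

subsection \<open>Coding orbits as isomorphism classes of structures\<close>

lemma polish_countable_base:
  assumes "polish_topology X"
  obtains U :: "nat \<Rightarrow> 'a set" where "\<And>n. openin X (U n)"
    and "\<And>A x. openin X A \<Longrightarrow> x \<in> A \<Longrightarrow> \<exists>n. x \<in> U n \<and> U n \<subseteq> A"
proof -
  have "metrizable_space X"
    using assms by (simp add: polish_topology_def completely_metrizable_imp_metrizable_space)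
  then obtain M d where M: "Metric_space M d" and X: "X = Metric_space.mtopology M d"
    unfolding metrizable_space_def by blast
  interpret Metric_space M d by fact
  obtain C where C: "countable C" "C \<subseteq> topspace X" "X closure_of C = topspace X"
    using assms unfolding polish_topology_def separable_space_def by blast
  define U where "U n = (case prod_decode n of (i, k) \<Rightarrow> mball (from_nat_into C i) (inverse (real (Suc k))))" for n
  have "openin X (U n)" for n by (simp add: U_def X split: prod.split)
  moreover have "\<exists>n. x \<in> U n \<and> U n \<subseteq> A" if A: "openin X A" "x \<in> A" for A x
  proof -
    obtain r where r: "r > 0" "mball x r \<subseteq> A" using A unfolding X openin_mtopology by blast
    obtain k where k: "inverse (real (Suc k)) < r / 2" using reals_Archimedean r(1) by (metis half_gt_zero)
    let ?e = "inverse (real (Suc k))"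
    have x: "x \<in> M" using openin_subset[OF A(1)] A(2) by (auto simp: X)
    then have "x \<in> X closure_of C" using C(3) by (simp add: X)
    moreover have "?e > 0" by simp
    ultimately obtain c where c: "c \<in> C" "c \<in> mball x ?e"
      unfolding X metric_closure_of by blast
    obtain i where i: "from_nat_into C i = c" using from_nat_into_surj[OF C(1) c(1)] by blast
    have Un: "U (prod_encode (i, k)) = mball c ?e" by (simp add: U_def i)
    have "x \<in> mball c ?e" using c(2) by (simp add: commute)
    moreover have "mball c ?e \<subseteq> mball x r"
      by (rule mball_subset) (use c(2) x k in \<open>auto simp: commute\<close>)
    ultimately show ?thesis using r(2) Un by blast
  qed
  ultimately show ?thesis using that by blast
qed

section \<open>The permutation group and its neighbourhoods of the identity\<close>

lemma carrier_Sinf: "carrier Sinf = {g. bij g}"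
  by (simp add: Sinf_def BijGroup_def Bij_def)

lemma mult_Sinf: "bij g \<Longrightarrow> bij h \<Longrightarrow> g \<otimes>\<^bsub>Sinf\<^esub> h = g \<circ> h"
  by (simp add: Sinf_def BijGroup_def Bij_def compose_def fun_eq_iff)

lemma one_Sinf: "\<one>\<^bsub>Sinf\<^esub> = id"
  by (simp add: Sinf_def BijGroup_def fun_eq_iff)

lemma topspace_Sinf_top: "topspace Sinf_top = carrier Sinf"
  by (simp add: Sinf_top_def)

lemma Sinf_top_nbhd:
  assumes "openin Sinf_top O'" "id \<in> O'"
  shows "\<exists>k. \<forall>g\<in>carrier Sinf. (\<forall>i<k. g i = i) \<longrightarrow> g \<in> O'"
proof -
  let ?D = "\<lambda>_::nat. discrete_topology (UNIV :: nat set)"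
  obtain T where T: "openin (product_topology ?D UNIV) T" "O' = T \<inter> carrier Sinf"
    using assms(1) unfolding Sinf_top_def openin_subtopology by blast
  have "id \<in> T" using T(2) assms(2) by simp
  from bspec[OF T(1)[unfolded openin_product_topology_alt] this]
  obtain W where W: "finite {i \<in> UNIV. W i \<noteq> topspace (?D i)}" "id \<in> Pi\<^sub>E UNIV W" "Pi\<^sub>E UNIV W \<subseteq> T"
    by (elim exE conjE)
  obtain k where k: "\<forall>i\<in>{i. W i \<noteq> UNIV}. i < k"
    using W(1) finite_nat_set_iff_bounded by auto
  have "g \<in> O'" if g: "g \<in> carrier Sinf" "\<forall>i<k. g i = i" for g
  proof -
    have "g i \<in> W i" for i
    proof (cases "i < k")
      case True
      then show ?thesis using g(2) PiE_mem[OF W(2), of i] by simp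
    next
      case False
      then have "W i = UNIV" using k by blast
      then show ?thesis by simp
    qed
    then have "g \<in> T" using W(3) by blast
    then show ?thesis using g(1) T(2) by blast
  qed
  then show ?thesis by blast
qed

text \<open>The action enters the structure of a point through open sets only, so the relations depend on
  the point in an open way, and no Baire category argument is needed.\<close>

definition orbit_struct ::
  "((nat \<Rightarrow> nat) \<Rightarrow> 'a \<Rightarrow> 'a) \<Rightarrow> (nat \<Rightarrow> 'a set) \<Rightarrow> 'a \<Rightarrow> nat \<Rightarrow> nat list \<Rightarrow> bool"
  where "orbit_struct \<phi> U x n s \<longleftrightarrow>
    (\<exists>g\<in>carrier Sinf. (\<forall>i<length s. g (s ! i) = i) \<and> \<phi> g x \<in> U n)"

locale polish_action =
  fixes X :: "'a topology" and \<phi> :: "(nat \<Rightarrow> nat) \<Rightarrow> 'a \<Rightarrow> 'a" and U :: "nat \<Rightarrow> 'a set"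
  assumes Hausdorff: "Hausdorff_space X" and act: "continuous_Sinf_action X \<phi>"
    and openU: "\<And>n. openin X (U n)"
    and baseU: "\<And>A x. openin X A \<Longrightarrow> x \<in> A \<Longrightarrow> \<exists>n. x \<in> U n \<and> U n \<subseteq> A"
begin

abbreviation R :: "'a \<Rightarrow> nat \<Rightarrow> nat list \<Rightarrow> bool"
  where "R \<equiv> orbit_struct \<phi> U"

lemma act_action: "group_action Sinf (topspace X) \<phi>"
  using act by (simp add: continuous_Sinf_action_def)

lemma act_cont: "continuous_map (prod_topology Sinf_top X) X (\<lambda>(\<sigma>, x). \<phi> \<sigma> x)"
  using act by (simp add: continuous_Sinf_action_def)

lemma act_closed: "bij g \<Longrightarrow> x \<in> topspace X \<Longrightarrow> \<phi> g x \<in> topspace X"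
  using group_action.element_image[OF act_action] by (simp add: carrier_Sinf)

lemma act_comp: "bij g \<Longrightarrow> bij h \<Longrightarrow> x \<in> topspace X \<Longrightarrow> \<phi> (g \<circ> h) x = \<phi> g (\<phi> h x)"
  using group_action.composition_rule[OF act_action, of x g h] by (simp add: carrier_Sinf mult_Sinf)

lemma act_id: "x \<in> topspace X \<Longrightarrow> \<phi> id x = x"
  using group_action.id_eq_one[OF act_action] by (metis one_Sinf restrict_apply')

lemma openin_R: "openin X {x \<in> topspace X. R x n s}"
proof -
  have "openin X {x \<in> topspace X. \<phi> g x \<in> U n}" if "bij g" for g
  proof -
    have "continuous_map X (prod_topology Sinf_top X) (\<lambda>x. (g, x))"
      using that by (simp add: continuous_map_paired topspace_Sinf_top carrier_Sinf)
    from continuous_map_compose[OF this act_cont] have "continuous_map X X (\<phi> g)"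
      by (simp add: o_def)
    then show ?thesis using openU openin_continuous_map_preimage by blast
  qed
  then have "openin X (\<Union>{{x \<in> topspace X. \<phi> g x \<in> U n} |g. bij g \<and> (\<forall>i<length s. g (s ! i) = i)})"
    by (intro openin_Union) auto
  moreover have "{x \<in> topspace X. R x n s} =
      \<Union>{{x \<in> topspace X. \<phi> g x \<in> U n} |g. bij g \<and> (\<forall>i<length s. g (s ! i) = i)}"
    by (auto simp: orbit_struct_def carrier_Sinf)
  ultimately show ?thesis by simp
qed

text \<open>A permutation \<open>g\<close> witnesses the relation for \<open>\<phi> h x\<close> and
  the moved tuple iff \<open>g \<circ> h\<close> witnesses it for \<open>x\<close> and the original
  one.\<close>

lemma R_equivariant:
  assumes h: "bij h" and x: "x \<in> topspace X"
  shows "R (\<phi> h x) n (map h s) \<longleftrightarrow> R x n s"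
proof
  assume "R (\<phi> h x) n (map h s)"
  then obtain g where g: "bij g" "\<forall>i<length s. g (h (s ! i)) = i" "\<phi> g (\<phi> h x) \<in> U n"
    by (auto simp: orbit_struct_def carrier_Sinf)
  have "\<phi> (g \<circ> h) x \<in> U n" using act_comp[OF g(1) h x] g(3) by simp
  then show "R x n s"
    unfolding orbit_struct_def carrier_Sinf using g h
    by (intro bexI[of _ "g \<circ> h"]) (auto intro: bij_comp)
next
  assume "R x n s"
  then obtain g where g: "bij g" "\<forall>i<length s. g (s ! i) = i" "\<phi> g x \<in> U n"
    by (auto simp: orbit_struct_def carrier_Sinf)
  let ?g = "g \<circ> inv_into UNIV h"
  have b: "bij ?g" using g(1) h by (simp add: bij_comp bij_imp_bij_inv)
  have "?g \<circ> h = g" using h by (simp add: fun_eq_iff bij_is_inj)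
  then have "\<phi> ?g (\<phi> h x) \<in> U n" using act_comp[OF b h x] g(3) by simp
  moreover have "\<forall>i<length (map h s). ?g (map h s ! i) = i" using g(2) h by (simp add: bij_is_inj)
  ultimately show "R (\<phi> h x) n (map h s)" using b unfolding orbit_struct_def carrier_Sinf by blast
qed

text \<open>A witness for the tuple \<open>[0..<k]\<close> fixes all numbers below \<open>k\<close>.
  For large \<open>k\<close> it is so close to the identity that it keeps \<open>y\<close> inside
  \<open>B\<close>, whereas equality of the structures provides such a witness moving
  \<open>y\<close> into \<open>A\<close>.\<close>

lemma R_inj:
  assumes x: "x \<in> topspace X" and y: "y \<in> topspace X" and eq: "R x = R y"
  shows "x = y"
proof (rule ccontr)
  assume "x \<noteq> y"
  then obtain A B where AB: "openin X A" "openin X B" "x \<in> A" "y \<in> B" "disjnt A B"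
    using Hausdorff x y unfolding Hausdorff_space_def by blast
  obtain n where n: "x \<in> U n" "U n \<subseteq> A" using baseU[OF AB(1,3)] by blast
  have "continuous_map Sinf_top (prod_topology Sinf_top X) (\<lambda>g. (g, y))"
    using y by (simp add: continuous_map_paired)
  from continuous_map_compose[OF this act_cont] have "continuous_map Sinf_top X (\<lambda>g. \<phi> g y)"
    by (simp add: o_def)
  then have "openin Sinf_top {g \<in> topspace Sinf_top. \<phi> g y \<in> B}"
    using AB(2) openin_continuous_map_preimage by blast
  moreover have "id \<in> {g \<in> topspace Sinf_top. \<phi> g y \<in> B}"
    using act_id[OF y] AB(4) by (simp add: topspace_Sinf_top carrier_Sinf)
  ultimately obtain k where k: "\<forall>g\<in>carrier Sinf. (\<forall>i<k. g i = i) \<longrightarrow> g \<in> {g \<in> topspace Sinf_top. \<phi> g y \<in> B}"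
    using Sinf_top_nbhd by blast
  \<comment> \<open>The identity is a witness, because \<open>x\<close> itself lies in
    \<open>U n\<close>.\<close>
  have "R x n [0..<k]"
    unfolding orbit_struct_def carrier_Sinf using n(1) act_id[OF x] by (intro bexI[of _ id]) auto
  then have "R y n [0..<k]" by (simp add: eq)
  then obtain g where "g \<in> carrier Sinf" "\<forall>i<k. g i = i" "\<phi> g y \<in> U n"
    by (auto simp: orbit_struct_def)
  then have "\<phi> g y \<in> B \<inter> A" using k n(2) by blast
  then show False using AB(5) by (auto simp: disjnt_def)
qed

text \<open>If \<open>h\<close> is an isomorphism of the structures, then by equivariance
  \<open>\<phi> h u\<close> and \<open>v\<close> have the same structure, hence coincide.\<close>

lemma orbit_equiv_iff:
  assumes u: "u \<in> topspace X" and v: "v \<in> topspace X"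
  shows "orbit_equiv \<phi> u v \<longleftrightarrow> (\<exists>h. bij h \<and> (\<forall>n s. R u n s \<longleftrightarrow> R v n (map h s)))"
proof
  assume "orbit_equiv \<phi> u v"
  then obtain h where "bij h" "v = \<phi> h u" by (auto simp: orbit_equiv_def orbit_def carrier_Sinf)
  then show "\<exists>h. bij h \<and> (\<forall>n s. R u n s \<longleftrightarrow> R v n (map h s))"
    using R_equivariant[OF _ u] by blast
next
  assume "\<exists>h. bij h \<and> (\<forall>n s. R u n s \<longleftrightarrow> R v n (map h s))"
  then obtain h where h: "bij h" "\<And>n s. R u n s \<longleftrightarrow> R v n (map h s)" by blast
  have "R (\<phi> h u) n s = R v n s" for n s
  proof -
    have "map h (map (inv_into UNIV h) s) = s" using h(1) by (simp add: map_idI bij_is_surj surj_f_inv_f)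
    then show ?thesis using R_equivariant[OF h(1) u, of n "map (inv_into UNIV h) s"] h(2)[of n "map (inv_into UNIV h) s"] by simp
  qed
  then have "\<phi> h u = v" using R_inj[OF act_closed[OF h(1) u] v] by blast
  then show "orbit_equiv \<phi> u v" using h(1) by (auto simp: orbit_equiv_def orbit_def carrier_Sinf)
qed

lemma orbit_equiv_sym:
  assumes "u \<in> topspace X" "v \<in> topspace X"
  shows "orbit_equiv \<phi> u v \<longleftrightarrow> orbit_equiv \<phi> v u"
  using group_action.orbit_sym[OF act_action] assms unfolding orbit_equiv_def by blast

end

theorem theorem7p1:
  fixes p :: nat
    and \<delta> :: "(word set \<Rightarrow> word set) \<Rightarrow> (word set \<Rightarrow> word set) \<Rightarrow> real"
    and X :: "'a topology"
    and \<phi> :: "(nat \<Rightarrow> nat) \<Rightarrow> 'a \<Rightarrow> 'a"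
  assumes "prime p" and "p \<ge> 3"
    and "compatible_metric Fhat_top \<delta>" and "bi_invariant Fhat \<delta>"
    and "polish_topology X" and "continuous_Sinf_action X \<phi>"
  shows "\<exists>g \<in> borel_of X \<rightarrow>\<^sub>M borel_of (nil2_exp_space p \<delta>).
    \<forall>u \<in> topspace X. \<forall>v \<in> topspace X.
      orbit_equiv \<phi> u v \<longleftrightarrow>
      top_group_iso (Fhat Mod g u) (Mod_top Fhat Fhat_top (g u))
                    (Fhat Mod g v) (Mod_top Fhat Fhat_top (g v))"
proof -
  obtain U :: "nat \<Rightarrow> 'a set" where U: "\<And>n. openin X (U n)"
    "\<And>A x. openin X A \<Longrightarrow> x \<in> A \<Longrightarrow> \<exists>n. x \<in> U n \<and> U n \<subseteq> A"
    using polish_countable_base[OF assms(5)] by blast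
  have "Hausdorff_space X"
    using assms(5) by (simp add: polish_topology_def completely_metrizable_imp_metrizable_space
        metrizable_imp_Hausdorff_space)
  then interpret polish_action X \<phi> U using assms(6) U by unfold_locales
  have p0: "p > 0" using assms(2) by simp
  define g where "g x = kerN p (code_graph (R x))" for x
  have "g \<in> borel_of X \<rightarrow>\<^sub>M borel_of (nil2_exp_space p \<delta>)"
  proof (rule measurable_kernel_map[OF assms(3,4)])
    show "g x \<in> nil2_exp_kernels p" if "x \<in> topspace X" for x
      unfolding g_def by (rule kerN_mem_kernels[OF assms(1,2)])
    show "openin X {x \<in> topspace X. A \<notin> (\<lambda>z. z V) ` g x}" if "V \<in> FI" for V A
      unfolding g_def by (intro openin_kerN_misses[OF p0 that] openin_code_graph openin_R)
  qed
  moreover have "orbit_equiv \<phi> u v \<longleftrightarrow>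
      top_group_iso (Fhat Mod g u) (Mod_top Fhat Fhat_top (g u))
        (Fhat Mod g v) (Mod_top Fhat Fhat_top (g v))"
    if uv: "u \<in> topspace X" "v \<in> topspace X" for u v
  proof
    assume "orbit_equiv \<phi> u v"
    then obtain h where "bij h" "\<And>n s. R u n s \<longleftrightarrow> R v n (map h s)" using orbit_equiv_iff[OF uv] by blast
    then show "top_group_iso (Fhat Mod g u) (Mod_top Fhat Fhat_top (g u))
        (Fhat Mod g v) (Mod_top Fhat Fhat_top (g v))"
      unfolding g_def by (rule iso_of_isomorphic_structures[OF p0])
  next
    assume "top_group_iso (Fhat Mod g u) (Mod_top Fhat Fhat_top (g u))
        (Fhat Mod g v) (Mod_top Fhat Fhat_top (g v))"
    \<comment> \<open>Characters pull back, so the isomorphism of structures runs from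
      \<open>v\<close> to \<open>u\<close>; symmetry of the orbit relation repairs the
      direction.\<close>
    then have "\<exists>h. bij h \<and> (\<forall>n s. R v n s \<longleftrightarrow> R u n (map h s))"
      unfolding g_def by (rule isomorphic_structures_of_iso[OF assms(1,2)])
    then show "orbit_equiv \<phi> u v"
      using orbit_equiv_iff[OF uv(2,1)] orbit_equiv_sym[OF uv] by blast
  qed
  ultimately show ?thesis by blast
qed

end
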